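(* Let $g$ be a Riemannian metric on $Q$, $L(v)=\frac12g(v,v)$, $\mathcal{D}$ a distribution on $Q$, and let $\hat g$ be a $\mathcal{D}$-preserving modification of $g$. For $q\in Q$ and $v_q\in\mathcal{D}_q$, let $c_{v_q}$ be the nonholonomic trajectory with initial velocity $v_q$, and let $h(t)$ be the 1-form along $c_{v_q}(t)$ determined by $\overline\nabla_{\dot c_{v_q}(t)}h(t)=\lambda(t)$, $h(0)=0$. Then $\hat g$ satisfies $$(B)\quad \Gamma_{(L,\mathcal{D})}(\theta_i)+\theta_kR^k_{ia}v^a+\lambda_i=0\ \text{ on } \mathcal{C}\text{, for all } i\text{, where }\theta_i=\hat g_{ai}v^a,$$ if and only if (for all $q\in Q$, $v_q\in\mathcal{D}_q$ and all $t$ in the domain of $c_{v_q}$) $$\hat g_{c_{v_q}(t)}\left(\dot c_{v_q}(t),W(t)\right)+\big(h(t)\big)\big(W(t)\big)=\hat g_q(v_q,w_q),\qquad\forall w_q\in\mathcal{D}^g_q,$$ where $W(t)$ is the parallel transport of $w_q\in\mathcal{D}^g_q$ along $c_{v_q}$ with respect to $\overline\nabla$.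
   Context: All objects are smooth and repeated indices are summed. $Q$ is an $n$-dimensional manifold, $\mathcal{D}$ has rank $m$, $\mathcal{D}^g$ is the $g$-orthogonal complement of $\mathcal{D}$, and $P:TQ\to\mathcal{D}$, $Q:TQ\to\mathcal{D}^g$ are the corresponding orthogonal projections (the letter $Q$ denotes both the manifold and this projection). A globally defined frame $\{X_\alpha\}=\{X_a,X_i\}$ on $Q$ is fixed, with $\{X_a\}$ ($a,b,c\in\{1,\dots,m\}$) spanning $\mathcal{D}$ and $\{X_i\}$ ($i,j,k\in\{1,\dots,n-m\}$) spanning $\mathcal{D}^g$; $[X_\alpha,X_\beta]=R^\gamma_{\alpha\beta}X_\gamma$; $\hat g_{\alpha\beta}=\hat g(X_\alpha,X_\beta)$; $\nabla^g_{X_\alpha}X_\beta=\Gamma^\gamma_{\alpha\beta}X_\gamma$ for the Levi-Civita connection of $g$; $\{X^a,X^i\}$ is the dual frame of 1-forms. Quasi-velocities $v^\alpha=(v^a,v^i)$ are the functions on $TQ$ with $v_q=v^\alpha X_\alpha(q)$; $\mathcal{C}=\{v^i=0\}$ is $\mathcal{D}$ viewed as a submanifold of $TQ$. $X^C$, $X^V$ are the complete and vertical lifts to $TQ$ of a vector field $X$ on $Q$. A symmetric $(0,2)$-tensor field $\hat g$ is a $\mathcal{D}$-preserving modification of $g$ if $\hat g|_{\mathcal{D}\times\mathcal{D}}=g|_{\mathcal{D}\times\mathcal{D}}$. The nonholonomic vector field $\Gamma_{(L,\mathcal{D})}$ is the unique vector field on $\mathcal{C}$ of the form $v^aX_a^C+f^aX_a^V$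 satisfying $\Gamma_{(L,\mathcal{D})}(X^V(L))-X^C(L)=0$ on $\mathcal{C}$ for all $X\in\mathrm{Sec}(\mathcal{D})$. Its base integral curves are the nonholonomic trajectories; $c_{v_q}$ is the one with $\dot c_{v_q}(0)=v_q$. The multipliers are the functions $\lambda_i=\Gamma_{(L,\mathcal{D})}(X_i^V(L))-X_i^C(L)$ on $\mathcal{C}$, and $\lambda(t)=\lambda_i(\dot c_{v_q}(t))\,X^i(c_{v_q}(t))$ is the corresponding 1-form along $c_{v_q}$. The linear connection $\overline\nabla$ on $Q$ is defined, for $X,Y\in\mathcal{X}(Q)$, by $$\overline\nabla_XY=P\big(\nabla^g_{P(X)}P(Y)\big)+P\big([Q(X),P(Y)]\big)+Q\big(\nabla^g_{Q(X)}Q(Y)\big)+Q\big([P(X),Q(Y)]\big);$$ equivalently $\overline\nabla_{X_a}X_b=\Gamma^c_{ab}X_c$, $\overline\nabla_{X_a}X_i=R^k_{ai}X_k$, $\overline\nabla_{X_i}X_a=R^c_{ia}X_c$, $\overline\nabla_{X_i}X_j=\Gamma^k_{ij}X_k$. For a 1-form $h(t)$ along $c_{v_q}$, $\overline\nabla_{\dot c_{v_q}(t)}h(t)$ is the 1-form along $c_{v_q}$ with $(\overline\nabla_{\dot c_{v_q}}h)(X)=\frac{d}{dt}(h(X))-h(\overline\nabla_{\dot c_{v_q}}X)$ for all vector fields $X(t)$ along $c_{v_q}$. *)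

theory Defs
  imports "HOL-Analysis.Analysis"
begin

section \<open>Smooth maps between Euclidean spaces\<close>

text \<open>The domain \<open>S\<close> is always an open set.\<close>

primrec Ck_on :: "nat \<Rightarrow> 'a::euclidean_space set \<Rightarrow> ('a \<Rightarrow> 'b::real_normed_vector) \<Rightarrow> bool" where
  "Ck_on 0 S f \<longleftrightarrow> continuous_on S f"
| "Ck_on (Suc k) S f \<longleftrightarrow>
     (\<forall>x\<in>S. f differentiable (at x)) \<and>
     (\<forall>v. Ck_on k S (\<lambda>x. frechet_derivative f (at x) v))"

definition smooth_on :: "'a::euclidean_space set \<Rightarrow> ('a \<Rightarrow> 'b::real_normed_vector) \<Rightarrow> bool" where
  "smooth_on S f \<longleftrightarrow> (\<forall>k. Ck_on k S f)"


section \<open>Smooth manifolds\<close>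

text \<open>
  A manifold is given by an atlas, a set of charts \<open>(U, \<phi>)\<close>; the underlying set is the union of
  the chart domains and its topology is the one induced by the charts. The dimension is \<open>DIM('e)\<close>.
  Values of a chart map \<open>\<phi>\<close> outside \<open>U\<close> are irrelevant.
\<close>

type_synonym ('q, 'e) chart = "'q set \<times> ('q \<Rightarrow> 'e)"
type_synonym ('q, 'e) atlas = "('q, 'e) chart set"

definition carrier :: "('q, 'e) atlas \<Rightarrow> 'q set" where
  "carrier A = (\<Union>\<kappa>\<in>A. fst \<kappa>)"

abbreviation chart_inv :: "('q, 'e) chart \<Rightarrow> 'e \<Rightarrow> 'q" where
  "chart_inv \<kappa> \<equiv> inv_into (fst \<kappa>) (snd \<kappa>)"

definition manifold_topology :: "('q, 'e::euclidean_space) atlas \<Rightarrow> 'q topology" where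
  "manifold_topology A =
     topology (\<lambda>U. U \<subseteq> carrier A \<and> (\<forall>\<kappa>\<in>A. open (snd \<kappa> ` (U \<inter> fst \<kappa>))))"

lemma openin_manifold_topology:
  assumes "\<forall>\<kappa>\<in>A. inj_on (snd \<kappa>) (fst \<kappa>)"
  shows "openin (manifold_topology A) U \<longleftrightarrow>
           U \<subseteq> carrier A \<and> (\<forall>\<kappa>\<in>A. open (snd \<kappa> ` (U \<inter> fst \<kappa>)))"
proof -
  let ?P = "\<lambda>U. U \<subseteq> carrier A \<and> (\<forall>\<kappa>\<in>A. open (snd \<kappa> ` (U \<inter> fst \<kappa>)))"
  have "istopology ?P"
    unfolding istopology_def
  proof (intro conjI allI impI)
    fix S T assume S: "?P S" and T: "?P T"
    have "open (snd \<kappa> ` (S \<inter> T \<inter> fst \<kappa>))" if k: "\<kappa> \<in> A" for \<kappa>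
    proof -
      have "snd \<kappa> ` (S \<inter> T \<inter> fst \<kappa>) = snd \<kappa> ` ((S \<inter> fst \<kappa>) \<inter> (T \<inter> fst \<kappa>))"
        by (simp add: Int_ac)
      also have "\<dots> = snd \<kappa> ` (S \<inter> fst \<kappa>) \<inter> snd \<kappa> ` (T \<inter> fst \<kappa>)"
        using assms k by (intro inj_on_image_Int[where C = "fst \<kappa>"]) auto
      finally show ?thesis using S T k by auto
    qed
    then show "S \<inter> T \<subseteq> carrier A" "\<forall>\<kappa>\<in>A. open (snd \<kappa> ` (S \<inter> T \<inter> fst \<kappa>))"
      using S by auto
  next
    fix K assume K: "\<forall>S\<in>K. ?P S"
    then show "\<Union>K \<subseteq> carrier A" by auto
    show "\<forall>\<kappa>\<in>A. open (snd \<kappa> ` (\<Union>K \<inter> fst \<kappa>))"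
    proof
      fix \<kappa> assume "\<kappa> \<in> A"
      have "snd \<kappa> ` (\<Union>K \<inter> fst \<kappa>) = (\<Union>S\<in>K. snd \<kappa> ` (S \<inter> fst \<kappa>))"
        by auto
      also have "open \<dots>"
        using K \<open>\<kappa> \<in> A\<close> by (intro open_UN) blast
      finally show "open (snd \<kappa> ` (\<Union>K \<inter> fst \<kappa>))" .
    qed
  qed
  then show ?thesis
    by (simp add: manifold_topology_def)
qed

definition smooth_manifold :: "('q, 'e::euclidean_space) atlas \<Rightarrow> bool" where
  "smooth_manifold A \<longleftrightarrow>
     (\<forall>\<kappa>\<in>A. inj_on (snd \<kappa>) (fst \<kappa>) \<and> open (snd \<kappa> ` fst \<kappa>)) \<and>
     (\<forall>\<kappa>\<in>A. \<forall>\<kappa>'\<in>A. open (snd \<kappa> ` (fst \<kappa> \<inter> fst \<kappa>')) \<and>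
        smooth_on (snd \<kappa> ` (fst \<kappa> \<inter> fst \<kappa>')) (snd \<kappa>' \<circ> chart_inv \<kappa>)) \<and>
     Hausdorff_space (manifold_topology A) \<and> second_countable (manifold_topology A)"

text \<open>Smoothness of a real function on an open set, and on an arbitrary subset of a manifold
  (local extendability).\<close>

definition smooth_fun_on :: "('q, 'e::euclidean_space) atlas \<Rightarrow> 'q set \<Rightarrow> ('q \<Rightarrow> real) \<Rightarrow> bool" where
  "smooth_fun_on A U f \<longleftrightarrow> (\<forall>\<kappa>\<in>A. smooth_on (snd \<kappa> ` (U \<inter> fst \<kappa>)) (f \<circ> chart_inv \<kappa>))"

definition smooth_fun_on_subset ::
    "('q, 'e::euclidean_space) atlas \<Rightarrow> 'q set \<Rightarrow> ('q \<Rightarrow> real) \<Rightarrow> bool" where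
  "smooth_fun_on_subset A S f \<longleftrightarrow>
     (\<forall>p\<in>S. \<exists>U F. openin (manifold_topology A) U \<and> p \<in> U \<and> smooth_fun_on A U F \<and>
        (\<forall>x\<in>U \<inter> S. F x = f x))"


section \<open>Tangent vectors\<close>

text \<open>
  A tangent vector at \<open>q\<close> is the family of its components in all the charts around \<open>q\<close>, related by
  the derivatives of the transition maps (equivalently, an equivalence class of pairs of a chart
  and a vector of the model space). It is extended by \<open>0\<close> to the other charts, so that vector
  space operations are pointwise and the zero vector is \<open>\<lambda>\<kappa>. 0\<close>.
\<close>

type_synonym ('q, 'e) tvec = "('q, 'e) chart \<Rightarrow> 'e"

definition transition_deriv ::
    "('q, 'e::euclidean_space) chart \<Rightarrow> ('q, 'e) chart \<Rightarrow> 'q \<Rightarrow> 'e \<Rightarrow> 'e" where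
  "transition_deriv \<kappa> \<kappa>' q = frechet_derivative (snd \<kappa>' \<circ> chart_inv \<kappa>) (at (snd \<kappa> q))"

definition tangent_space :: "('q, 'e::euclidean_space) atlas \<Rightarrow> 'q \<Rightarrow> ('q, 'e) tvec set" where
  "tangent_space A q =
     {v. (\<forall>\<kappa>. \<not> (\<kappa> \<in> A \<and> q \<in> fst \<kappa>) \<longrightarrow> v \<kappa> = 0) \<and>
         (\<forall>\<kappa>\<in>A. \<forall>\<kappa>'\<in>A. q \<in> fst \<kappa> \<and> q \<in> fst \<kappa>' \<longrightarrow> v \<kappa>' = transition_deriv \<kappa> \<kappa>' q (v \<kappa>))}"

text \<open>The tangent vector at \<open>q\<close> whose component in the chart \<open>\<kappa>\<close> is \<open>\<xi>\<close>.\<close>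

definition tvec_of ::
    "('q, 'e::euclidean_space) atlas \<Rightarrow> 'q \<Rightarrow> ('q, 'e) chart \<Rightarrow> 'e \<Rightarrow> ('q, 'e) tvec" where
  "tvec_of A q \<kappa> \<xi> = (\<lambda>\<kappa>'. if \<kappa>' \<in> A \<and> q \<in> fst \<kappa>' then transition_deriv \<kappa> \<kappa>' q \<xi> else 0)"

definition lincomb ::
    "nat set \<Rightarrow> (nat \<Rightarrow> real) \<Rightarrow> (nat \<Rightarrow> ('q, 'e::euclidean_space) tvec) \<Rightarrow> ('q, 'e) tvec" where
  "lincomb I c V = (\<lambda>\<kappa>. \<Sum>i\<in>I. c i *\<^sub>R V i \<kappa>)"

definition lin_span :: "nat set \<Rightarrow> (nat \<Rightarrow> ('q, 'e::euclidean_space) tvec) \<Rightarrow> ('q, 'e) tvec set" where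
  "lin_span I V = {lincomb I c V | c. True}"

definition lin_indep :: "nat set \<Rightarrow> (nat \<Rightarrow> ('q, 'e::euclidean_space) tvec) \<Rightarrow> bool" where
  "lin_indep I V \<longleftrightarrow> (\<forall>c. lincomb I c V = (\<lambda>\<kappa>. 0) \<longrightarrow> (\<forall>i\<in>I. c i = 0))"

definition chart_at :: "('q, 'e) atlas \<Rightarrow> 'q \<Rightarrow> ('q, 'e) chart" where
  "chart_at A q = (SOME \<kappa>. \<kappa> \<in> A \<and> q \<in> fst \<kappa>)"

text \<open>The derivative \<open>v(f)\<close> of a function in the direction of a tangent vector \<open>v\<close> at \<open>q\<close>.\<close>

definition dir_deriv ::
    "('q, 'e::euclidean_space) atlas \<Rightarrow> 'q \<Rightarrow> ('q, 'e) tvec \<Rightarrow> ('q \<Rightarrow> real) \<Rightarrow> real" where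
  "dir_deriv A q v f =
     (let \<kappa> = chart_at A q in frechet_derivative (f \<circ> chart_inv \<kappa>) (at (snd \<kappa> q)) (v \<kappa>))"


section \<open>The tangent bundle\<close>

definition tangent_bundle ::
    "('q, 'e::euclidean_space) atlas \<Rightarrow> ('q \<times> ('q, 'e) tvec) set" where
  "tangent_bundle A = (SIGMA q:carrier A. tangent_space A q)"

definition lift_chart ::
    "('q, 'e::euclidean_space) atlas \<Rightarrow> ('q, 'e) chart \<Rightarrow> ('q \<times> ('q, 'e) tvec, 'e \<times> 'e) chart" where
  "lift_chart A \<kappa> = (SIGMA q:fst \<kappa>. tangent_space A q, \<lambda>p. (snd \<kappa> (fst p), snd p \<kappa>))"

definition tangent_atlas ::
    "('q, 'e::euclidean_space) atlas \<Rightarrow> ('q \<times> ('q, 'e) tvec, 'e \<times> 'e) atlas" where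
  "tangent_atlas A = lift_chart A ` A"

lemma carrier_tangent_atlas: "carrier (tangent_atlas A) = tangent_bundle A"
  by (auto simp: carrier_def tangent_atlas_def tangent_bundle_def lift_chart_def)


section \<open>Vector fields\<close>

text \<open>Values of fields outside the carrier of the manifold are irrelevant.\<close>

type_synonym ('q, 'e) vfield = "'q \<Rightarrow> ('q, 'e) tvec"

definition local_rep :: "('q, 'e) chart \<Rightarrow> ('q, 'e) vfield \<Rightarrow> 'e \<Rightarrow> 'e" where
  "local_rep \<kappa> X x = X (chart_inv \<kappa> x) \<kappa>"

definition vector_field_on ::
    "('q, 'e::euclidean_space) atlas \<Rightarrow> 'q set \<Rightarrow> ('q, 'e) vfield \<Rightarrow> bool" where
  "vector_field_on A U X \<longleftrightarrow>
     (\<forall>q\<in>U. X q \<in> tangent_space A q) \<and>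
     (\<forall>\<kappa>\<in>A. smooth_on (snd \<kappa> ` (U \<inter> fst \<kappa>)) (local_rep \<kappa> X))"

abbreviation vector_field :: "('q, 'e::euclidean_space) atlas \<Rightarrow> ('q, 'e) vfield \<Rightarrow> bool" where
  "vector_field A \<equiv> vector_field_on A (carrier A)"

definition lie_bracket ::
    "('q, 'e::euclidean_space) atlas \<Rightarrow> ('q, 'e) vfield \<Rightarrow> ('q, 'e) vfield \<Rightarrow> ('q, 'e) vfield" where
  "lie_bracket A X Y q = (\<lambda>\<kappa>. if \<kappa> \<in> A \<and> q \<in> fst \<kappa> then
       frechet_derivative (local_rep \<kappa> Y) (at (snd \<kappa> q)) (X q \<kappa>)
       - frechet_derivative (local_rep \<kappa> X) (at (snd \<kappa> q)) (Y q \<kappa>) else 0)"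

text \<open>
  In the coordinates \<open>(x, \<xi>)\<close> of \<open>TQ\<close> given by a chart of \<open>Q\<close>, the vertical lift of \<open>X\<close> is
  \<open>(0, X(x))\<close> and the complete lift is \<open>(X(x), DX(x)\<cdot>\<xi>)\<close>.
\<close>

definition vertical_lift ::
    "('q, 'e::euclidean_space) atlas \<Rightarrow> ('q, 'e) vfield \<Rightarrow> ('q \<times> ('q, 'e) tvec, 'e \<times> 'e) vfield" where
  "vertical_lift A X p =
     (let \<kappa> = chart_at A (fst p)
      in tvec_of (tangent_atlas A) p (lift_chart A \<kappa>) (0, X (fst p) \<kappa>))"

definition complete_lift ::
    "('q, 'e::euclidean_space) atlas \<Rightarrow> ('q, 'e) vfield \<Rightarrow> ('q \<times> ('q, 'e) tvec, 'e \<times> 'e) vfield" where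
  "complete_lift A X p =
     (let \<kappa> = chart_at A (fst p)
      in tvec_of (tangent_atlas A) p (lift_chart A \<kappa>)
           (X (fst p) \<kappa>,
            frechet_derivative (local_rep \<kappa> X) (at (snd \<kappa> (fst p))) (snd p \<kappa>)))"


section \<open>Metrics, distributions and frames\<close>

type_synonym ('q, 'e) tensor2 = "'q \<Rightarrow> ('q, 'e) tvec \<Rightarrow> ('q, 'e) tvec \<Rightarrow> real"

definition symmetric_tensor :: "('q, 'e::euclidean_space) atlas \<Rightarrow> ('q, 'e) tensor2 \<Rightarrow> bool" where
  "symmetric_tensor A g \<longleftrightarrow>
     (\<forall>q\<in>carrier A. \<forall>u\<in>tangent_space A q. \<forall>v\<in>tangent_space A q. \<forall>w\<in>tangent_space A q. \<forall>a b.
        g q u v = g q v u \<and>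
        g q (\<lambda>\<kappa>. a *\<^sub>R u \<kappa> + b *\<^sub>R v \<kappa>) w = a * g q u w + b * g q v w) \<and>
     (\<forall>X Y. vector_field A X \<longrightarrow> vector_field A Y \<longrightarrow>
        smooth_fun_on A (carrier A) (\<lambda>q. g q (X q) (Y q)))"

definition riemannian_metric :: "('q, 'e::euclidean_space) atlas \<Rightarrow> ('q, 'e) tensor2 \<Rightarrow> bool" where
  "riemannian_metric A g \<longleftrightarrow> symmetric_tensor A g \<and>
     (\<forall>q\<in>carrier A. \<forall>v\<in>tangent_space A q. v \<noteq> (\<lambda>\<kappa>. 0) \<longrightarrow> g q v v > 0)"

type_synonym ('q, 'e) distr = "'q \<Rightarrow> ('q, 'e) tvec set"

definition distribution ::
    "('q, 'e::euclidean_space) atlas \<Rightarrow> nat \<Rightarrow> ('q, 'e) distr \<Rightarrow> bool" where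
  "distribution A m D \<longleftrightarrow>
     (\<forall>q\<in>carrier A. \<exists>U Y. openin (manifold_topology A) U \<and> q \<in> U \<and>
        (\<forall>a<m. vector_field_on A U (Y a)) \<and>
        (\<forall>x\<in>U. lin_indep {..<m} (\<lambda>a. Y a x) \<and> D x = lin_span {..<m} (\<lambda>a. Y a x)))"

definition orth_compl ::
    "('q, 'e::euclidean_space) atlas \<Rightarrow> ('q, 'e) tensor2 \<Rightarrow> ('q, 'e) distr \<Rightarrow> ('q, 'e) distr" where
  "orth_compl A g D q = {v \<in> tangent_space A q. \<forall>w\<in>D q. g q v w = 0}"

definition orth_proj ::
    "('q, 'e::euclidean_space) tensor2 \<Rightarrow> ('q, 'e) distr \<Rightarrow> 'q \<Rightarrow> ('q, 'e) tvec \<Rightarrow> ('q, 'e) tvec" where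
  "orth_proj g E q v = (THE u. u \<in> E q \<and> (\<forall>w\<in>E q. g q (\<lambda>\<kappa>. v \<kappa> - u \<kappa>) w = 0))"

definition preserving_modification ::
    "('q, 'e::euclidean_space) atlas \<Rightarrow> ('q, 'e) distr \<Rightarrow> ('q, 'e) tensor2 \<Rightarrow> ('q, 'e) tensor2 \<Rightarrow> bool" where
  "preserving_modification A D g gh \<longleftrightarrow> symmetric_tensor A gh \<and>
     (\<forall>q\<in>carrier A. \<forall>u\<in>D q. \<forall>v\<in>D q. gh q u v = g q u v)"

text \<open>
  Frames are indexed by \<open>0, \<dots>, n - 1\<close> with \<open>n = DIM('e)\<close>: the indices \<open>a < m\<close> belong to
  \<open>D\<close> and the indices \<open>i\<close> with \<open>m \<le> i < n\<close> to the orthogonal complement.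
\<close>

definition adapted_frame ::
    "('q, 'e::euclidean_space) atlas \<Rightarrow> ('q, 'e) tensor2 \<Rightarrow> nat \<Rightarrow> ('q, 'e) distr \<Rightarrow>
     (nat \<Rightarrow> ('q, 'e) vfield) \<Rightarrow> bool" where
  "adapted_frame A g m D X \<longleftrightarrow>
     m \<le> DIM('e) \<and> (\<forall>\<alpha><DIM('e). vector_field A (X \<alpha>)) \<and>
     (\<forall>q\<in>carrier A.
        lin_indep {..<DIM('e)} (\<lambda>\<alpha>. X \<alpha> q) \<and>
        lin_span {..<DIM('e)} (\<lambda>\<alpha>. X \<alpha> q) = tangent_space A q \<and>
        lin_span {..<m} (\<lambda>a. X a q) = D q \<and>
        lin_span {m..<DIM('e)} (\<lambda>i. X i q) = orth_compl A g D q)"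

text \<open>\<open>dual_frame X \<alpha> q\<close> is the value at \<open>q\<close> of the dual 1-form \<open>X\<^sup>\<alpha>\<close> (for \<open>\<alpha> < n\<close>).\<close>

definition dual_frame ::
    "(nat \<Rightarrow> ('q, 'e::euclidean_space) vfield) \<Rightarrow> nat \<Rightarrow> 'q \<Rightarrow> ('q, 'e) tvec \<Rightarrow> real" where
  "dual_frame X \<alpha> q v = (SOME c. v = lincomb {..<DIM('e)} c (\<lambda>\<beta>. X \<beta> q)) \<alpha>"

definition quasi_velocity ::
    "(nat \<Rightarrow> ('q, 'e::euclidean_space) vfield) \<Rightarrow> nat \<Rightarrow> 'q \<times> ('q, 'e) tvec \<Rightarrow> real" where
  "quasi_velocity X \<alpha> p = dual_frame X \<alpha> (fst p) (snd p)"

text \<open>\<open>structure_fun A X \<gamma> \<alpha> \<beta> = R\<^sup>\<gamma>\<^sub>\<alpha>\<^sub>\<beta>\<close>, the components of \<open>[X\<^sub>\<alpha>, X\<^sub>\<beta>]\<close>.\<close>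

definition structure_fun ::
    "('q, 'e::euclidean_space) atlas \<Rightarrow> (nat \<Rightarrow> ('q, 'e) vfield) \<Rightarrow> nat \<Rightarrow> nat \<Rightarrow> nat \<Rightarrow> 'q \<Rightarrow> real" where
  "structure_fun A X \<gamma> \<alpha> \<beta> q = dual_frame X \<gamma> q (lie_bracket A (X \<alpha>) (X \<beta>) q)"


section \<open>Connections\<close>

type_synonym ('q, 'e) connection = "('q, 'e) vfield \<Rightarrow> ('q, 'e) vfield \<Rightarrow> ('q, 'e) vfield"

definition linear_connection ::
    "('q, 'e::euclidean_space) atlas \<Rightarrow> ('q, 'e) connection \<Rightarrow> bool" where
  "linear_connection A nab \<longleftrightarrow>
     (\<forall>X Y. vector_field A X \<longrightarrow> vector_field A Y \<longrightarrow> vector_field A (nab X Y)) \<and>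
     (\<forall>X Y Z f. vector_field A X \<longrightarrow> vector_field A Y \<longrightarrow> vector_field A Z \<longrightarrow>
        smooth_fun_on A (carrier A) f \<longrightarrow>
        (\<forall>q\<in>carrier A.
           nab (\<lambda>x \<kappa>. X x \<kappa> + Y x \<kappa>) Z q = (\<lambda>\<kappa>. nab X Z q \<kappa> + nab Y Z q \<kappa>) \<and>
           nab (\<lambda>x \<kappa>. f x *\<^sub>R X x \<kappa>) Z q = (\<lambda>\<kappa>. f q *\<^sub>R nab X Z q \<kappa>) \<and>
           nab X (\<lambda>x \<kappa>. Y x \<kappa> + Z x \<kappa>) q = (\<lambda>\<kappa>. nab X Y q \<kappa> + nab X Z q \<kappa>) \<and>
           nab X (\<lambda>x \<kappa>. f x *\<^sub>R Z x \<kappa>) q =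
             (\<lambda>\<kappa>. dir_deriv A q (X q) f *\<^sub>R Z q \<kappa> + f q *\<^sub>R nab X Z q \<kappa>)))"

definition levi_civita ::
    "('q, 'e::euclidean_space) atlas \<Rightarrow> ('q, 'e) tensor2 \<Rightarrow> ('q, 'e) connection \<Rightarrow> bool" where
  "levi_civita A g nab \<longleftrightarrow> linear_connection A nab \<and>
     (\<forall>X Y Z. vector_field A X \<longrightarrow> vector_field A Y \<longrightarrow> vector_field A Z \<longrightarrow>
        (\<forall>q\<in>carrier A.
           (\<lambda>\<kappa>. nab X Y q \<kappa> - nab Y X q \<kappa>) = lie_bracket A X Y q \<and>
           dir_deriv A q (X q) (\<lambda>x. g x (Y x) (Z x)) = g q (nab X Y q) (Z q) + g q (Y q) (nab X Z q)))"

text \<open>The connection \<open>\<nabla>\<close>-bar associated with the connection \<open>nab\<close> and the splitting \<open>TQ = D \<oplus> D\<^sup>g\<close>.\<close>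

definition nabla_bar ::
    "('q, 'e::euclidean_space) atlas \<Rightarrow> ('q, 'e) tensor2 \<Rightarrow> ('q, 'e) distr \<Rightarrow> ('q, 'e) connection \<Rightarrow>
     ('q, 'e) connection" where
  "nabla_bar A g D nab X Y =
     (let P = (\<lambda>Z q. orth_proj g D q (Z q)); Q = (\<lambda>Z q. orth_proj g (orth_compl A g D) q (Z q))
      in (\<lambda>q \<kappa>. P (nab (P X) (P Y)) q \<kappa> + P (lie_bracket A (Q X) (P Y)) q \<kappa>
              + Q (nab (Q X) (Q Y)) q \<kappa> + Q (lie_bracket A (P X) (Q Y)) q \<kappa>))"


section \<open>Calculus along curves\<close>

definition has_velocity ::
    "('q, 'e::euclidean_space) atlas \<Rightarrow> (real \<Rightarrow> 'q) \<Rightarrow> real \<Rightarrow> ('q, 'e) tvec \<Rightarrow> bool" where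
  "has_velocity A \<gamma> t v \<longleftrightarrow> (\<forall>\<kappa>\<in>A. \<gamma> t \<in> fst \<kappa> \<longrightarrow>
     eventually (\<lambda>s. \<gamma> s \<in> fst \<kappa>) (nhds t) \<and>
     ((snd \<kappa> \<circ> \<gamma>) has_vector_derivative v \<kappa>) (at t))"

definition velocity ::
    "('q, 'e::euclidean_space) atlas \<Rightarrow> (real \<Rightarrow> 'q) \<Rightarrow> real \<Rightarrow> ('q, 'e) tvec" where
  "velocity A c t = (\<lambda>\<kappa>. if \<kappa> \<in> A \<and> c t \<in> fst \<kappa> then vector_derivative (snd \<kappa> \<circ> c) (at t) else 0)"

text \<open>
  Vector fields \<open>W\<close> along \<open>c\<close>, on the open interval \<open>J\<close>, have components \<open>W\<^sup>\<alpha>\<close> in the global frame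
  \<open>X\<close> that are differentiable in \<open>t\<close>. Asking for smooth components instead would change nothing
  below: solutions of the differential equations considered are automatically smooth.
\<close>

definition vector_field_along ::
    "('q, 'e::euclidean_space) atlas \<Rightarrow> (nat \<Rightarrow> ('q, 'e) vfield) \<Rightarrow> (real \<Rightarrow> 'q) \<Rightarrow> real set \<Rightarrow>
     (real \<Rightarrow> ('q, 'e) tvec) \<Rightarrow> bool" where
  "vector_field_along A X c J W \<longleftrightarrow>
     (\<forall>t\<in>J. W t \<in> tangent_space A (c t) \<and>
        (\<forall>\<alpha><DIM('e). (\<lambda>s. dual_frame X \<alpha> (c s) (W s)) differentiable (at t)))"

text \<open>
  The covariant derivative along \<open>c\<close> is \<open>(W\<^sup>\<alpha>)' X\<^sub>\<alpha> + W\<^sup>\<alpha> \<nabla>\<^bsub>c'\<^esub> X\<^sub>\<alpha>\<close>. A connection is tensorial in its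
  first argument, so \<open>\<nabla>\<^bsub>c'(t)\<^esub> X\<^sub>\<alpha>\<close> is computed with the extension of the vector \<open>c'(t)\<close> to a vector
  field that has constant components in the frame.
\<close>

definition cov_deriv_along ::
    "('q, 'e::euclidean_space) atlas \<Rightarrow> ('q, 'e) connection \<Rightarrow> (nat \<Rightarrow> ('q, 'e) vfield) \<Rightarrow>
     (real \<Rightarrow> 'q) \<Rightarrow> (real \<Rightarrow> ('q, 'e) tvec) \<Rightarrow> real \<Rightarrow> ('q, 'e) tvec" where
  "cov_deriv_along A nab X c W t =
     (let V = (\<lambda>q. lincomb {..<DIM('e)} (\<lambda>\<beta>. dual_frame X \<beta> (c t) (velocity A c t)) (\<lambda>\<beta>. X \<beta> q))
      in (\<lambda>\<kappa>. \<Sum>\<alpha><DIM('e).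
            deriv (\<lambda>s. dual_frame X \<alpha> (c s) (W s)) t *\<^sub>R X \<alpha> (c t) \<kappa>
            + dual_frame X \<alpha> (c t) (W t) *\<^sub>R nab V (X \<alpha>) (c t) \<kappa>))"

definition parallel_along ::
    "('q, 'e::euclidean_space) atlas \<Rightarrow> ('q, 'e) connection \<Rightarrow> (nat \<Rightarrow> ('q, 'e) vfield) \<Rightarrow>
     (real \<Rightarrow> 'q) \<Rightarrow> real set \<Rightarrow> (real \<Rightarrow> ('q, 'e) tvec) \<Rightarrow> bool" where
  "parallel_along A nab X c J W \<longleftrightarrow>
     vector_field_along A X c J W \<and> (\<forall>t\<in>J. cov_deriv_along A nab X c W t = (\<lambda>\<kappa>. 0))"

definition one_form_along ::
    "('q, 'e::euclidean_space) atlas \<Rightarrow> (real \<Rightarrow> 'q) \<Rightarrow> real set \<Rightarrow>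
     (real \<Rightarrow> ('q, 'e) tvec \<Rightarrow> real) \<Rightarrow> bool" where
  "one_form_along A c J h \<longleftrightarrow>
     (\<forall>t\<in>J. \<forall>u\<in>tangent_space A (c t). \<forall>v\<in>tangent_space A (c t). \<forall>a b.
        h t (\<lambda>\<kappa>. a *\<^sub>R u \<kappa> + b *\<^sub>R v \<kappa>) = a * h t u + b * h t v)"

text \<open>\<open>\<nabla>\<^bsub>c'\<^esub> h = l\<close> for 1-forms \<open>h\<close>, \<open>l\<close> along \<open>c\<close>: \<open>l(Y) = (h(Y))' - h(\<nabla>\<^bsub>c'\<^esub> Y)\<close> for all \<open>Y\<close>
  along \<open>c\<close>.\<close>

definition form_cov_deriv_along ::
    "('q, 'e::euclidean_space) atlas \<Rightarrow> ('q, 'e) connection \<Rightarrow> (nat \<Rightarrow> ('q, 'e) vfield) \<Rightarrow>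
     (real \<Rightarrow> 'q) \<Rightarrow> real set \<Rightarrow> (real \<Rightarrow> ('q, 'e) tvec \<Rightarrow> real) \<Rightarrow>
     (real \<Rightarrow> ('q, 'e) tvec \<Rightarrow> real) \<Rightarrow> bool" where
  "form_cov_deriv_along A nab X c J h l \<longleftrightarrow>
     one_form_along A c J h \<and>
     (\<forall>Y. vector_field_along A X c J Y \<longrightarrow> (\<forall>t\<in>J.
        (\<lambda>s. h s (Y s)) differentiable (at t) \<and>
        l t (Y t) = deriv (\<lambda>s. h s (Y s)) t - h t (cov_deriv_along A nab X c Y t)))"


section \<open>Nonholonomic dynamics\<close>

definition kinetic_lagrangian ::
    "('q, 'e) tensor2 \<Rightarrow> 'q \<times> ('q, 'e) tvec \<Rightarrow> real" where
  "kinetic_lagrangian g p = 1/2 * g (fst p) (snd p) (snd p)"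

definition constraint_set ::
    "('q, 'e::euclidean_space) atlas \<Rightarrow> ('q, 'e) distr \<Rightarrow> ('q \<times> ('q, 'e) tvec) set" where
  "constraint_set A D = (SIGMA q:carrier A. D q)"

text \<open>The function \<open>G(Y\<^sup>V(L)) - Y\<^sup>C(L)\<close>.\<close>

definition lagrange_expr ::
    "('q, 'e::euclidean_space) atlas \<Rightarrow> ('q \<times> ('q, 'e) tvec \<Rightarrow> real) \<Rightarrow>
     ('q \<times> ('q, 'e) tvec, 'e \<times> 'e) vfield \<Rightarrow> ('q, 'e) vfield \<Rightarrow> 'q \<times> ('q, 'e) tvec \<Rightarrow> real" where
  "lagrange_expr A L G Y p =
     dir_deriv (tangent_atlas A) p (G p)
       (\<lambda>r. dir_deriv (tangent_atlas A) r (vertical_lift A Y r) L)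
     - dir_deriv (tangent_atlas A) p (complete_lift A Y p) L"

text \<open>
  \<open>G\<close> is the vector field on the submanifold \<open>C = {v\<^sup>i = 0}\<close> of \<open>TQ\<close> that describes the
  nonholonomic dynamics. It is given as a field of tangent vectors of \<open>TQ\<close> at the points of \<open>C\<close>
  that are tangent to \<open>C\<close>, i.e. annihilate the functions \<open>v\<^sup>i\<close>.
\<close>

definition nonholonomic_field ::
    "('q, 'e::euclidean_space) atlas \<Rightarrow> ('q \<times> ('q, 'e) tvec \<Rightarrow> real) \<Rightarrow> nat \<Rightarrow> ('q, 'e) distr \<Rightarrow>
     (nat \<Rightarrow> ('q, 'e) vfield) \<Rightarrow> ('q \<times> ('q, 'e) tvec, 'e \<times> 'e) vfield \<Rightarrow> bool" where
  "nonholonomic_field A L m D X G \<longleftrightarrow>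
     (\<exists>f. (\<forall>a<m. smooth_fun_on_subset (tangent_atlas A) (constraint_set A D) (f a)) \<and>
        (\<forall>p\<in>constraint_set A D. G p =
           (\<lambda>K. \<Sum>a<m. quasi_velocity X a p *\<^sub>R complete_lift A (X a) p K
                      + f a p *\<^sub>R vertical_lift A (X a) p K))) \<and>
     (\<forall>p\<in>constraint_set A D. \<forall>i\<in>{m..<DIM('e)}.
        dir_deriv (tangent_atlas A) p (G p) (quasi_velocity X i) = 0) \<and>
     (\<forall>Y. vector_field A Y \<and> (\<forall>q\<in>carrier A. Y q \<in> D q) \<longrightarrow>
        (\<forall>p\<in>constraint_set A D. lagrange_expr A L G Y p = 0))"

text \<open>The multipliers \<open>\<lambda>\<^sub>i\<close>.\<close>

definition multiplier ::
    "('q, 'e::euclidean_space) atlas \<Rightarrow> ('q \<times> ('q, 'e) tvec \<Rightarrow> real) \<Rightarrow> (nat \<Rightarrow> ('q, 'e) vfield) \<Rightarrow>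
     ('q \<times> ('q, 'e) tvec, 'e \<times> 'e) vfield \<Rightarrow> nat \<Rightarrow> 'q \<times> ('q, 'e) tvec \<Rightarrow> real" where
  "multiplier A L X G i = lagrange_expr A L G (X i)"

definition multiplier_form ::
    "('q, 'e::euclidean_space) atlas \<Rightarrow> ('q \<times> ('q, 'e) tvec \<Rightarrow> real) \<Rightarrow> nat \<Rightarrow>
     (nat \<Rightarrow> ('q, 'e) vfield) \<Rightarrow> ('q \<times> ('q, 'e) tvec, 'e \<times> 'e) vfield \<Rightarrow> (real \<Rightarrow> 'q) \<Rightarrow>
     real \<Rightarrow> ('q, 'e) tvec \<Rightarrow> real" where
  "multiplier_form A L m X G c t w =
     (\<Sum>i\<in>{m..<DIM('e)}. multiplier A L X G i (c t, velocity A c t) * dual_frame X i (c t) w)"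

text \<open>
  \<open>c\<close> is a nonholonomic trajectory, defined on the open interval \<open>J\<close> around \<open>0\<close>: the projection
  to \<open>Q\<close> of an integral curve of \<open>G\<close> in \<open>C\<close>.
\<close>

definition nonholonomic_trajectory ::
    "('q, 'e::euclidean_space) atlas \<Rightarrow> ('q, 'e) distr \<Rightarrow>
     ('q \<times> ('q, 'e) tvec, 'e \<times> 'e) vfield \<Rightarrow> real set \<Rightarrow> (real \<Rightarrow> 'q) \<Rightarrow> bool" where
  "nonholonomic_trajectory A D G J c \<longleftrightarrow>
     open J \<and> is_interval J \<and> 0 \<in> J \<and>
     (\<exists>\<gamma>. \<forall>t\<in>J. \<gamma> t \<in> constraint_set A D \<and> has_velocity (tangent_atlas A) \<gamma> t (G (\<gamma> t)) \<and>
        c t = fst (\<gamma> t))"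

text \<open>The functions \<open>\<theta>\<^sub>i = gh\<^sub>a\<^sub>i v\<^sup>a\<close>, with the sum over \<open>a < m\<close>.\<close>

definition theta ::
    "nat \<Rightarrow> (nat \<Rightarrow> ('q, 'e::euclidean_space) vfield) \<Rightarrow> ('q, 'e) tensor2 \<Rightarrow> nat \<Rightarrow>
     'q \<times> ('q, 'e) tvec \<Rightarrow> real" where
  "theta m X gh i p = (\<Sum>a<m. gh (fst p) (X a (fst p)) (X i (fst p)) * quasi_velocity X a p)"

definition condition_B ::
    "('q, 'e::euclidean_space) atlas \<Rightarrow> ('q \<times> ('q, 'e) tvec \<Rightarrow> real) \<Rightarrow> nat \<Rightarrow> ('q, 'e) distr \<Rightarrow>
     (nat \<Rightarrow> ('q, 'e) vfield) \<Rightarrow> ('q \<times> ('q, 'e) tvec, 'e \<times> 'e) vfield \<Rightarrow> ('q, 'e) tensor2 \<Rightarrow> bool" where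
  "condition_B A L m D X G gh \<longleftrightarrow>
     (\<forall>i\<in>{m..<DIM('e)}. \<forall>p\<in>constraint_set A D.
        dir_deriv (tangent_atlas A) p (G p) (theta m X gh i)
        + (\<Sum>k\<in>{m..<DIM('e)}. \<Sum>a<m.
             theta m X gh k p * structure_fun A X k i a (fst p) * quasi_velocity X a p)
        + multiplier A L X G i p = 0)"

end

theory Submission
  imports Defs "HOL-Complex_Analysis.Great_Picard"
begin

text \<open>
  Let \<open>c\<close> be a nonholonomic trajectory, \<open>W\<close> a parallel field along \<open>c\<close> with \<open>W(0)\<close> in \<open>D\<^sup>g\<close>, and
  \<open>E = gh(c', W) + h(W)\<close>. Write \<open>B\<^sub>i\<close> for the left-hand side of condition (B). Everything follows
  from the balance law \<open>E'(t) = \<Sum>\<^sub>i B\<^sub>i(c'(t)) W\<^sup>i(t)\<close>, proved in \<open>momentum_derivative\<close>. The connection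
  preserves \<open>D\<close> and \<open>D\<^sup>g\<close>, so \<open>W\<close> stays in \<open>D\<^sup>g\<close> (\<open>parallel_stays_orthogonal\<close>) and
  \<open>gh(c', W) = \<theta>\<^sub>i W\<^sup>i\<close>. As \<open>c' = v\<^sup>a X\<^sub>a\<close>, the equation of parallel transport in \<open>D\<^sup>g\<close> involves only
  the brackets \<open>[X\<^sub>a, X\<^sub>k]\<close>: it is \<open>(W\<^sup>i)' = R\<^sup>i\<^sub>k\<^sub>a v\<^sup>a W\<^sup>k\<close>, which produces the middle term of (B),
  while the derivative of \<open>\<theta>\<^sub>i\<close> along the curve produces the first one. The equation for \<open>h\<close> says
  that \<open>h(W)' = \<lambda>\<^sub>i W\<^sup>i\<close>, the last one.

  Thus (B) makes \<open>E\<close> constant. Conversely, if \<open>E\<close> is constant whenever \<open>c\<close>, \<open>W\<close> and \<open>h\<close> exist, then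
  \<open>B\<^sub>i(v) = E'(0) = 0\<close> for a trajectory starting with velocity \<open>v\<close> and a parallel field starting at
  \<open>X\<^sub>i\<close>. For this, existence on a small time interval is enough (\<open>local_solution\<close>), and
  \<open>c\<close>, \<open>c'\<close>, \<open>W\<close>, \<open>h\<close> together solve one autonomous system. Peano's theorem yields a solution as
  soon as the structure functions, the connection coefficients, the components of \<open>G\<close> and the
  multipliers are known to be continuous.

  What remains is to prove this continuity and to compute derivatives on \<open>TQ\<close>. Both are done in the
  coordinates \<open>(x, \<eta>)\<close> of the vector \<open>\<eta>\<^sup>\<alpha> X\<^sub>\<alpha>\<close> at \<open>x\<close>. They are related to the charts of \<open>TQ\<close> by a map whose inverse is differentiable by the inverse function theorem
  (\<open>frame_coord_chart_has_derivative\<close>). In them the vertical lift of \<open>X\<^sub>\<beta>\<close> is \<open>(0, e\<^sub>\<beta>)\<close>, the complete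
  lift is \<open>(X\<^sub>\<beta>, \<eta>\<^sup>\<alpha> R\<^sup>\<gamma>\<^sub>\<alpha>\<^sub>\<beta> e\<^sub>\<gamma>)\<close>, and the multipliers get an explicit formula
  (\<open>multiplier_formula\<close>).
\<close>

section \<open>Existence of solutions of ordinary differential equations\<close>

lemma lipschitz_of_bounded_vector_derivative:
  fixes Y :: "real \<Rightarrow> 'a::real_normed_vector"
  assumes "convex I" "\<And>t. t \<in> I \<Longrightarrow> (Y has_vector_derivative Y' t) (at t within I)"
    and "\<And>t. t \<in> I \<Longrightarrow> norm (Y' t) \<le> M" "s \<in> I" "t \<in> I"
  shows "norm (Y s - Y t) \<le> M * \<bar>s - t\<bar>"
proof -
  have "onorm (\<lambda>h. h *\<^sub>R Y' t) \<le> M" if "t \<in> I" for t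
    using assms(3)[OF that] by (intro onorm_le) (simp add: mult.commute[of M] mult_left_mono)
  then have "norm (Y s - Y t) \<le> M * norm (s - t)"
    using assms by (intro differentiable_bound[of I Y "\<lambda>t h. h *\<^sub>R Y' t"])
      (auto simp: has_vector_derivative_def)
  then show ?thesis by simp
qed

text \<open>
  Tonelli's method. The function \<open>\<sigma>\<close> moves the time \<open>t\<close> towards \<open>0\<close> by the delay \<open>h\<close>, so the slope of
  a solution at \<open>t\<close> only depends on its values at times closer to \<open>0\<close>. Successive iterates therefore
  agree for \<open>\<bar>t\<bar> \<le> j h\<close> after \<open>j\<close> steps and no longer change once \<open>j h \<ge> T\<close>. The condition
  \<open>M T \<le> r\<close> keeps all iterates in the ball on which \<open>F\<close> is controlled.
\<close>

lemma delayed_solution_exists: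
  fixes F :: "'a::euclidean_space \<Rightarrow> 'a"
  assumes "0 < h" "0 < T" "0 \<le> M" "M * T \<le> r"
    and F: "continuous_on (cball y0 r) F" "\<And>y. y \<in> cball y0 r \<Longrightarrow> norm (F y) \<le> M"
  defines "I \<equiv> {-T..T}" and "\<sigma> \<equiv> \<lambda>t. t - max (- h) (min h t)"
  shows "\<exists>Y. Y 0 = y0 \<and> Y ` I \<subseteq> cball y0 r \<and>
           (\<forall>t\<in>I. (Y has_vector_derivative F (Y (\<sigma> t))) (at t within I))"
proof -
  define adm where "adm Y \<longleftrightarrow> Y 0 = y0 \<and> continuous_on I Y \<and> Y ` I \<subseteq> cball y0 r" for Y
  have \<sigma>I: "\<sigma> t \<in> I" if "t \<in> I" for t using that assms(1,2) by (auto simp: I_def \<sigma>_def)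
  have c\<sigma>: "continuous_on I \<sigma>" unfolding \<sigma>_def by (intro continuous_intros)
  have step: "\<exists>Y. adm Y \<and> (\<forall>t\<in>I. (Y has_vector_derivative F (Z (\<sigma> t))) (at t within I))"
    if Z: "adm Z" for Z
  proof -
    have Zin: "Z (\<sigma> t) \<in> cball y0 r" if "t \<in> I" for t using Z \<sigma>I[OF that] by (auto simp: adm_def)
    have "continuous_on I (\<lambda>t. Z (\<sigma> t))"
      by (rule continuous_on_compose2[of I Z]) (use Z c\<sigma> \<sigma>I in \<open>auto simp: adm_def\<close>)
    then have "continuous_on I (\<lambda>t. F (Z (\<sigma> t)))"
      by (rule continuous_on_compose2[OF F(1)]) (use Zin in auto)
    then obtain Y0 where Y0: "\<And>t. t \<in> I \<Longrightarrow> (Y0 has_vector_derivative F (Z (\<sigma> t))) (at t within I)"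
      unfolding I_def using antiderivative_continuous by blast
    define Y where "Y t = Y0 t - Y0 0 + y0" for t
    have Y: "(Y has_vector_derivative F (Z (\<sigma> t))) (at t within I)" if "t \<in> I" for t
      unfolding Y_def by (auto intro!: derivative_eq_intros Y0[OF that])
    have "norm (Y t - y0) \<le> r" if "t \<in> I" for t
    proof -
      have "norm (Y t - Y 0) \<le> M * \<bar>t - 0\<bar>"
        by (rule lipschitz_of_bounded_vector_derivative[of I, OF _ Y])
          (use that F(2) Zin assms(2) in \<open>auto simp: I_def\<close>)
      also have "\<dots> \<le> M * T" using that assms(3) by (intro mult_left_mono) (auto simp: I_def)
      finally show ?thesis using assms(4) by (simp add: Y_def)
    qed
    moreover have "continuous_on I Y"
      using Y by (auto simp: continuous_on_eq_continuous_within intro: has_vector_derivative_continuous)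
    ultimately have "adm Y" by (auto simp: adm_def Y_def dist_norm norm_minus_commute)
    with Y show ?thesis by blast
  qed
  have iter: "\<exists>Y Z. adm Y \<and> adm Z \<and> (\<forall>t\<in>I. (Y has_vector_derivative F (Z (\<sigma> t))) (at t within I)) \<and>
          (\<forall>t\<in>I. \<bar>t\<bar> \<le> real j * h \<longrightarrow> Y t = Z t)" for j
  proof (induction j)
    case 0
    have "0 \<le> r" using assms(2,3,4) by (meson less_eq_real_def mult_nonneg_nonneg order_trans)
    then have c: "adm (\<lambda>_. y0)" by (auto simp: adm_def)
    obtain Y where Y: "adm Y" "\<forall>t\<in>I. (Y has_vector_derivative F y0) (at t within I)"
      using step[OF c] by blast
    have "Y t = y0" if "\<bar>t\<bar> \<le> real 0 * h" for t
      using that Y(1) by (simp add: adm_def)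
    with Y c show ?case
      by (intro exI[of _ Y] exI[of _ "\<lambda>_. y0"]) blast
  next
    case (Suc j)
    then obtain Y Z where YZ: "adm Y" "adm Z"
      "\<And>t. t \<in> I \<Longrightarrow> (Y has_vector_derivative F (Z (\<sigma> t))) (at t within I)"
      "\<And>t. t \<in> I \<Longrightarrow> \<bar>t\<bar> \<le> real j * h \<Longrightarrow> Y t = Z t" by blast
    obtain Y' where Y': "adm Y'"
      "\<And>t. t \<in> I \<Longrightarrow> (Y' has_vector_derivative F (Y (\<sigma> t))) (at t within I)"
      using step[OF YZ(1)] by blast
    have "Y' t = Y t" if t: "t \<in> I" "\<bar>t\<bar> \<le> real (Suc j) * h" for t
    proof -
      let ?K = "I \<inter> {- (real (Suc j) * h)..real (Suc j) * h}"
      have "((\<lambda>t. Y' t - Y t) has_derivative (\<lambda>_. 0)) (at s within ?K)" if s: "s \<in> ?K" for s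
      proof -
        have "\<bar>\<sigma> s\<bar> \<le> real j * h"
        proof (cases "h \<le> \<bar>s\<bar>")
          case True
          then show ?thesis using s assms(1) by (auto simp: \<sigma>_def max_def min_def algebra_simps)
        next
          case False
          then have "\<sigma> s = 0" by (auto simp: \<sigma>_def)
          then show ?thesis using assms(1) by simp
        qed
        then have "F (Y (\<sigma> s)) = F (Z (\<sigma> s))" using YZ(4) \<sigma>I s by simp
        then have "((\<lambda>t. Y' t - Y t) has_vector_derivative 0) (at s within I)"
          using s by (auto intro!: derivative_eq_intros Y'(2) YZ(3))
        then have "((\<lambda>t. Y' t - Y t) has_vector_derivative 0) (at s within ?K)"
          by (rule has_vector_derivative_within_subset) auto
        then show ?thesis by (simp add: has_vector_derivative_def)
      qed
      moreover have "convex ?K" unfolding I_def by (intro convex_Int) auto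
      ultimately have "\<exists>c. \<forall>s\<in>?K. Y' s - Y s = c"
        using has_derivative_zero_constant[of ?K "\<lambda>t. Y' t - Y t"] by simp
      then obtain c where c: "\<And>s. s \<in> ?K \<Longrightarrow> Y' s - Y s = c" by blast
      have "0 \<in> ?K" using assms(1,2) by (auto simp: I_def)
      from c[OF this] have "c = 0" using YZ(1) Y'(1) by (simp add: adm_def)
      moreover have "t \<in> ?K" using t by auto
      ultimately show ?thesis using c[of t] by simp
    qed
    then show ?case using Y' YZ(1) by blast
  qed
  obtain j :: nat where j: "T \<le> real j * h"
    using assms(1) by (metis ex_less_of_nat_mult less_imp_le)
  obtain Y Z where YZ: "adm Y"
    "\<forall>t\<in>I. (Y has_vector_derivative F (Z (\<sigma> t))) (at t within I)"
    "\<forall>t\<in>I. \<bar>t\<bar> \<le> real j * h \<longrightarrow> Y t = Z t" using iter[of j] by blast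
  have "Y t = Z t" if "t \<in> I" for t using YZ(3) that j by (auto simp: I_def)
  with YZ(1,2) \<sigma>I show ?thesis unfolding adm_def by (intro exI[of _ Y]) simp
qed

text \<open>
  Solutions of the delayed equations with delays \<open>1/(k+1)\<close> share the Lipschitz constant \<open>M\<close>, so a
  subsequence converges uniformly. The slopes then converge uniformly to \<open>F\<close> of the limit, because
  \<open>F\<close> is uniformly continuous on the ball, and the limit may be differentiated termwise.
\<close>

theorem Peano_existence:
  fixes F :: "'a::euclidean_space \<Rightarrow> 'a"
  assumes S: "open S" "y0 \<in> S" and F: "continuous_on S F"
  obtains y \<epsilon> where "0 < \<epsilon>" "y 0 = y0"
    "\<And>t. t \<in> {-\<epsilon><..<\<epsilon>} \<Longrightarrow> y t \<in> S \<and> (y has_vector_derivative F (y t)) (at t)"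
proof -
  obtain r where r: "0 < r" "cball y0 r \<subseteq> S" using S open_contains_cball by blast
  have cF: "continuous_on (cball y0 r) F" using F r continuous_on_subset by blast
  have "bounded (F ` cball y0 r)" by (intro compact_imp_bounded compact_continuous_image cF compact_cball)
  then obtain M where M: "0 < M" "\<And>y. y \<in> cball y0 r \<Longrightarrow> norm (F y) \<le> M"
    by (auto simp: bounded_pos)
  \<comment> \<open>in time \<open>T\<close> a curve of speed at most \<open>M\<close> does not leave the ball\<close>
  define T where "T = r / M"
  have T: "0 < T" "M * T \<le> r" using r M by (auto simp: T_def)
  define I where "I = {-T..T}"
  define \<sigma> where "\<sigma> k t = t - max (- inverse (real (Suc k))) (min (inverse (real (Suc k))) t)" for k t
  have "\<forall>k. \<exists>Y. Y 0 = y0 \<and> Y ` I \<subseteq> cball y0 r \<and>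
           (\<forall>t\<in>I. (Y has_vector_derivative F (Y (\<sigma> k t))) (at t within I))"
    unfolding I_def \<sigma>_def using T M cF by (intro allI delayed_solution_exists[where M = M]) auto
  then obtain Y where Y: "\<And>k. Y k 0 = y0" "\<And>k t. t \<in> I \<Longrightarrow> Y k t \<in> cball y0 r"
    "\<And>k t. t \<in> I \<Longrightarrow> (Y k has_vector_derivative F (Y k (\<sigma> k t))) (at t within I)"
    by (auto simp: image_subset_iff dest!: choice)
  have \<sigma>I: "\<sigma> k t \<in> I" if "t \<in> I" for k t
  proof -
    have "t - max (- i) (min i t) \<in> I" if "0 < i" for i
      using that \<open>t \<in> I\<close> T(1) unfolding I_def atLeastAtMost_iff by linarith
    then show ?thesis by (simp add: \<sigma>_def del: of_nat_Suc)
  qed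
  have \<sigma>: "\<bar>\<sigma> k t - t\<bar> \<le> inverse (real (Suc k))" for k t
    by (auto simp: \<sigma>_def max_def min_def not_le intro: order_trans)
  have Lip: "norm (Y k s - Y k t) \<le> M * \<bar>s - t\<bar>" if "s \<in> I" "t \<in> I" for k s t
    by (rule lipschitz_of_bounded_vector_derivative[of I, OF _ Y(3)])
      (use that M(2) Y(2) \<sigma>I in \<open>auto simp: I_def\<close>)
  obtain y k where y: "continuous_on I y" "strict_mono (k :: nat \<Rightarrow> nat)"
    "\<And>e. 0 < e \<Longrightarrow> \<exists>N. \<forall>n x. n \<ge> N \<and> x \<in> I \<longrightarrow> norm (Y (k n) x - y x) < e"
  proof (rule Arzela_Ascoli[of I Y "norm y0 + r"])
    show "compact I" by (simp add: I_def)
    show "norm (Y n x) \<le> norm y0 + r" if "x \<in> I" for n x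
      using Y(2)[OF that, of n] norm_triangle_ineq2[of "Y n x" y0]
      by (simp add: dist_norm norm_minus_commute)
    show "\<exists>d>0. \<forall>n s. s \<in> I \<and> norm (t - s) < d \<longrightarrow> norm (Y n t - Y n s) < e"
      if te: "t \<in> I" "0 < e" for t e
    proof (intro exI[of _ "e / M"] conjI allI impI)
      show "0 < e / M" using te M by simp
      show "norm (Y n t - Y n s) < e" if "s \<in> I \<and> norm (t - s) < e / M" for n s
        using that Lip[of t s n] te M(1) by (auto simp: field_simps)
    qed
  qed blast
  have pw: "(\<lambda>n. Y (k n) t) \<longlonglongrightarrow> y t" if "t \<in> I" for t
    using y(3) that by (metis (no_types, lifting) LIMSEQ_I)
  have yin: "y t \<in> cball y0 r" if "t \<in> I" for t
    using pw[OF that] Y(2)[OF that] by (intro Lim_in_closed_set[of "cball y0 r"]) auto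
  have unif: "\<forall>\<^sub>F n in sequentially. \<forall>t\<in>I. \<forall>h. norm (h *\<^sub>R F (Y (k n) (\<sigma> (k n) t)) - h *\<^sub>R F (y t)) \<le> e * norm h"
    if "0 < e" for e
  proof -
    have "uniformly_continuous_on (cball y0 r) F"
      by (rule compact_uniformly_continuous[OF cF compact_cball])
    then obtain d where d: "0 < d" "\<And>u v. u \<in> cball y0 r \<Longrightarrow> v \<in> cball y0 r \<Longrightarrow> dist u v < d \<Longrightarrow> dist (F u) (F v) < e"
      using \<open>0 < e\<close> unfolding uniformly_continuous_on_def by metis
    obtain N1 where N1: "\<And>n t. n \<ge> N1 \<Longrightarrow> t \<in> I \<Longrightarrow> norm (Y (k n) t - y t) < d / 2"
      using y(3)[of "d/2"] d(1) by auto
    obtain N2 where N2: "inverse (real (Suc N2)) < d / (2 * M)"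
      using reals_Archimedean[of "d / (2*M)"] d(1) M(1) by auto
    show ?thesis
      unfolding eventually_sequentially
    proof (intro exI[of _ "max N1 N2"] allI impI ballI)
      fix n t h assume n: "max N1 N2 \<le> n" and t: "t \<in> I"
      have "inverse (real (Suc (k n))) \<le> inverse (real (Suc N2))"
        using n seq_suble[OF y(2), of n] by (intro le_imp_inverse_le) auto
      then have "\<bar>\<sigma> (k n) t - t\<bar> < d / (2 * M)" using \<sigma>[of "k n" t] N2 by linarith
      then have "norm (Y (k n) (\<sigma> (k n) t) - Y (k n) t) < d / 2"
        using Lip[OF \<sigma>I[OF t] t, of "k n" "k n"] M(1) by (auto simp: field_simps)
      moreover have "norm (Y (k n) t - y t) < d / 2" using N1 n t by auto
      ultimately have "dist (Y (k n) (\<sigma> (k n) t)) (y t) < d"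
        unfolding dist_norm by (rule norm_diff_triangle_less[THEN less_le_trans]) simp
      then have "dist (F (Y (k n) (\<sigma> (k n) t))) (F (y t)) < e"
        using d(2)[OF Y(2)[OF \<sigma>I[OF t]] yin[OF t]] by simp
      then show "norm (h *\<^sub>R F (Y (k n) (\<sigma> (k n) t)) - h *\<^sub>R F (y t)) \<le> e * norm h"
        by (simp flip: scaleR_diff_right add: dist_norm mult.commute[of e] mult_left_mono)
    qed
  qed
  have "\<exists>g. \<forall>t\<in>I. (\<lambda>n. Y (k n) t) \<longlonglongrightarrow> g t \<and> (g has_derivative (\<lambda>h. h *\<^sub>R F (y t))) (at t within I)"
  proof (rule has_derivative_sequence[where f' = "\<lambda>n t h. h *\<^sub>R F (Y (k n) (\<sigma> (k n) t))" and ?x0.0 = 0])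
    show "convex I" "0 \<in> I" using T by (auto simp: I_def)
    show "(\<lambda>n. Y (k n) 0) \<longlonglongrightarrow> y0" by (simp add: Y(1))
    show "(Y (k n) has_derivative (\<lambda>h. h *\<^sub>R F (Y (k n) (\<sigma> (k n) t)))) (at t within I)"
      if "t \<in> I" for n t using Y(3)[OF that] by (simp add: has_vector_derivative_def)
  qed (use unif in auto)
  then obtain g where g: "\<And>t. t \<in> I \<Longrightarrow> (\<lambda>n. Y (k n) t) \<longlonglongrightarrow> g t"
    "\<And>t. t \<in> I \<Longrightarrow> (g has_vector_derivative F (y t)) (at t within I)"
    by (auto simp: has_vector_derivative_def)
  have gy: "g t = y t" if "t \<in> I" for t using g(1)[OF that] pw[OF that] LIMSEQ_unique by blast
  have "0 \<in> I" using T by (simp add: I_def)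
  then have "g 0 = y0" using g(1)[of 0] by (simp add: Y(1) LIMSEQ_const_iff)
  moreover have "g t \<in> S \<and> (g has_vector_derivative F (g t)) (at t)" if "t \<in> {-T<..<T}" for t
  proof -
    have "t \<in> interior I" using that by (simp add: I_def)
    moreover have "t \<in> I" using that by (simp add: I_def)
    ultimately show ?thesis
      using g(2)[of t] gy[of t] yin[of t] r(2) at_within_interior[of t I] by auto
  qed
  ultimately show ?thesis using that T by blast
qed

section \<open>Differential calculus in an atlas\<close>

text \<open>
  What pointwise calculus needs from a smooth atlas. The rules below apply both to the atlas of the
  manifold and to the atlas of its tangent bundle.
\<close>

definition differentiable_atlas :: "('q, 'e::euclidean_space) atlas \<Rightarrow> bool" where
  "differentiable_atlas B \<longleftrightarrow>
     (\<forall>\<kappa>\<in>B. inj_on (snd \<kappa>) (fst \<kappa>)) \<and>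
     (\<forall>\<kappa>\<in>B. \<forall>\<kappa>'\<in>B. open (snd \<kappa> ` (fst \<kappa> \<inter> fst \<kappa>')) \<and>
        (\<forall>p\<in>fst \<kappa> \<inter> fst \<kappa>'. (snd \<kappa>' \<circ> chart_inv \<kappa>) differentiable (at (snd \<kappa> p))))"

lemma differentiable_atlas_smooth_manifold:
  assumes "smooth_manifold A"
  shows "differentiable_atlas A"
proof -
  have "(snd \<kappa>' \<circ> chart_inv \<kappa>) differentiable (at (snd \<kappa> p))"
    if "\<kappa> \<in> A" "\<kappa>' \<in> A" "p \<in> fst \<kappa> \<inter> fst \<kappa>'" for \<kappa> \<kappa>' p
  proof -
    have "Ck_on (Suc 0) (snd \<kappa> ` (fst \<kappa> \<inter> fst \<kappa>')) (snd \<kappa>' \<circ> chart_inv \<kappa>)"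
      using assms that unfolding smooth_manifold_def smooth_on_def by blast
    then show ?thesis using that by auto
  qed
  then show ?thesis using assms by (auto simp: differentiable_atlas_def smooth_manifold_def)
qed

lemma chart_at_in:
  assumes "p \<in> carrier B"
  shows "chart_at B p \<in> B" "p \<in> fst (chart_at B p)"
proof -
  have "\<exists>\<kappa>. \<kappa> \<in> B \<and> p \<in> fst \<kappa>" using assms by (auto simp: carrier_def)
  then have "chart_at B p \<in> B \<and> p \<in> fst (chart_at B p)"
    unfolding chart_at_def by (rule someI_ex)
  then show "chart_at B p \<in> B" "p \<in> fst (chart_at B p)" by auto
qed

lemma tangent_space_outside: "v \<in> tangent_space B p \<Longrightarrow> \<not> (\<kappa> \<in> B \<and> p \<in> fst \<kappa>) \<Longrightarrow> v \<kappa> = 0"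
  unfolding tangent_space_def by blast

context
  fixes B :: "('p, 'f::euclidean_space) atlas"
  assumes B: "differentiable_atlas B"
begin

lemma chart_inv_chart: "\<kappa> \<in> B \<Longrightarrow> p \<in> fst \<kappa> \<Longrightarrow> chart_inv \<kappa> (snd \<kappa> p) = p"
  using B by (simp add: differentiable_atlas_def)

lemma open_overlap: "\<kappa> \<in> B \<Longrightarrow> \<kappa>' \<in> B \<Longrightarrow> open (snd \<kappa> ` (fst \<kappa> \<inter> fst \<kappa>'))"
  using B by (simp add: differentiable_atlas_def)

lemma open_chart_image: "\<kappa> \<in> B \<Longrightarrow> open (snd \<kappa> ` fst \<kappa>)"
  using open_overlap[of \<kappa> \<kappa>] by simp

lemma transition_has_derivative:
  assumes "\<kappa> \<in> B" "\<kappa>' \<in> B" "p \<in> fst \<kappa>" "p \<in> fst \<kappa>'"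
  shows "((snd \<kappa>' \<circ> chart_inv \<kappa>) has_derivative transition_deriv \<kappa> \<kappa>' p) (at (snd \<kappa> p))"
  using B assms unfolding transition_deriv_def differentiable_atlas_def
  by (simp add: frechet_derivative_works[THEN iffD1])

lemma linear_transition_deriv:
  assumes "\<kappa> \<in> B" "\<kappa>' \<in> B" "p \<in> fst \<kappa>" "p \<in> fst \<kappa>'"
  shows "linear (transition_deriv \<kappa> \<kappa>' p)"
  using transition_has_derivative[OF assms] by (rule has_derivative_linear)

lemma has_derivative_change_chart:
  assumes "\<kappa> \<in> B" "\<kappa>' \<in> B" "p \<in> fst \<kappa>" "p \<in> fst \<kappa>'"
    and F: "((F \<circ> chart_inv \<kappa>') has_derivative F') (at (snd \<kappa>' p))"
  shows "((F \<circ> chart_inv \<kappa>) has_derivative (F' \<circ> transition_deriv \<kappa> \<kappa>' p)) (at (snd \<kappa> p))"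
proof -
  have eq: "chart_inv \<kappa> (snd \<kappa> p) = p" using assms chart_inv_chart by simp
  have "((F \<circ> chart_inv \<kappa>') \<circ> (snd \<kappa>' \<circ> chart_inv \<kappa>) has_derivative
          (F' \<circ> transition_deriv \<kappa> \<kappa>' p)) (at (snd \<kappa> p))"
    using F by (intro diff_chain_at transition_has_derivative assms) (simp add: eq)
  then show ?thesis
    by (rule has_derivative_transform_within_open[OF _ open_overlap[of \<kappa> \<kappa>']])
      (use assms chart_inv_chart in auto)
qed

lemma transition_deriv_compose:
  assumes "\<kappa> \<in> B" "\<kappa>' \<in> B" "\<kappa>'' \<in> B" "p \<in> fst \<kappa>" "p \<in> fst \<kappa>'" "p \<in> fst \<kappa>''"
  shows "transition_deriv \<kappa>' \<kappa>'' p (transition_deriv \<kappa> \<kappa>' p \<xi>) = transition_deriv \<kappa> \<kappa>'' p \<xi>"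
  using has_derivative_change_chart[OF assms(1,2,4,5) transition_has_derivative[OF assms(2,3,5,6)]]
    transition_has_derivative[OF assms(1,3,4,6)]
  by (metis comp_apply has_derivative_unique)

lemma transition_deriv_same:
  assumes "\<kappa> \<in> B" "p \<in> fst \<kappa>"
  shows "transition_deriv \<kappa> \<kappa> p \<xi> = \<xi>"
proof -
  have "((\<lambda>x. x) has_derivative (\<lambda>\<xi>. \<xi>)) (at (snd \<kappa> p))" by (rule has_derivative_ident)
  then have "((snd \<kappa> \<circ> chart_inv \<kappa>) has_derivative (\<lambda>\<xi>. \<xi>)) (at (snd \<kappa> p))"
    by (rule has_derivative_transform_within_open[OF _ open_chart_image[of \<kappa>]])
      (use assms chart_inv_chart in auto)
  then show ?thesis using transition_has_derivative[OF assms(1,1,2,2)] has_derivative_unique by metis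
qed

lemma tvec_of_same [simp]: "\<kappa> \<in> B \<Longrightarrow> p \<in> fst \<kappa> \<Longrightarrow> tvec_of B p \<kappa> \<xi> \<kappa> = \<xi>"
  by (simp add: tvec_of_def transition_deriv_same)

lemma tvec_of_tangent: "\<kappa> \<in> B \<Longrightarrow> p \<in> fst \<kappa> \<Longrightarrow> tvec_of B p \<kappa> \<xi> \<in> tangent_space B p"
  by (auto simp: tvec_of_def tangent_space_def transition_deriv_compose)

lemma tangent_eq_tvec_of:
  assumes "v \<in> tangent_space B p" "\<kappa> \<in> B" "p \<in> fst \<kappa>"
  shows "v = tvec_of B p \<kappa> (v \<kappa>)"
proof
  fix \<kappa>'
  show "v \<kappa>' = tvec_of B p \<kappa> (v \<kappa>) \<kappa>'"
  proof (cases "\<kappa>' \<in> B \<and> p \<in> fst \<kappa>'")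
    case True
    with assms have "v \<kappa>' = transition_deriv \<kappa> \<kappa>' p (v \<kappa>)" unfolding tangent_space_def by blast
    with True show ?thesis by (simp add: tvec_of_def)
  next
    case False
    with tangent_space_outside[OF assms(1)] show ?thesis by (auto simp: tvec_of_def)
  qed
qed

lemma tangent_eqI:
  assumes "v \<in> tangent_space B p" "w \<in> tangent_space B p" "\<kappa> \<in> B" "p \<in> fst \<kappa>" "v \<kappa> = w \<kappa>"
  shows "v = w"
  using assms tangent_eq_tvec_of by metis

lemma linear_tvec_of:
  assumes "\<kappa> \<in> B" "p \<in> fst \<kappa>"
  shows "linear (\<lambda>\<xi>. tvec_of B p \<kappa> \<xi> \<kappa>')"
proof (cases "\<kappa>' \<in> B \<and> p \<in> fst \<kappa>'")
  case True
  then have "(\<lambda>\<xi>. tvec_of B p \<kappa> \<xi> \<kappa>') = transition_deriv \<kappa> \<kappa>' p" by (auto simp: tvec_of_def)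
  then show ?thesis using True assms linear_transition_deriv by metis
next
  case False
  then have "(\<lambda>\<xi>. tvec_of B p \<kappa> \<xi> \<kappa>') = (\<lambda>_. 0)" by (auto simp: tvec_of_def)
  then show ?thesis by (simp add: linear_iff)
qed

text \<open>
  Directional derivatives are evaluated in one selected chart, and tangent vectors are often given by
  their components in another one. By the chain rule the selection does not matter.
\<close>

lemma dir_deriv_tvec_of:
  fixes F :: "'p \<Rightarrow> real"
  assumes "\<kappa> \<in> B" "p \<in> fst \<kappa>" and F: "((F \<circ> chart_inv \<kappa>) has_derivative F') (at (snd \<kappa> p))"
  shows "dir_deriv B p (tvec_of B p \<kappa> \<xi>) F = F' \<xi>"
proof -
  let ?K = "chart_at B p"
  have "p \<in> carrier B" using assms by (auto simp: carrier_def)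
  note K = chart_at_in[OF this]
  have "((F \<circ> chart_inv ?K) has_derivative (F' \<circ> transition_deriv ?K \<kappa> p)) (at (snd ?K p))"
    by (rule has_derivative_change_chart) (use K assms in auto)
  then have "frechet_derivative (F \<circ> chart_inv ?K) (at (snd ?K p)) = F' \<circ> transition_deriv ?K \<kappa> p"
    using frechet_derivative_at by metis
  then show ?thesis
    using K assms by (simp add: dir_deriv_def Let_def tvec_of_def transition_deriv_compose transition_deriv_same)
qed

lemma dir_deriv_in_chart:
  fixes F :: "'p \<Rightarrow> real"
  assumes "v \<in> tangent_space B p" "\<kappa> \<in> B" "p \<in> fst \<kappa>"
    and F: "((F \<circ> chart_inv \<kappa>) has_derivative F') (at (snd \<kappa> p))"
  shows "dir_deriv B p v F = F' (v \<kappa>)"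
  using dir_deriv_tvec_of[OF assms(2-4)] tangent_eq_tvec_of[OF assms(1-3)] by metis

text \<open>
  Velocities are required to be right in every chart around the point; the transition maps carry them
  over from a single one.
\<close>

lemma has_velocity_from_chart:
  assumes \<kappa>: "\<kappa> \<in> B" and ev: "\<forall>\<^sub>F s in nhds t. \<gamma> s \<in> fst \<kappa>"
    and der: "((snd \<kappa> \<circ> \<gamma>) has_vector_derivative \<xi>) (at t)"
  shows "has_velocity B \<gamma> t (tvec_of B (\<gamma> t) \<kappa> \<xi>)"
  unfolding has_velocity_def
proof (intro ballI impI conjI)
  fix K assume K: "K \<in> B" "\<gamma> t \<in> fst K"
  have t: "\<gamma> t \<in> fst \<kappa>" using ev by (rule eventually_nhds_x_imp_x)
  have "isCont (snd \<kappa> \<circ> \<gamma>) t" using der by (rule has_vector_derivative_continuous)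
  then have "\<forall>\<^sub>F s in nhds t. (snd \<kappa> \<circ> \<gamma>) s \<in> snd \<kappa> ` (fst \<kappa> \<inter> fst K)"
    using K t by (intro topological_tendstoD[OF _ open_overlap[OF \<kappa> K(1)]])
      (auto simp: continuous_at tendsto_nhds_iff comp_def)
  with ev show evK: "\<forall>\<^sub>F s in nhds t. \<gamma> s \<in> fst K"
  proof eventually_elim
    case (elim s)
    then show ?case using chart_inv_chart[OF \<kappa>] by (metis (no_types, lifting) Int_iff comp_apply imageE)
  qed
  have "((snd K \<circ> chart_inv \<kappa>) \<circ> (snd \<kappa> \<circ> \<gamma>) has_derivative
          transition_deriv \<kappa> K (\<gamma> t) \<circ> (\<lambda>h. h *\<^sub>R \<xi>)) (at t)"
    using der transition_has_derivative[OF \<kappa> K(1) t K(2)]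
    by (intro diff_chain_at) (auto simp: has_vector_derivative_def)
  moreover have "transition_deriv \<kappa> K (\<gamma> t) \<circ> (\<lambda>h. h *\<^sub>R \<xi>) = (\<lambda>h. h *\<^sub>R tvec_of B (\<gamma> t) \<kappa> \<xi> K)"
    using K linear_scale[OF linear_transition_deriv[OF \<kappa> K(1) t K(2)]] by (auto simp: tvec_of_def)
  ultimately have "((snd K \<circ> chart_inv \<kappa>) \<circ> (snd \<kappa> \<circ> \<gamma>) has_vector_derivative
          tvec_of B (\<gamma> t) \<kappa> \<xi> K) (at t)"
    by (simp add: has_vector_derivative_def)
  moreover have "\<forall>\<^sub>F s in nhds t. (snd K \<circ> \<gamma>) s = ((snd K \<circ> chart_inv \<kappa>) \<circ> (snd \<kappa> \<circ> \<gamma>)) s"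
    using ev by eventually_elim (simp add: chart_inv_chart \<kappa>)
  ultimately show "(snd K \<circ> \<gamma> has_vector_derivative tvec_of B (\<gamma> t) \<kappa> \<xi> K) (at t)"
    by (subst has_vector_derivative_cong_ev[where g = "(snd K \<circ> chart_inv \<kappa>) \<circ> (snd \<kappa> \<circ> \<gamma>)"])
      (auto dest: eventually_nhds_x_imp_x elim: eventually_mono)
qed

lemma has_derivative_along_curve:
  fixes F :: "'p \<Rightarrow> real"
  assumes v: "has_velocity B \<gamma> t v" and \<kappa>: "\<kappa> \<in> B" "\<gamma> t \<in> fst \<kappa>"
    and F: "((F \<circ> chart_inv \<kappa>) has_derivative F') (at (snd \<kappa> (\<gamma> t)))"
  shows "((\<lambda>s. F (\<gamma> s)) has_real_derivative F' (v \<kappa>)) (at t)"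
proof -
  have ev: "\<forall>\<^sub>F s in nhds t. \<gamma> s \<in> fst \<kappa>" and der: "((snd \<kappa> \<circ> \<gamma>) has_vector_derivative v \<kappa>) (at t)"
    using v \<kappa> by (auto simp: has_velocity_def)
  have "((F \<circ> chart_inv \<kappa>) \<circ> (snd \<kappa> \<circ> \<gamma>) has_derivative F' \<circ> (\<lambda>h. h *\<^sub>R v \<kappa>)) (at t)"
    using F der by (intro diff_chain_at) (auto simp: has_vector_derivative_def)
  moreover have "F' \<circ> (\<lambda>h. h *\<^sub>R v \<kappa>) = (*) (F' (v \<kappa>))"
    using linear_scale[OF has_derivative_linear[OF F]] by (auto simp: mult.commute)
  ultimately have "((F \<circ> chart_inv \<kappa>) \<circ> (snd \<kappa> \<circ> \<gamma>) has_real_derivative F' (v \<kappa>)) (at t)"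
    by (simp add: has_field_derivative_def)
  moreover have "\<forall>\<^sub>F s in nhds t. F (\<gamma> s) = ((F \<circ> chart_inv \<kappa>) \<circ> (snd \<kappa> \<circ> \<gamma>)) s"
    using ev by eventually_elim (simp add: chart_inv_chart \<kappa>)
  ultimately show ?thesis
    by (subst DERIV_cong_ev[OF refl _ refl, where g = "(F \<circ> chart_inv \<kappa>) \<circ> (snd \<kappa> \<circ> \<gamma>)"])
qed

lemma has_derivative_dir_deriv_along_curve:
  fixes F :: "'p \<Rightarrow> real"
  assumes "has_velocity B \<gamma> t v" "\<kappa> \<in> B" "\<gamma> t \<in> fst \<kappa>"
    and F: "(F \<circ> chart_inv \<kappa>) differentiable (at (snd \<kappa> (\<gamma> t)))"
  shows "((\<lambda>s. F (\<gamma> s)) has_real_derivative dir_deriv B (\<gamma> t) v F) (at t)"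
proof -
  let ?K = "chart_at B (\<gamma> t)"
  have "\<gamma> t \<in> carrier B" using assms by (auto simp: carrier_def)
  note K = chart_at_in[OF this]
  obtain F' where "((F \<circ> chart_inv \<kappa>) has_derivative F') (at (snd \<kappa> (\<gamma> t)))"
    using F by (auto simp: differentiable_def)
  from has_derivative_change_chart[OF K(1) assms(2) K(2) assms(3) this]
  have "(F \<circ> chart_inv ?K) differentiable (at (snd ?K (\<gamma> t)))" by (auto simp: differentiable_def)
  then have "((F \<circ> chart_inv ?K) has_derivative frechet_derivative (F \<circ> chart_inv ?K) (at (snd ?K (\<gamma> t))))
     (at (snd ?K (\<gamma> t)))" by (rule frechet_derivative_works[THEN iffD1])
  from has_derivative_along_curve[OF assms(1) K this]
  show ?thesis by (simp add: dir_deriv_def Let_def)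
qed

lemma velocity_eq:
  assumes "has_velocity B c t v" "v \<in> tangent_space B (c t)"
  shows "velocity B c t = v"
proof
  fix \<kappa>
  show "velocity B c t \<kappa> = v \<kappa>"
    using assms(1) tangent_space_outside[OF assms(2), of \<kappa>]
    by (auto simp: velocity_def has_velocity_def intro: vector_derivative_at)
qed

end

lemma snd_lift_chart: "snd (lift_chart A \<kappa>) p = (snd \<kappa> (fst p), snd p \<kappa>)"
  by (simp add: lift_chart_def)

lemma inj_on_lift_chart:
  assumes A: "smooth_manifold A" and \<kappa>: "\<kappa> \<in> A"
  shows "inj_on (snd (lift_chart A \<kappa>)) (fst (lift_chart A \<kappa>))"
proof (rule inj_onI)
  note B = differentiable_atlas_smooth_manifold[OF A]
  fix p p' assume p: "p \<in> fst (lift_chart A \<kappa>)" "p' \<in> fst (lift_chart A \<kappa>)"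
    and eq: "snd (lift_chart A \<kappa>) p = snd (lift_chart A \<kappa>) p'"
  obtain q v q' v' where qv: "p = (q, v)" "p' = (q', v')" by fastforce
  have q: "q \<in> fst \<kappa>" "q' \<in> fst \<kappa>" "v \<in> tangent_space A q" "v' \<in> tangent_space A q'"
    "snd \<kappa> q = snd \<kappa> q'" "v \<kappa> = v' \<kappa>"
    using p eq by (simp_all add: qv lift_chart_def)
  then have "q = q'" using chart_inv_chart[OF B \<kappa>] by metis
  with q tangent_eqI[OF B _ _ \<kappa>] show "p = p'" by (simp add: qv)
qed

lemma chart_inv_lift_chart:
  assumes A: "smooth_manifold A" and \<kappa>: "\<kappa> \<in> A" "q \<in> fst \<kappa>"
  shows "chart_inv (lift_chart A \<kappa>) (snd \<kappa> q, \<xi>) = (q, tvec_of A q \<kappa> \<xi>)"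
proof -
  note B = differentiable_atlas_smooth_manifold[OF A]
  show ?thesis
    by (rule inv_into_f_eq[OF inj_on_lift_chart[OF A \<kappa>(1)]]) (use \<kappa> B in \<open>auto simp: lift_chart_def tvec_of_tangent\<close>)
qed

lemma lift_chart_image:
  assumes A: "smooth_manifold A" and \<kappa>: "\<kappa> \<in> A" "S \<subseteq> fst \<kappa>"
  shows "snd (lift_chart A \<kappa>) ` (SIGMA q:S. tangent_space A q) = snd \<kappa> ` S \<times> UNIV"
proof -
  note B = differentiable_atlas_smooth_manifold[OF A]
  have "(snd \<kappa> q, \<xi>) \<in> snd (lift_chart A \<kappa>) ` (SIGMA q:S. tangent_space A q)" if "q \<in> S" for q \<xi>
    using that \<kappa> B by (intro image_eqI[of _ _ "(q, tvec_of A q \<kappa> \<xi>)"])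
      (auto simp: lift_chart_def tvec_of_tangent)
  then show ?thesis by (auto simp: lift_chart_def)
qed

text \<open>
  The transition maps of the tangent bundle are \<open>(x, \<xi>) \<mapsto> (\<tau>(x), D\<tau>(x)\<cdot>\<xi>)\<close>. Expanding \<open>\<xi>\<close> in a basis
  shows that they are differentiable, as \<open>\<tau>\<close> is twice differentiable.
\<close>

lemma differentiable_atlas_tangent_atlas:
  assumes A: "smooth_manifold A"
  shows "differentiable_atlas (tangent_atlas A)"
proof -
  note B = differentiable_atlas_smooth_manifold[OF A]
  have "open (snd (lift_chart A \<kappa>) ` (fst (lift_chart A \<kappa>) \<inter> fst (lift_chart A \<kappa>'))) \<and>
     (\<forall>p\<in>fst (lift_chart A \<kappa>) \<inter> fst (lift_chart A \<kappa>').
        (snd (lift_chart A \<kappa>') \<circ> chart_inv (lift_chart A \<kappa>)) differentiable (at (snd (lift_chart A \<kappa>) p)))"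
    if k: "\<kappa> \<in> A" "\<kappa>' \<in> A" for \<kappa> \<kappa>'
  proof -
    let ?S = "snd \<kappa> ` (fst \<kappa> \<inter> fst \<kappa>')"
    let ?\<tau> = "snd \<kappa>' \<circ> chart_inv \<kappa>"
    have "fst (lift_chart A \<kappa>) \<inter> fst (lift_chart A \<kappa>') = (SIGMA q:fst \<kappa> \<inter> fst \<kappa>'. tangent_space A q)"
      by (auto simp: lift_chart_def)
    then have im: "snd (lift_chart A \<kappa>) ` (fst (lift_chart A \<kappa>) \<inter> fst (lift_chart A \<kappa>')) = ?S \<times> UNIV"
      using lift_chart_image[OF A k(1), of "fst \<kappa> \<inter> fst \<kappa>'"] by simp
    have op: "open (?S \<times> (UNIV :: 'b set))" by (intro open_Times open_overlap[OF B k] open_UNIV)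
    have C2: "Ck_on (Suc (Suc 0)) ?S ?\<tau>"
      using A k unfolding smooth_manifold_def smooth_on_def by blast
    define T where "T p = (?\<tau> (fst p), \<Sum>b\<in>Basis. (snd p \<bullet> b) *\<^sub>R frechet_derivative ?\<tau> (at (fst p)) b)"
      for p :: "'b \<times> 'b"
    have "(snd (lift_chart A \<kappa>') \<circ> chart_inv (lift_chart A \<kappa>)) differentiable (at p)"
      if p: "p \<in> ?S \<times> UNIV" for p
    proof -
      have "fst p \<in> ?S" using p by auto
      then have d1: "?\<tau> differentiable (at (fst p))"
        and d2: "(\<lambda>x. frechet_derivative ?\<tau> (at x) b) differentiable (at (fst p))" for b
        using C2 by auto
      have f: "(\<lambda>p. g (fst p)) differentiable (at p)" if "g differentiable (at (fst p))"
        for g :: "'b \<Rightarrow> 'b"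
        using differentiable_chain_at[of fst p g] that
        by (simp add: o_def bounded_linear_imp_differentiable bounded_linear_fst)
      have s: "snd differentiable (at p)"
        by (simp add: bounded_linear_imp_differentiable bounded_linear_snd)
      have "T differentiable (at p)"
        unfolding T_def by (intro differentiable_Pair f d1 differentiable_sum ballI differentiable_scaleR
            differentiable_inner s d2 differentiable_const finite_Basis)
      moreover have "T p' = (snd (lift_chart A \<kappa>') \<circ> chart_inv (lift_chart A \<kappa>)) p'"
        if p': "p' \<in> ?S \<times> UNIV" for p'
      proof -
        obtain q \<xi> where q: "q \<in> fst \<kappa>" "q \<in> fst \<kappa>'" "p' = (snd \<kappa> q, \<xi>)" using p' by (cases p') auto
        have "(\<Sum>b\<in>Basis. (\<xi> \<bullet> b) *\<^sub>R transition_deriv \<kappa> \<kappa>' q b) = transition_deriv \<kappa> \<kappa>' q \<xi>"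
          using linear_transition_deriv[OF B k q(1,2)]
          by (metis (no_types, lifting) euclidean_representation linear_scale linear_sum sum.cong)
        then show ?thesis
          using q k by (simp add: T_def chart_inv_lift_chart[OF A k(1)] snd_lift_chart
              tvec_of_def chart_inv_chart[OF B] transition_deriv_def)
      qed
      ultimately show ?thesis
        using has_derivative_transform_within_open[OF _ op p, of T] unfolding differentiable_def by blast
    qed
    then show ?thesis using op by (auto simp flip: im)
  qed
  then show ?thesis
    using inj_on_lift_chart[OF A] unfolding differentiable_atlas_def tangent_atlas_def by blast
qed

section \<open>Global adapted frames\<close>

text \<open>
  An enumeration of the orthonormal basis of the model space. It turns the components of a tangent
  vector in the frame into a vector of the model space, on which the calculus of Euclidean spaces is
  available.
\<close>

definition coord_basis :: "nat \<Rightarrow> 'e::euclidean_space" where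
  "coord_basis = (SOME e. bij_betw e {..<DIM('e)} Basis)"

lemma bij_betw_coord_basis: "bij_betw (coord_basis :: nat \<Rightarrow> 'e::euclidean_space) {..<DIM('e)} Basis"
proof -
  have "\<exists>e :: nat \<Rightarrow> 'e. bij_betw e {..<DIM('e)} Basis"
    using ex_bij_betw_nat_finite[of "Basis :: 'e set"] by (simp add: atLeast0LessThan)
  then show ?thesis unfolding coord_basis_def by (rule someI_ex)
qed

lemma inner_coord_basis:
  assumes "\<alpha> < DIM('e)" "\<beta> < DIM('e)"
  shows "(coord_basis \<alpha> :: 'e::euclidean_space) \<bullet> coord_basis \<beta> = (if \<alpha> = \<beta> then 1 else 0)"
proof -
  have "coord_basis \<alpha> \<in> (Basis :: 'e set)" "coord_basis \<beta> \<in> (Basis :: 'e set)"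
    using bij_betw_coord_basis[where 'e = 'e] assms by (auto simp: bij_betw_def)
  moreover have "(coord_basis \<alpha> :: 'e) = coord_basis \<beta> \<longleftrightarrow> \<alpha> = \<beta>"
    using bij_betw_coord_basis[where 'e = 'e] assms by (auto simp: bij_betw_def inj_on_eq_iff)
  ultimately show ?thesis by (simp add: inner_Basis)
qed

lemma sum_coord_basis:
  "(\<Sum>\<alpha><DIM('e). (\<eta> \<bullet> coord_basis \<alpha>) *\<^sub>R coord_basis \<alpha>) = (\<eta> :: 'e::euclidean_space)"
  using sum.reindex_bij_betw[OF bij_betw_coord_basis[where 'e = 'e], of "\<lambda>b. (\<eta> \<bullet> b) *\<^sub>R b"]
  by (simp add: euclidean_representation)

lemma inner_sum_coord_basis:
  assumes "\<alpha> < DIM('e)"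
  shows "(\<Sum>\<beta><DIM('e). c \<beta> *\<^sub>R coord_basis \<beta>) \<bullet> (coord_basis \<alpha> :: 'e::euclidean_space) = c \<alpha>"
proof -
  have "(\<Sum>\<beta><DIM('e). c \<beta> *\<^sub>R coord_basis \<beta>) \<bullet> (coord_basis \<alpha> :: 'e) =
      (\<Sum>\<beta><DIM('e). if \<beta> = \<alpha> then c \<beta> else 0)"
    unfolding inner_sum_left by (rule sum.cong) (auto simp: inner_coord_basis assms)
  then show ?thesis using assms by simp
qed

lemma lincomb_restrict:
  assumes "I \<subseteq> J" "finite J" "\<And>i. i \<in> J - I \<Longrightarrow> c i = 0"
  shows "lincomb I c V = lincomb J c V"
  unfolding lincomb_def by (intro ext sum.mono_neutral_left) (use assms in auto)

locale adapted_frame_manifold =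
  fixes A :: "('q, 'e::euclidean_space) atlas"
    and g :: "('q, 'e) tensor2"
    and D :: "('q, 'e) distr"
    and m :: nat
    and X :: "nat \<Rightarrow> ('q, 'e) vfield"
    and nab :: "('q, 'e) connection"
  assumes manifold: "smooth_manifold A"
    and metric: "riemannian_metric A g"
    and frame: "adapted_frame A g m D X"
    and connection: "levi_civita A g nab"
begin

abbreviation "TA \<equiv> tangent_atlas A"

lemmas dA = differentiable_atlas_smooth_manifold[OF manifold]
lemmas dTA = differentiable_atlas_tangent_atlas[OF manifold]

lemma m_le: "m \<le> DIM('e)"
  using frame by (simp add: adapted_frame_def)

lemma carrierI: "\<kappa> \<in> A \<Longrightarrow> q \<in> fst \<kappa> \<Longrightarrow> q \<in> carrier A"
  by (auto simp: carrier_def)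

lemma vector_field_frame: "\<alpha> < DIM('e) \<Longrightarrow> vector_field A (X \<alpha>)"
  using frame by (simp add: adapted_frame_def)

lemma frame_in_tangent: "\<alpha> < DIM('e) \<Longrightarrow> q \<in> carrier A \<Longrightarrow> X \<alpha> q \<in> tangent_space A q"
  using vector_field_frame by (simp add: vector_field_on_def)

section \<open>Algebra of the adapted frame\<close>

lemma tangent_iff_lincomb:
  "q \<in> carrier A \<Longrightarrow> v \<in> tangent_space A q \<longleftrightarrow> (\<exists>c. v = lincomb {..<DIM('e)} c (\<lambda>\<alpha>. X \<alpha> q))"
proof -
  assume "q \<in> carrier A"
  then have "tangent_space A q = lin_span {..<DIM('e)} (\<lambda>\<alpha>. X \<alpha> q)"
    using frame by (simp add: adapted_frame_def)
  then show ?thesis unfolding lin_span_def by blast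
qed

lemma dual_frame_lincomb:
  assumes "q \<in> carrier A" "\<alpha> < DIM('e)"
  shows "dual_frame X \<alpha> q (lincomb {..<DIM('e)} c (\<lambda>\<alpha>. X \<alpha> q)) = c \<alpha>"
proof -
  let ?L = "\<lambda>c. lincomb {..<DIM('e)} c (\<lambda>\<alpha>. X \<alpha> q)"
  define c' where "c' = (SOME c'. ?L c = ?L c')"
  have "?L c = ?L c'"
    unfolding c'_def by (rule someI[of "\<lambda>c'. ?L c = ?L c'" c]) simp
  then have "?L (\<lambda>\<alpha>. c \<alpha> - c' \<alpha>) = (\<lambda>\<kappa>. 0)"
    by (simp add: lincomb_def fun_eq_iff scaleR_left_diff_distrib sum_subtractf)
  moreover have "lin_indep {..<DIM('e)} (\<lambda>\<alpha>. X \<alpha> q)"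
    using frame assms by (simp add: adapted_frame_def)
  ultimately have "\<forall>i\<in>{..<DIM('e)}. c i - c' i = 0"
    unfolding lin_indep_def by blast
  then have "c \<alpha> = c' \<alpha>" using assms by simp
  then show ?thesis unfolding dual_frame_def c'_def by simp
qed

lemma dual_frame_eqI:
  assumes "q \<in> carrier A" "\<alpha> < DIM('e)" "v = (\<lambda>\<kappa>. \<Sum>\<beta><DIM('e). c \<beta> *\<^sub>R X \<beta> q \<kappa>)"
  shows "dual_frame X \<alpha> q v = c \<alpha>"
  using dual_frame_lincomb[OF assms(1,2), of c] assms(3) by (simp add: lincomb_def)

lemma frame_expansion:
  assumes "q \<in> carrier A" "v \<in> tangent_space A q"
  shows "v = (\<lambda>\<kappa>. \<Sum>\<alpha><DIM('e). dual_frame X \<alpha> q v *\<^sub>R X \<alpha> q \<kappa>)"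
proof -
  obtain c where c: "v = lincomb {..<DIM('e)} c (\<lambda>\<alpha>. X \<alpha> q)"
    using assms tangent_iff_lincomb by blast
  show ?thesis
  proof
    fix \<kappa>
    have "v \<kappa> = (\<Sum>\<alpha><DIM('e). c \<alpha> *\<^sub>R X \<alpha> q \<kappa>)" by (simp add: c lincomb_def)
    also have "\<dots> = (\<Sum>\<alpha><DIM('e). dual_frame X \<alpha> q v *\<^sub>R X \<alpha> q \<kappa>)"
      by (intro sum.cong) (simp_all add: c dual_frame_lincomb[OF assms(1)])
    finally show "v \<kappa> = (\<Sum>\<alpha><DIM('e). dual_frame X \<alpha> q v *\<^sub>R X \<alpha> q \<kappa>)" .
  qed
qed

lemma tangent_frame_sum:
  assumes "q \<in> carrier A"
  shows "(\<lambda>\<kappa>. \<Sum>\<alpha><DIM('e). c \<alpha> *\<^sub>R X \<alpha> q \<kappa>) \<in> tangent_space A q"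
  using assms tangent_iff_lincomb by (auto simp: lincomb_def)

lemma tangent_sum:
  assumes "q \<in> carrier A" "finite I" "\<And>i. i \<in> I \<Longrightarrow> V i \<in> tangent_space A q"
  shows "(\<lambda>\<kappa>. \<Sum>i\<in>I. c i *\<^sub>R V i \<kappa>) \<in> tangent_space A q"
    and "\<alpha> < DIM('e) \<Longrightarrow> dual_frame X \<alpha> q (\<lambda>\<kappa>. \<Sum>i\<in>I. c i *\<^sub>R V i \<kappa>) = (\<Sum>i\<in>I. c i * dual_frame X \<alpha> q (V i))"
proof -
  have "(\<lambda>\<kappa>. \<Sum>i\<in>I. c i *\<^sub>R V i \<kappa>) =
     (\<lambda>\<kappa>. \<Sum>\<alpha><DIM('e). (\<Sum>i\<in>I. c i * dual_frame X \<alpha> q (V i)) *\<^sub>R X \<alpha> q \<kappa>)" (is "?l = ?r")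
  proof
    fix \<kappa>
    have "?l \<kappa> = (\<Sum>i\<in>I. c i *\<^sub>R (\<Sum>\<alpha><DIM('e). dual_frame X \<alpha> q (V i) *\<^sub>R X \<alpha> q \<kappa>))"
      by (intro sum.cong refl arg_cong[where f = "\<lambda>z. _ *\<^sub>R z"])
        (use frame_expansion[OF assms(1,3)] in metis)
    also have "\<dots> = (\<Sum>i\<in>I. \<Sum>\<alpha><DIM('e). (c i * dual_frame X \<alpha> q (V i)) *\<^sub>R X \<alpha> q \<kappa>)"
      by (simp add: scaleR_sum_right)
    also have "\<dots> = ?r \<kappa>" by (subst sum.swap) (simp add: scaleR_sum_left)
    finally show "?l \<kappa> = ?r \<kappa>" .
  qed
  note eq = this
  show "?l \<in> tangent_space A q" unfolding eq by (rule tangent_frame_sum[OF assms(1)])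
  show "dual_frame X \<alpha> q ?l = (\<Sum>i\<in>I. c i * dual_frame X \<alpha> q (V i))" if "\<alpha> < DIM('e)"
    using dual_frame_eqI[OF assms(1) that eq] .
qed

lemma tangent_linear:
  assumes "q \<in> carrier A" "u \<in> tangent_space A q" "v \<in> tangent_space A q"
  shows "(\<lambda>\<kappa>. a *\<^sub>R u \<kappa> + b *\<^sub>R v \<kappa>) \<in> tangent_space A q"
    and "\<alpha> < DIM('e) \<Longrightarrow> dual_frame X \<alpha> q (\<lambda>\<kappa>. a *\<^sub>R u \<kappa> + b *\<^sub>R v \<kappa>) =
           a * dual_frame X \<alpha> q u + b * dual_frame X \<alpha> q v"
  using tangent_sum[OF assms(1), where I = "{0, Suc 0}" and V = "\<lambda>i. if i = 0 then u else v"
      and c = "\<lambda>i. if i = 0 then a else b"]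
    assms(2,3) by auto

lemma dual_frame_frame:
  assumes "q \<in> carrier A" "\<alpha> < DIM('e)" "\<beta> < DIM('e)"
  shows "dual_frame X \<alpha> q (X \<beta> q) = (if \<alpha> = \<beta> then 1 else 0)"
proof -
  have "X \<beta> q = (\<lambda>\<kappa>. \<Sum>\<gamma><DIM('e). (if \<gamma> = \<beta> then 1 else 0) *\<^sub>R X \<gamma> q \<kappa>)"
    using assms by (simp add: fun_eq_iff if_distrib[of "\<lambda>c. c *\<^sub>R _"] cong: if_cong)
  from dual_frame_eqI[OF assms(1,2) this] show ?thesis by simp
qed

lemma lin_span_frame_iff:
  assumes q: "q \<in> carrier A" and I: "I \<subseteq> {..<DIM('e)}"
  shows "v \<in> lin_span I (\<lambda>\<alpha>. X \<alpha> q) \<longleftrightarrow>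
    v \<in> tangent_space A q \<and> (\<forall>\<alpha>\<in>{..<DIM('e)} - I. dual_frame X \<alpha> q v = 0)"
proof
  assume "v \<in> lin_span I (\<lambda>\<alpha>. X \<alpha> q)"
  then obtain c where c: "v = lincomb I c (\<lambda>\<alpha>. X \<alpha> q)" by (auto simp: lin_span_def)
  also have "\<dots> = lincomb I (\<lambda>\<alpha>. if \<alpha> \<in> I then c \<alpha> else 0) (\<lambda>\<alpha>. X \<alpha> q)"
    by (auto simp: lincomb_def)
  also have "\<dots> = lincomb {..<DIM('e)} (\<lambda>\<alpha>. if \<alpha> \<in> I then c \<alpha> else 0) (\<lambda>\<alpha>. X \<alpha> q)"
    by (rule lincomb_restrict) (use I in auto)
  finally show "v \<in> tangent_space A q \<and> (\<forall>\<alpha>\<in>{..<DIM('e)} - I. dual_frame X \<alpha> q v = 0)"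
    using q dual_frame_lincomb tangent_iff_lincomb by auto
next
  assume v: "v \<in> tangent_space A q \<and> (\<forall>\<alpha>\<in>{..<DIM('e)} - I. dual_frame X \<alpha> q v = 0)"
  then have "v = lincomb {..<DIM('e)} (\<lambda>\<alpha>. dual_frame X \<alpha> q v) (\<lambda>\<alpha>. X \<alpha> q)"
    unfolding lincomb_def using frame_expansion[OF q] by blast
  also have "\<dots> = lincomb I (\<lambda>\<alpha>. dual_frame X \<alpha> q v) (\<lambda>\<alpha>. X \<alpha> q)"
    by (rule lincomb_restrict[symmetric]) (use I v in auto)
  finally show "v \<in> lin_span I (\<lambda>\<alpha>. X \<alpha> q)" by (auto simp: lin_span_def)
qed

lemma distribution_iff:
  assumes "q \<in> carrier A"
  shows "v \<in> D q \<longleftrightarrow> v \<in> tangent_space A q \<and> (\<forall>i\<in>{m..<DIM('e)}. dual_frame X i q v = 0)"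
proof -
  have "D q = lin_span {..<m} (\<lambda>\<alpha>. X \<alpha> q)" using frame assms by (simp add: adapted_frame_def)
  moreover have "{..<DIM('e)} - {..<m} = {m..<DIM('e)}" by auto
  ultimately show ?thesis using lin_span_frame_iff[OF assms, of "{..<m}" v] m_le by simp
qed

lemma orth_compl_iff:
  assumes "q \<in> carrier A"
  shows "v \<in> orth_compl A g D q \<longleftrightarrow> v \<in> tangent_space A q \<and> (\<forall>a<m. dual_frame X a q v = 0)"
proof -
  have "orth_compl A g D q = lin_span {m..<DIM('e)} (\<lambda>\<alpha>. X \<alpha> q)"
    using frame assms by (simp add: adapted_frame_def)
  moreover have "{..<DIM('e)} - {m..<DIM('e)} = {..<m}" "{m..<DIM('e)} \<subseteq> {..<DIM('e)}" using m_le by auto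
  ultimately show ?thesis using lin_span_frame_iff[OF assms, of "{m..<DIM('e)}" v] by (simp add: Ball_def)
qed

lemma tensor_linear_left:
  assumes "symmetric_tensor A h" "q \<in> carrier A"
    and "u \<in> tangent_space A q" "v \<in> tangent_space A q" "w \<in> tangent_space A q"
  shows "h q (\<lambda>\<kappa>. a *\<^sub>R u \<kappa> + b *\<^sub>R v \<kappa>) w = a * h q u w + b * h q v w"
  using assms unfolding symmetric_tensor_def by blast

lemma tensor_left_sum:
  assumes h: "symmetric_tensor A h" and q: "q \<in> carrier A" and w: "w \<in> tangent_space A q"
    and "finite I" "\<And>i. i \<in> I \<Longrightarrow> V i \<in> tangent_space A q"
  shows "h q (\<lambda>\<kappa>. \<Sum>i\<in>I. c i *\<^sub>R V i \<kappa>) w = (\<Sum>i\<in>I. c i * h q (V i) w)"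
  using assms(4,5)
proof (induction I)
  case empty
  show ?case using tensor_linear_left[OF h q w w w, of 0 0] by simp
next
  case (insert i I)
  have "h q (\<lambda>\<kappa>. c i *\<^sub>R V i \<kappa> + 1 *\<^sub>R (\<Sum>i\<in>I. c i *\<^sub>R V i \<kappa>)) w =
      c i * h q (V i) w + 1 * h q (\<lambda>\<kappa>. \<Sum>i\<in>I. c i *\<^sub>R V i \<kappa>) w"
    by (intro tensor_linear_left h q w tangent_sum(1) insert.hyps) (use insert.prems in auto)
  then show ?case using insert by simp
qed

lemma tensor_frame_left:
  assumes h: "symmetric_tensor A h" and q: "q \<in> carrier A"
    and "v \<in> tangent_space A q" "w \<in> tangent_space A q"
  shows "h q v w = (\<Sum>\<alpha><DIM('e). dual_frame X \<alpha> q v * h q (X \<alpha> q) w)"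
  unfolding arg_cong[OF frame_expansion[OF q assms(3)], of "\<lambda>u. h q u w"]
  by (rule tensor_left_sum[OF h q assms(4)]) (auto simp: frame_in_tangent q)

lemma tensor_sym:
  assumes "symmetric_tensor A h" "q \<in> carrier A" "v \<in> tangent_space A q" "w \<in> tangent_space A q"
  shows "h q v w = h q w v"
  using assms unfolding symmetric_tensor_def by blast

lemma tensor_frame_right:
  assumes h: "symmetric_tensor A h" and q: "q \<in> carrier A"
    and "v \<in> tangent_space A q" "w \<in> tangent_space A q"
  shows "h q v w = (\<Sum>\<alpha><DIM('e). dual_frame X \<alpha> q w * h q v (X \<alpha> q))"
  using tensor_frame_left[OF h q assms(4,3)] tensor_sym[OF h q] frame_in_tangent[OF _ q] assms(3,4) by simp

lemma metric_tensor: "symmetric_tensor A g"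
  using metric by (simp add: riemannian_metric_def)

lemma metric_orthogonal:
  assumes q: "q \<in> carrier A" and "a < m" "i \<in> {m..<DIM('e)}"
  shows "g q (X a q) (X i q) = 0" "g q (X i q) (X a q) = 0"
proof -
  have "X i q \<in> orth_compl A g D q" using assms m_le by (auto simp: orth_compl_iff frame_in_tangent dual_frame_frame)
  moreover have "X a q \<in> D q" using assms m_le by (auto simp: distribution_iff frame_in_tangent dual_frame_frame)
  ultimately show "g q (X i q) (X a q) = 0" by (simp add: orth_compl_def)
  then show "g q (X a q) (X i q) = 0"
    using tensor_sym[OF metric_tensor q] frame_in_tangent[OF _ q] assms m_le by simp
qed

section \<open>Frame coordinates on the tangent bundle\<close>

text \<open>
  \<open>frame_vec q\<close> and the map \<open>frame_coord q\<close> below are the mutually inverse isomorphisms between the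
  model space and the tangent space at \<open>q\<close> that the frame determines.
\<close>

definition frame_vec :: "'q \<Rightarrow> 'e \<Rightarrow> ('q, 'e) tvec" where
  "frame_vec q \<eta> = (\<lambda>\<kappa>. \<Sum>\<alpha><DIM('e). (\<eta> \<bullet> coord_basis \<alpha>) *\<^sub>R X \<alpha> q \<kappa>)"

definition frame_coord :: "'q \<Rightarrow> ('q, 'e) tvec \<Rightarrow> 'e" where
  "frame_coord q v = (\<Sum>\<alpha><DIM('e). dual_frame X \<alpha> q v *\<^sub>R coord_basis \<alpha>)"

lemma inner_frame_coord [simp]:
  "\<alpha> < DIM('e) \<Longrightarrow> frame_coord q v \<bullet> coord_basis \<alpha> = dual_frame X \<alpha> q v"
  by (simp add: frame_coord_def inner_sum_coord_basis)

lemma dual_frame_frame_vec [simp]: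
  "q \<in> carrier A \<Longrightarrow> \<alpha> < DIM('e) \<Longrightarrow> dual_frame X \<alpha> q (frame_vec q \<eta>) = \<eta> \<bullet> coord_basis \<alpha>"
  by (rule dual_frame_eqI) (auto simp: frame_vec_def)

lemma frame_vec_tangent [simp]: "q \<in> carrier A \<Longrightarrow> frame_vec q \<eta> \<in> tangent_space A q"
  unfolding frame_vec_def by (rule tangent_frame_sum)

lemma frame_coord_frame_vec [simp]: "q \<in> carrier A \<Longrightarrow> frame_coord q (frame_vec q \<eta>) = \<eta>"
  by (simp add: frame_coord_def sum_coord_basis)

lemma frame_vec_frame_coord:
  assumes "q \<in> carrier A" "v \<in> tangent_space A q"
  shows "frame_vec q (frame_coord q v) = v"
  by (subst (2) frame_expansion[OF assms]) (simp add: frame_vec_def)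

abbreviation frame_deriv :: "('q, 'e) chart \<Rightarrow> nat \<Rightarrow> 'e \<Rightarrow> 'e \<Rightarrow> 'e" where
  "frame_deriv \<kappa> \<alpha> x \<equiv> frechet_derivative (local_rep \<kappa> (X \<alpha>)) (at x)"

lemma local_rep_chart: "\<kappa> \<in> A \<Longrightarrow> q \<in> fst \<kappa> \<Longrightarrow> local_rep \<kappa> Y (snd \<kappa> q) = Y q \<kappa>"
  by (simp add: local_rep_def chart_inv_chart[OF dA])

lemma vector_field_has_derivative:
  assumes "vector_field A Y" "\<kappa> \<in> A" "q \<in> fst \<kappa>"
  shows "(local_rep \<kappa> Y has_derivative frechet_derivative (local_rep \<kappa> Y) (at (snd \<kappa> q))) (at (snd \<kappa> q))"
proof -
  have "Ck_on (Suc 0) (snd \<kappa> ` (carrier A \<inter> fst \<kappa>)) (local_rep \<kappa> Y)"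
    using assms unfolding vector_field_on_def smooth_on_def by blast
  then have "local_rep \<kappa> Y differentiable (at (snd \<kappa> q))" using assms carrierI by auto
  then show ?thesis by (simp add: frechet_derivative_works)
qed

lemma vector_field_continuous:
  assumes "vector_field A Y" "\<kappa> \<in> A"
  shows "continuous_on (snd \<kappa> ` fst \<kappa>) (local_rep \<kappa> Y)"
proof -
  have "Ck_on 0 (snd \<kappa> ` (carrier A \<inter> fst \<kappa>)) (local_rep \<kappa> Y)"
    using assms unfolding vector_field_on_def smooth_on_def by blast
  moreover have "carrier A \<inter> fst \<kappa> = fst \<kappa>" using carrierI[OF assms(2)] by blast
  ultimately show ?thesis by simp
qed

text \<open>
  The change of the frame coordinate \<open>\<eta>\<close> when a vector with base point \<open>q\<close> moves with velocity \<open>z\<close>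
  in the chart of the tangent bundle given by \<open>\<kappa>\<close>: the part of the motion that is due to the
  variation of the frame has to be subtracted.
\<close>

definition frame_velocity :: "('q, 'e) chart \<Rightarrow> 'q \<Rightarrow> 'e \<Rightarrow> 'e \<times> 'e \<Rightarrow> 'e" where
  "frame_velocity \<kappa> q \<eta> z = frame_coord q (tvec_of A q \<kappa>
     (snd z - (\<Sum>\<alpha><DIM('e). (\<eta> \<bullet> coord_basis \<alpha>) *\<^sub>R frame_deriv \<kappa> \<alpha> (snd \<kappa> q) (fst z))))"

text \<open>
  The map is inverse to \<open>(x, \<eta>) \<mapsto> (x, \<eta>\<^sup>\<alpha> X\<^sub>\<alpha>(x))\<close>, whose derivative is invertible because the \<open>X\<^sub>\<alpha>\<close>
  are a frame. The inverse function theorem thus shows that the dual frame is differentiable, and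
  gives its derivative, without any formula for the inverse of a matrix.
\<close>

lemma frame_coord_chart_has_derivative:
  assumes \<kappa>: "\<kappa> \<in> A" "q \<in> fst \<kappa>"
  shows "((\<lambda>z. (fst z, frame_coord (chart_inv \<kappa> (fst z)) (tvec_of A (chart_inv \<kappa> (fst z)) \<kappa> (snd z))))
     has_derivative (\<lambda>z. (fst z, frame_velocity \<kappa> q \<eta> z))) (at (snd \<kappa> q, frame_vec q \<eta> \<kappa>))"
proof -
  let ?S = "(snd \<kappa> ` fst \<kappa>) \<times> (UNIV :: 'e set)"
  define f where "f z = (fst z, \<Sum>\<alpha><DIM('e). (snd z \<bullet> coord_basis \<alpha>) *\<^sub>R local_rep \<kappa> (X \<alpha>) (fst z))"
    for z :: "'e \<times> 'e"
  define f' where "f' z w = (fst w, \<Sum>\<alpha><DIM('e). (snd z \<bullet> coord_basis \<alpha>) *\<^sub>R frame_deriv \<kappa> \<alpha> (fst z) (fst w)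
       + (snd w \<bullet> coord_basis \<alpha>) *\<^sub>R local_rep \<kappa> (X \<alpha>) (fst z))" for z w :: "'e \<times> 'e"
  define g where "g z = (fst z, frame_coord (chart_inv \<kappa> (fst z)) (tvec_of A (chart_inv \<kappa> (fst z)) \<kappa> (snd z)))"
    for z :: "'e \<times> 'e"
  have fq: "f (snd \<kappa> q', \<zeta>) = (snd \<kappa> q', frame_vec q' \<zeta> \<kappa>)" if "q' \<in> fst \<kappa>" for q' \<zeta>
    using that \<kappa> by (simp add: f_def frame_vec_def local_rep_chart)
  have "(g has_derivative (\<lambda>z. (fst z, frame_velocity \<kappa> q \<eta> z))) (at (f (snd \<kappa> q, \<eta>)))"
  proof (rule has_derivative_inverse_on[where S = ?S and f = f and f' = f' and g' = "\<lambda>_ z. (fst z, frame_velocity \<kappa> q \<eta> z)"])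
    show "open ?S" by (intro open_Times open_chart_image[OF dA \<kappa>(1)] open_UNIV)
    show "(f has_derivative f' z) (at z)" if z: "z \<in> ?S" for z
    proof -
      have d: "((\<lambda>z. local_rep \<kappa> (X \<alpha>) (fst z)) has_derivative (\<lambda>w. frame_deriv \<kappa> \<alpha> (fst z) (fst w))) (at z)"
        if \<alpha>: "\<alpha> < DIM('e)" for \<alpha>
      proof -
        obtain q' where "q' \<in> fst \<kappa>" "fst z = snd \<kappa> q'" using z by (cases z) auto
        with vector_field_has_derivative[OF vector_field_frame[OF \<alpha>] \<kappa>(1)]
        have "(local_rep \<kappa> (X \<alpha>) has_derivative frame_deriv \<kappa> \<alpha> (fst z)) (at (fst z))" by simp
        from diff_chain_at[OF has_derivative_fst[OF has_derivative_ident] this]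
        show ?thesis by (simp add: o_def)
      qed
      show ?thesis unfolding f_def f'_def
        by (auto intro!: derivative_eq_intros d)
    qed
    show "g (f z) = z" if z: "z \<in> ?S" for z
    proof -
      obtain q' where q': "q' \<in> fst \<kappa>" "fst z = snd \<kappa> q'" using z by (cases z) auto
      then have "f z = (snd \<kappa> q', frame_vec q' (snd z) \<kappa>)" using fq[OF q'(1), of "snd z"] by (metis prod.collapse)
      then show ?thesis
        using q' \<kappa> carrierI tangent_eq_tvec_of[OF dA frame_vec_tangent, of q' \<kappa> "snd z"]
        by (simp add: g_def chart_inv_chart[OF dA] prod_eq_iff)
    qed
    show "(snd \<kappa> q, \<eta>) \<in> ?S" using \<kappa> by auto
    have "(\<Sum>\<alpha><DIM('e). dual_frame X \<alpha> q (tvec_of A q \<kappa> \<tau>) *\<^sub>R X \<alpha> q \<kappa>) = \<tau>" for \<tau>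
      using frame_expansion[OF carrierI[OF \<kappa>] tvec_of_tangent[OF dA \<kappa>, of \<tau>]] tvec_of_same[OF dA \<kappa>, of \<tau>]
      by metis
    then show "f' (snd \<kappa> q, \<eta>) \<circ> (\<lambda>z. (fst z, frame_velocity \<kappa> q \<eta> z)) = id"
      using \<kappa> by (auto simp: f'_def fun_eq_iff sum.distrib frame_velocity_def local_rep_chart)
  qed
  then show ?thesis using fq[OF \<kappa>(2)] unfolding g_def by simp
qed

text \<open>
  Chain rule for a function \<open>F\<close> on the tangent bundle whose expression in frame coordinates is \<open>\<Phi>\<close>.
\<close>

lemma tangent_bundle_has_derivative:
  assumes \<kappa>: "\<kappa> \<in> A" "q \<in> fst \<kappa>"
    and F: "\<And>q' \<zeta>. q' \<in> fst \<kappa> \<Longrightarrow> F (q', frame_vec q' \<zeta>) = \<Phi> (snd \<kappa> q', \<zeta>)"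
    and \<Phi>: "(\<Phi> has_derivative \<Phi>') (at (snd \<kappa> q, \<eta>))"
  shows "((F \<circ> chart_inv (lift_chart A \<kappa>)) has_derivative
      (\<lambda>z. \<Phi>' (fst z, frame_velocity \<kappa> q \<eta> z))) (at (snd (lift_chart A \<kappa>) (q, frame_vec q \<eta>)))"
proof -
  let ?S = "(snd \<kappa> ` fst \<kappa>) \<times> (UNIV :: 'e set)"
  let ?g = "\<lambda>z. (fst z, frame_coord (chart_inv \<kappa> (fst z)) (tvec_of A (chart_inv \<kappa> (fst z)) \<kappa> (snd z)))"
  have p: "snd (lift_chart A \<kappa>) (q, frame_vec q \<eta>) = (snd \<kappa> q, frame_vec q \<eta> \<kappa>)"
    by (simp add: lift_chart_def)
  have "?g (snd \<kappa> q, frame_vec q \<eta> \<kappa>) = (snd \<kappa> q, \<eta>)"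
    using tangent_eq_tvec_of[OF dA frame_vec_tangent \<kappa>] carrierI[OF \<kappa>] by (simp add: chart_inv_chart[OF dA \<kappa>])
  then have "((\<Phi> \<circ> ?g) has_derivative (\<Phi>' \<circ> (\<lambda>z. (fst z, frame_velocity \<kappa> q \<eta> z)))) (at (snd \<kappa> q, frame_vec q \<eta> \<kappa>))"
    using \<Phi> by (intro diff_chain_at frame_coord_chart_has_derivative[OF \<kappa>]) simp
  then have "((F \<circ> chart_inv (lift_chart A \<kappa>)) has_derivative
      (\<Phi>' \<circ> (\<lambda>z. (fst z, frame_velocity \<kappa> q \<eta> z)))) (at (snd \<kappa> q, frame_vec q \<eta> \<kappa>))"
  proof (rule has_derivative_transform_within_open[of _ _ _ _ ?S])
    show "open ?S" by (intro open_Times open_chart_image[OF dA \<kappa>(1)] open_UNIV)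
    show "(snd \<kappa> q, frame_vec q \<eta> \<kappa>) \<in> ?S" using \<kappa> by auto
    fix z assume "z \<in> ?S"
    then obtain q' \<xi> where z: "q' \<in> fst \<kappa>" "z = (snd \<kappa> q', \<xi>)" by (cases z) auto
    have c: "q' \<in> carrier A" using z \<kappa> carrierI by blast
    show "(\<Phi> \<circ> ?g) z = (F \<circ> chart_inv (lift_chart A \<kappa>)) z"
      using F[OF z(1), of "frame_coord q' (tvec_of A q' \<kappa> \<xi>)"]
        frame_vec_frame_coord[OF c tvec_of_tangent[OF dA \<kappa>(1) z(1)]]
      by (simp add: z chart_inv_lift_chart[OF manifold \<kappa>(1)] chart_inv_chart[OF dA \<kappa>(1)])
  qed
  then show ?thesis by (simp add: p o_def)
qed

end

context adapted_frame_manifold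
begin

section \<open>Complete and vertical lifts in frame coordinates\<close>

lemma dir_deriv_frame_chart:
  assumes \<kappa>: "\<kappa> \<in> A" "q \<in> fst \<kappa>"
    and F: "\<And>q' \<zeta>. q' \<in> fst \<kappa> \<Longrightarrow> F (q', frame_vec q' \<zeta>) = \<Phi> (snd \<kappa> q', \<zeta>)"
    and \<Phi>: "(\<Phi> has_derivative \<Phi>') (at (snd \<kappa> q, \<eta>))"
  shows "dir_deriv TA (q, frame_vec q \<eta>) (tvec_of TA (q, frame_vec q \<eta>) (lift_chart A \<kappa>) z) F =
      \<Phi>' (fst z, frame_velocity \<kappa> q \<eta> z)"
  by (rule dir_deriv_tvec_of[OF dTA _ _ tangent_bundle_has_derivative[OF assms]])
    (use \<kappa> carrierI[OF \<kappa>] in \<open>auto simp: tangent_atlas_def lift_chart_def\<close>)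

text \<open>
  The linear change \<open>\<psi>\<close> to frame coordinates is the same for all functions \<open>F\<close>. So what is known about
  the derivatives of some functions along \<open>w\<close>, such as the quasi-velocities, can be used for others.
\<close>

lemma dir_deriv_frame:
  assumes "q \<in> carrier A"
  obtains \<kappa> \<psi> where "\<kappa> \<in> A" "q \<in> fst \<kappa>"
    "\<And>F \<Phi> \<Phi>' w. (\<And>q' \<zeta>. q' \<in> fst \<kappa> \<Longrightarrow> F (q', frame_vec q' \<zeta>) = \<Phi> (snd \<kappa> q', \<zeta>)) \<Longrightarrow>
       (\<Phi> has_derivative \<Phi>') (at (snd \<kappa> q, \<eta>)) \<Longrightarrow>
       dir_deriv TA (q, frame_vec q \<eta>) w F = \<Phi>' (\<psi> w)"
proof -
  let ?p = "(q, frame_vec q \<eta>)"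
  let ?K = "chart_at TA ?p"
  have "?p \<in> carrier TA" using assms by (simp add: carrier_tangent_atlas tangent_bundle_def)
  note K = chart_at_in[OF this]
  then obtain \<kappa> where \<kappa>: "\<kappa> \<in> A" "?K = lift_chart A \<kappa>" by (auto simp: tangent_atlas_def)
  with K have q: "q \<in> fst \<kappa>" by (simp add: lift_chart_def)
  have *: "dir_deriv TA ?p w F = \<Phi>' (fst (w ?K), frame_velocity \<kappa> q \<eta> (w ?K))"
    if F: "\<And>q' \<zeta>. q' \<in> fst \<kappa> \<Longrightarrow> F (q', frame_vec q' \<zeta>) = \<Phi> (snd \<kappa> q', \<zeta>)"
      and \<Phi>: "(\<Phi> has_derivative \<Phi>') (at (snd \<kappa> q, \<eta>))" for F \<Phi> \<Phi>' w
    using frechet_derivative_at[OF tangent_bundle_has_derivative[OF \<kappa>(1) q F \<Phi>]] \<kappa>(2)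
    unfolding dir_deriv_def Let_def by metis
  show ?thesis by (rule that[OF \<kappa>(1) q *])
qed

lemma linear_frame_deriv:
  "\<alpha> < DIM('e) \<Longrightarrow> \<kappa> \<in> A \<Longrightarrow> q \<in> fst \<kappa> \<Longrightarrow> linear (frame_deriv \<kappa> \<alpha> (snd \<kappa> q))"
  using has_derivative_linear[OF vector_field_has_derivative[OF vector_field_frame]] by blast

lemma dir_deriv_vertical_lift:
  assumes q: "q \<in> carrier A" and Y: "Y q \<in> tangent_space A q"
    and F: "\<And>q' \<zeta>. q' \<in> fst (chart_at A q) \<Longrightarrow> F (q', frame_vec q' \<zeta>) = \<Phi> (snd (chart_at A q) q', \<zeta>)"
    and \<Phi>: "(\<Phi> has_derivative \<Phi>') (at (snd (chart_at A q) q, \<eta>))"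
  shows "dir_deriv TA (q, frame_vec q \<eta>) (vertical_lift A Y (q, frame_vec q \<eta>)) F = \<Phi>' (0, frame_coord q (Y q))"
proof -
  let ?\<kappa> = "chart_at A q"
  note \<kappa> = chart_at_in[OF q]
  have "frame_velocity ?\<kappa> q \<eta> (0, Y q ?\<kappa>) = frame_coord q (Y q)"
    using linear_0[OF linear_frame_deriv[OF _ \<kappa>]] tangent_eq_tvec_of[OF dA Y \<kappa>]
    by (simp add: frame_velocity_def)
  then show ?thesis
    using dir_deriv_frame_chart[OF \<kappa> F \<Phi>] by (simp add: vertical_lift_def Let_def)
qed

lemma linear_nab: "linear_connection A nab"
  using connection unfolding levi_civita_def by (rule conjunct1)

lemma connection_vector_field:
  "vector_field A U \<Longrightarrow> vector_field A V \<Longrightarrow> vector_field A (nab U V)"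
  by (rule linear_nab[unfolded linear_connection_def, THEN conjunct1, rule_format])

lemma torsion_free:
  assumes "vector_field A U" "vector_field A V" "q \<in> carrier A"
  shows "(\<lambda>\<kappa>. nab U V q \<kappa> - nab V U q \<kappa>) = lie_bracket A U V q"
  by (rule connection[unfolded levi_civita_def, THEN conjunct2, rule_format, OF assms(1,2,2,3), THEN conjunct1])

lemma connection_tangent:
  "\<alpha> < DIM('e) \<Longrightarrow> \<beta> < DIM('e) \<Longrightarrow> vector_field A (nab (X \<alpha>) (X \<beta>))"
  by (intro connection_vector_field vector_field_frame)

lemma lie_bracket_torsion_free:
  assumes "\<alpha> < DIM('e)" "\<beta> < DIM('e)" "q \<in> carrier A"
  shows "lie_bracket A (X \<alpha>) (X \<beta>) q = (\<lambda>\<kappa>. 1 *\<^sub>R nab (X \<alpha>) (X \<beta>) q \<kappa> + (-1) *\<^sub>R nab (X \<beta>) (X \<alpha>) q \<kappa>)"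
  using torsion_free[OF vector_field_frame vector_field_frame, OF assms] by simp

lemma connection_in_tangent:
  "\<alpha> < DIM('e) \<Longrightarrow> \<beta> < DIM('e) \<Longrightarrow> q \<in> carrier A \<Longrightarrow> nab (X \<alpha>) (X \<beta>) q \<in> tangent_space A q"
  using connection_tangent by (simp add: vector_field_on_def)

text \<open>
  The bracket is defined separately in each chart. Since it is the difference of two covariant
  derivatives, its values are tangent vectors; this replaces a computation with second derivatives
  of the transition maps.
\<close>

lemma
  assumes "\<alpha> < DIM('e)" "\<beta> < DIM('e)" "q \<in> carrier A"
  shows lie_bracket_tangent: "lie_bracket A (X \<alpha>) (X \<beta>) q \<in> tangent_space A q"
    and structure_fun_torsion_free: "\<gamma> < DIM('e) \<Longrightarrow> structure_fun A X \<gamma> \<alpha> \<beta> q =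
      dual_frame X \<gamma> q (nab (X \<alpha>) (X \<beta>) q) - dual_frame X \<gamma> q (nab (X \<beta>) (X \<alpha>) q)"
  unfolding structure_fun_def lie_bracket_torsion_free[OF assms]
  using assms by (auto simp only: tangent_linear connection_in_tangent)

text \<open>
  The complete lift differentiates \<open>X\<^sub>\<beta>\<close> along the given vector \<open>\<eta>\<^sup>\<alpha> X\<^sub>\<alpha>\<close>, and the passage to frame
  coordinates subtracts \<open>\<eta>\<^sup>\<alpha>\<close> times the derivative of \<open>X\<^sub>\<alpha>\<close> along \<open>X\<^sub>\<beta>\<close>. The difference is
  \<open>\<eta>\<^sup>\<alpha> [X\<^sub>\<alpha>, X\<^sub>\<beta>]\<close>.
\<close>

lemma dir_deriv_complete_lift:
  assumes q: "q \<in> carrier A" and \<beta>: "\<beta> < DIM('e)"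
    and F: "\<And>q' \<zeta>. q' \<in> fst (chart_at A q) \<Longrightarrow> F (q', frame_vec q' \<zeta>) = \<Phi> (snd (chart_at A q) q', \<zeta>)"
    and \<Phi>: "(\<Phi> has_derivative \<Phi>') (at (snd (chart_at A q) q, \<eta>))"
  shows "dir_deriv TA (q, frame_vec q \<eta>) (complete_lift A (X \<beta>) (q, frame_vec q \<eta>)) F =
    \<Phi>' (X \<beta> q (chart_at A q),
        \<Sum>\<gamma><DIM('e). (\<Sum>\<alpha><DIM('e). (\<eta> \<bullet> coord_basis \<alpha>) * structure_fun A X \<gamma> \<alpha> \<beta> q) *\<^sub>R coord_basis \<gamma>)"
proof -
  let ?\<kappa> = "chart_at A q"
  note \<kappa> = chart_at_in[OF q]
  let ?z = "(X \<beta> q ?\<kappa>, frame_deriv ?\<kappa> \<beta> (snd ?\<kappa> q) (frame_vec q \<eta> ?\<kappa>))"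
  let ?B = "\<lambda>\<kappa>'. \<Sum>\<alpha><DIM('e). (\<eta> \<bullet> coord_basis \<alpha>) *\<^sub>R lie_bracket A (X \<alpha>) (X \<beta>) q \<kappa>'"
  have B: "?B \<in> tangent_space A q"
    by (rule tangent_sum[OF q]) (auto simp: lie_bracket_tangent \<beta> q)
  note L = linear_frame_deriv[OF \<beta> \<kappa>]
  have "frame_deriv ?\<kappa> \<beta> (snd ?\<kappa> q) (frame_vec q \<eta> ?\<kappa>) =
      (\<Sum>\<alpha><DIM('e). (\<eta> \<bullet> coord_basis \<alpha>) *\<^sub>R frame_deriv ?\<kappa> \<beta> (snd ?\<kappa> q) (X \<alpha> q ?\<kappa>))"
    by (simp add: frame_vec_def linear_sum[OF L] linear_scale[OF L])
  then have "snd ?z - (\<Sum>\<alpha><DIM('e). (\<eta> \<bullet> coord_basis \<alpha>) *\<^sub>R frame_deriv ?\<kappa> \<alpha> (snd ?\<kappa> q) (fst ?z)) = ?B ?\<kappa>"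
    using \<kappa> by (simp add: lie_bracket_def scaleR_diff_right sum_subtractf)
  then have "frame_velocity ?\<kappa> q \<eta> ?z = frame_coord q ?B"
    unfolding frame_velocity_def using tangent_eq_tvec_of[OF dA B \<kappa>] by simp
  also have "\<dots> = (\<Sum>\<gamma><DIM('e). (\<Sum>\<alpha><DIM('e). (\<eta> \<bullet> coord_basis \<alpha>) * structure_fun A X \<gamma> \<alpha> \<beta> q) *\<^sub>R coord_basis \<gamma>)"
    unfolding frame_coord_def structure_fun_def
    by (intro sum.cong refl arg_cong[where f = "\<lambda>c. c *\<^sub>R _"] tangent_sum(2)[OF q])
      (auto simp: lie_bracket_tangent \<beta> q)
  finally show ?thesis
    using dir_deriv_frame_chart[OF \<kappa> F \<Phi>, of ?z] by (simp add: complete_lift_def Let_def)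
qed

section \<open>Continuity of components in the frame\<close>

definition chart_continuous :: "('q \<Rightarrow> real) \<Rightarrow> bool" where
  "chart_continuous f \<longleftrightarrow> (\<forall>\<kappa>\<in>A. continuous_on (snd \<kappa> ` fst \<kappa>) (\<lambda>x. f (chart_inv \<kappa> x)))"

lemma carrier_Int: "\<kappa> \<in> A \<Longrightarrow> carrier A \<inter> fst \<kappa> = fst \<kappa>"
  by (auto simp: carrier_def)

lemma dual_frame_continuous:
  assumes Y: "vector_field A Y" and \<alpha>: "\<alpha> < DIM('e)"
  shows "chart_continuous (\<lambda>q. dual_frame X \<alpha> q (Y q))"
  unfolding chart_continuous_def
proof
  fix \<kappa> assume \<kappa>: "\<kappa> \<in> A"
  let ?S = "snd \<kappa> ` fst \<kappa>"
  define G where "G z = (fst z, frame_coord (chart_inv \<kappa> (fst z)) (tvec_of A (chart_inv \<kappa> (fst z)) \<kappa> (snd z)))"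
    for z :: "'e \<times> 'e"
  have "continuous_on (?S \<times> UNIV) G"
  proof (rule continuous_at_imp_continuous_on, rule ballI)
    fix z assume "z \<in> ?S \<times> (UNIV :: 'e set)"
    then obtain q \<xi> where z: "q \<in> fst \<kappa>" "z = (snd \<kappa> q, \<xi>)" by (cases z) auto
    have "frame_vec q (frame_coord q (tvec_of A q \<kappa> \<xi>)) \<kappa> = \<xi>"
      using frame_vec_frame_coord[OF carrierI[OF \<kappa> z(1)] tvec_of_tangent[OF dA \<kappa> z(1)], of \<xi>]
        tvec_of_same[OF dA \<kappa> z(1), of \<xi>] by simp
    then show "isCont G z"
      using has_derivative_continuous[OF frame_coord_chart_has_derivative[OF \<kappa> z(1)],
          of "frame_coord q (tvec_of A q \<kappa> \<xi>)"] by (simp add: G_def[abs_def] z(2))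
  qed
  then have "continuous_on ?S (\<lambda>x. G (x, local_rep \<kappa> Y x))"
    by (rule continuous_on_compose2)
      (auto intro!: continuous_on_Pair continuous_on_id vector_field_continuous[OF Y \<kappa>])
  then have "continuous_on ?S (\<lambda>x. snd (G (x, local_rep \<kappa> Y x)) \<bullet> coord_basis \<alpha>)"
    by (intro continuous_on_inner continuous_on_snd continuous_on_const)
  then show "continuous_on ?S (\<lambda>x. dual_frame X \<alpha> (chart_inv \<kappa> x) (Y (chart_inv \<kappa> x)))"
  proof (rule continuous_on_eq)
    fix x assume "x \<in> ?S"
    then obtain q where q: "q \<in> fst \<kappa>" "x = snd \<kappa> q" by auto
    have "Y q \<in> tangent_space A q" using Y carrierI[OF \<kappa> q(1)] by (simp add: vector_field_on_def)
    then show "snd (G (x, local_rep \<kappa> Y x)) \<bullet> coord_basis \<alpha> = dual_frame X \<alpha> (chart_inv \<kappa> x) (Y (chart_inv \<kappa> x))"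
      using tangent_eq_tvec_of[OF dA _ \<kappa> q(1), of "Y q"] \<alpha> q
      by (simp add: G_def local_rep_chart[OF \<kappa>] chart_inv_chart[OF dA \<kappa>])
  qed
qed

lemma structure_fun_continuous:
  assumes "\<alpha> < DIM('e)" "\<beta> < DIM('e)" "\<gamma> < DIM('e)"
  shows "chart_continuous (structure_fun A X \<gamma> \<alpha> \<beta>)"
  unfolding chart_continuous_def
proof
  fix \<kappa> assume \<kappa>: "\<kappa> \<in> A"
  have "continuous_on (snd \<kappa> ` fst \<kappa>) (\<lambda>x. dual_frame X \<gamma> (chart_inv \<kappa> x) (nab (X \<alpha>) (X \<beta>) (chart_inv \<kappa> x))
      - dual_frame X \<gamma> (chart_inv \<kappa> x) (nab (X \<beta>) (X \<alpha>) (chart_inv \<kappa> x)))"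
    using dual_frame_continuous[OF connection_tangent assms(3)] assms \<kappa>
    unfolding chart_continuous_def by (intro continuous_on_diff) auto
  then show "continuous_on (snd \<kappa> ` fst \<kappa>) (\<lambda>x. structure_fun A X \<gamma> \<alpha> \<beta> (chart_inv \<kappa> x))"
    by (rule continuous_on_eq)
      (use assms \<kappa> carrierI[OF \<kappa>] in \<open>auto simp: structure_fun_torsion_free chart_inv_chart[OF dA]\<close>)
qed

lemma smooth_fun_has_derivative:
  assumes "smooth_fun_on A (carrier A) f" "\<kappa> \<in> A" "q \<in> fst \<kappa>"
  shows "((\<lambda>x. f (chart_inv \<kappa> x)) has_derivative frechet_derivative (\<lambda>x. f (chart_inv \<kappa> x)) (at (snd \<kappa> q))) (at (snd \<kappa> q))"
proof -
  have "Ck_on (Suc 0) (snd \<kappa> ` fst \<kappa>) (\<lambda>x. f (chart_inv \<kappa> x))"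
    using assms unfolding smooth_fun_on_def smooth_on_def comp_def by (metis carrier_Int)
  then show ?thesis using assms frechet_derivative_works by auto
qed

lemma smooth_fun_continuous:
  assumes "smooth_fun_on A (carrier A) f"
  shows "chart_continuous f"
  unfolding chart_continuous_def
proof
  fix \<kappa> assume \<kappa>: "\<kappa> \<in> A"
  have "Ck_on 0 (snd \<kappa> ` fst \<kappa>) (\<lambda>x. f (chart_inv \<kappa> x))"
    using assms \<kappa> unfolding smooth_fun_on_def smooth_on_def comp_def by (metis carrier_Int)
  then show "continuous_on (snd \<kappa> ` fst \<kappa>) (\<lambda>x. f (chart_inv \<kappa> x))" by simp
qed

lemma dir_deriv_smooth_fun:
  assumes "smooth_fun_on A (carrier A) f" "\<kappa> \<in> A" "q \<in> fst \<kappa>" "v \<in> tangent_space A q"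
  shows "dir_deriv A q v f = frechet_derivative (\<lambda>x. f (chart_inv \<kappa> x)) (at (snd \<kappa> q)) (v \<kappa>)"
  using dir_deriv_in_chart[OF dA assms(4,2,3)] smooth_fun_has_derivative[OF assms(1-3)] by (simp add: comp_def)

lemma dir_deriv_continuous:
  assumes f: "smooth_fun_on A (carrier A) f" and Y: "vector_field A Y"
  shows "chart_continuous (\<lambda>q. dir_deriv A q (Y q) f)"
  unfolding chart_continuous_def
proof
  fix \<kappa> assume \<kappa>: "\<kappa> \<in> A"
  let ?S = "snd \<kappa> ` fst \<kappa>"
  let ?D = "\<lambda>x. frechet_derivative (\<lambda>x. f (chart_inv \<kappa> x)) (at x)"
  have "Ck_on (Suc 0) ?S (\<lambda>x. f (chart_inv \<kappa> x))"
    using f \<kappa> unfolding smooth_fun_on_def smooth_on_def comp_def by (metis carrier_Int)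
  then have "continuous_on ?S (\<lambda>x. \<Sum>b\<in>Basis. (local_rep \<kappa> Y x \<bullet> b) * ?D x b)"
    by (intro continuous_intros vector_field_continuous[OF Y \<kappa>]) auto
  then show "continuous_on ?S (\<lambda>x. dir_deriv A (chart_inv \<kappa> x) (Y (chart_inv \<kappa> x)) f)"
  proof (rule continuous_on_eq)
    fix x assume "x \<in> ?S"
    then obtain q where q: "q \<in> fst \<kappa>" "x = snd \<kappa> q" by auto
    have Yq: "Y q \<in> tangent_space A q" using Y carrierI[OF \<kappa> q(1)] by (simp add: vector_field_on_def)
    note L = has_derivative_linear[OF smooth_fun_has_derivative[OF f \<kappa> q(1)]]
    have "?D x (Y q \<kappa>) = ?D x (\<Sum>b\<in>Basis. (Y q \<kappa> \<bullet> b) *\<^sub>R b)" by (simp add: euclidean_representation)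
    also have "\<dots> = (\<Sum>b\<in>Basis. (Y q \<kappa> \<bullet> b) * ?D x b)"
      unfolding q(2) by (simp add: linear_sum[OF L] linear_scale[OF L])
    finally show "(\<Sum>b\<in>Basis. (local_rep \<kappa> Y x \<bullet> b) * ?D x b) = dir_deriv A (chart_inv \<kappa> x) (Y (chart_inv \<kappa> x)) f"
      using dir_deriv_smooth_fun[OF f \<kappa> q(1) Yq] by (simp add: q local_rep_chart[OF \<kappa>] chart_inv_chart[OF dA \<kappa>])
  qed
qed

lemma tensor_smooth:
  "symmetric_tensor A h \<Longrightarrow> \<alpha> < DIM('e) \<Longrightarrow> \<beta> < DIM('e) \<Longrightarrow> smooth_fun_on A (carrier A) (\<lambda>q. h q (X \<alpha> q) (X \<beta> q))"
  using vector_field_frame unfolding symmetric_tensor_def by blast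

section \<open>Kinetic energy and multipliers\<close>

abbreviation metric_deriv :: "('q, 'e) chart \<Rightarrow> 'q \<Rightarrow> nat \<Rightarrow> nat \<Rightarrow> 'e \<Rightarrow> real" where
  "metric_deriv \<kappa> q \<alpha> \<beta> \<equiv>
     frechet_derivative (\<lambda>x. g (chart_inv \<kappa> x) (X \<alpha> (chart_inv \<kappa> x)) (X \<beta> (chart_inv \<kappa> x))) (at (snd \<kappa> q))"

lemma tensor_frame_expansion:
  assumes h: "symmetric_tensor A h" and q: "q \<in> carrier A" and v: "v \<in> tangent_space A q" "w \<in> tangent_space A q"
  shows "h q v w = (\<Sum>\<alpha><DIM('e). \<Sum>\<beta><DIM('e).
     h q (X \<alpha> q) (X \<beta> q) * dual_frame X \<alpha> q v * dual_frame X \<beta> q w)"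
proof -
  have "h q v w = (\<Sum>\<alpha><DIM('e). dual_frame X \<alpha> q v * h q (X \<alpha> q) w)"
    by (rule tensor_frame_left[OF h q v])
  also have "\<dots> = (\<Sum>\<alpha><DIM('e). dual_frame X \<alpha> q v * (\<Sum>\<beta><DIM('e). dual_frame X \<beta> q w * h q (X \<alpha> q) (X \<beta> q)))"
    by (intro sum.cong refl arg_cong[where f = "\<lambda>z. _ * z"] tensor_frame_right[OF h q])
      (auto simp: frame_in_tangent q v)
  finally show ?thesis by (simp add: sum_distrib_left mult_ac)
qed

definition kinetic_rep :: "('q, 'e) chart \<Rightarrow> 'e \<times> 'e \<Rightarrow> real" where
  "kinetic_rep \<kappa> z = 1/2 * (\<Sum>\<alpha><DIM('e). \<Sum>\<beta><DIM('e).
     g (chart_inv \<kappa> (fst z)) (X \<alpha> (chart_inv \<kappa> (fst z))) (X \<beta> (chart_inv \<kappa> (fst z)))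
       * (snd z \<bullet> coord_basis \<alpha>) * (snd z \<bullet> coord_basis \<beta>))"

lemma kinetic_lagrangian_rep:
  "\<kappa> \<in> A \<Longrightarrow> q \<in> fst \<kappa> \<Longrightarrow> kinetic_lagrangian g (q, frame_vec q \<zeta>) = kinetic_rep \<kappa> (snd \<kappa> q, \<zeta>)"
  using tensor_frame_expansion[OF metric_tensor carrierI, of \<kappa> q "frame_vec q \<zeta>" "frame_vec q \<zeta>"] carrierI
  by (simp add: kinetic_lagrangian_def kinetic_rep_def chart_inv_chart[OF dA])

lemma smooth_fun_fst_has_derivative:
  assumes f: "smooth_fun_on A (carrier A) f" and \<kappa>: "\<kappa> \<in> A" "q \<in> fst \<kappa>"
  shows "((\<lambda>z. f (chart_inv \<kappa> (fst z))) has_derivative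
      (\<lambda>w. frechet_derivative (\<lambda>x. f (chart_inv \<kappa> x)) (at (snd \<kappa> q)) (fst w))) (at (snd \<kappa> q, \<eta> :: 'e))"
proof -
  have "((\<lambda>x. f (chart_inv \<kappa> x)) has_derivative frechet_derivative (\<lambda>x. f (chart_inv \<kappa> x)) (at (snd \<kappa> q)))
      (at (fst (snd \<kappa> q, \<eta>)))" using smooth_fun_has_derivative[OF assms] by simp
  from diff_chain_at[OF has_derivative_fst[OF has_derivative_ident] this]
  show ?thesis by (simp add: comp_def)
qed

lemma kinetic_rep_has_derivative:
  assumes \<kappa>: "\<kappa> \<in> A" "q \<in> fst \<kappa>"
  shows "(kinetic_rep \<kappa> has_derivative (\<lambda>w. 1/2 * (\<Sum>\<alpha><DIM('e). \<Sum>\<beta><DIM('e).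
       metric_deriv \<kappa> q \<alpha> \<beta> (fst w) * (\<eta> \<bullet> coord_basis \<alpha>) * (\<eta> \<bullet> coord_basis \<beta>))
     + g q (frame_vec q (snd w)) (frame_vec q \<eta>))) (at (snd \<kappa> q, \<eta>))"
proof -
  note q = carrierI[OF \<kappa>]
  let ?g = "\<lambda>\<alpha> \<beta>. g q (X \<alpha> q) (X \<beta> q)"
  let ?c = "\<lambda>\<zeta> \<alpha>. \<zeta> \<bullet> coord_basis \<alpha> :: real"
  note d = smooth_fun_fst_has_derivative[OF tensor_smooth[OF metric_tensor] \<kappa>]
  have "(kinetic_rep \<kappa> has_derivative (\<lambda>w. 1/2 * (\<Sum>\<alpha><DIM('e). \<Sum>\<beta><DIM('e).
       metric_deriv \<kappa> q \<alpha> \<beta> (fst w) * ?c \<eta> \<alpha> * ?c \<eta> \<beta>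
       + ?g \<alpha> \<beta> * ?c (snd w) \<alpha> * ?c \<eta> \<beta> + ?g \<alpha> \<beta> * ?c \<eta> \<alpha> * ?c (snd w) \<beta>))) (at (snd \<kappa> q, \<eta>))"
    unfolding kinetic_rep_def
    by (auto intro!: derivative_eq_intros d simp: chart_inv_chart[OF dA \<kappa>] algebra_simps)
  moreover have "1/2 * (\<Sum>\<alpha><DIM('e). \<Sum>\<beta><DIM('e). metric_deriv \<kappa> q \<alpha> \<beta> (fst w) * ?c \<eta> \<alpha> * ?c \<eta> \<beta>
       + ?g \<alpha> \<beta> * ?c (snd w) \<alpha> * ?c \<eta> \<beta> + ?g \<alpha> \<beta> * ?c \<eta> \<alpha> * ?c (snd w) \<beta>) =
     1/2 * (\<Sum>\<alpha><DIM('e). \<Sum>\<beta><DIM('e). metric_deriv \<kappa> q \<alpha> \<beta> (fst w) * ?c \<eta> \<alpha> * ?c \<eta> \<beta>)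
     + g q (frame_vec q (snd w)) (frame_vec q \<eta>)" for w :: "'e \<times> 'e"
  proof -
    have "g q (frame_vec q (snd w)) (frame_vec q \<eta>) = (\<Sum>\<alpha><DIM('e). \<Sum>\<beta><DIM('e). ?g \<alpha> \<beta> * ?c (snd w) \<alpha> * ?c \<eta> \<beta>)"
      "g q (frame_vec q (snd w)) (frame_vec q \<eta>) = (\<Sum>\<alpha><DIM('e). \<Sum>\<beta><DIM('e). ?g \<alpha> \<beta> * ?c \<eta> \<alpha> * ?c (snd w) \<beta>)"
      using tensor_frame_expansion[OF metric_tensor q, of "frame_vec q (snd w)" "frame_vec q \<eta>"]
        tensor_frame_expansion[OF metric_tensor q, of "frame_vec q \<eta>" "frame_vec q (snd w)"]
        tensor_sym[OF metric_tensor q, of "frame_vec q (snd w)" "frame_vec q \<eta>"] q by auto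
    then show ?thesis by (simp add: sum.distrib)
  qed
  ultimately show ?thesis by (simp only:)
qed

lemma vertical_lift_kinetic:
  assumes q: "q \<in> carrier A" and i: "i < DIM('e)"
  shows "dir_deriv TA (q, frame_vec q \<eta>) (vertical_lift A (X i) (q, frame_vec q \<eta>)) (kinetic_lagrangian g) =
    g q (X i q) (frame_vec q \<eta>)"
proof -
  note \<kappa> = chart_at_in[OF q]
  have "metric_deriv (chart_at A q) q \<alpha> \<beta> 0 = 0" if "\<alpha> < DIM('e)" "\<beta> < DIM('e)" for \<alpha> \<beta>
    using linear_0[OF has_derivative_linear[OF smooth_fun_has_derivative[OF tensor_smooth[OF metric_tensor that] \<kappa>]]] .
  then show ?thesis
    using dir_deriv_vertical_lift[where Y = "X i" and F = "kinetic_lagrangian g" and \<Phi> = "kinetic_rep (chart_at A q)",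
        OF q frame_in_tangent[OF i q] kinetic_lagrangian_rep[OF \<kappa>(1)] kinetic_rep_has_derivative[OF \<kappa>]]
      frame_vec_frame_coord[OF q frame_in_tangent[OF i q]] by simp
qed

lemma quasi_velocity_frame [simp]:
  "q \<in> carrier A \<Longrightarrow> \<alpha> < DIM('e) \<Longrightarrow> quasi_velocity X \<alpha> (q, frame_vec q \<zeta>) = \<zeta> \<bullet> coord_basis \<alpha>"
  by (simp add: quasi_velocity_def)

lemma frame_coord_has_derivative:
  "((\<lambda>z. snd z \<bullet> (b :: 'e)) has_derivative (\<lambda>w. snd w \<bullet> b)) (at (z :: 'e \<times> 'e))"
  by (auto intro!: derivative_eq_intros)

text \<open>
  Minus the derivative of the kinetic energy along the complete lift of \<open>X\<^sub>i\<close>, at the vector with frame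
  coordinate \<open>\<eta>\<close>.
\<close>

definition lambda_expr :: "nat \<Rightarrow> 'q \<Rightarrow> 'e \<Rightarrow> real" where
  "lambda_expr i q \<eta> =
     - (1/2 * (\<Sum>\<alpha><DIM('e). \<Sum>\<beta><DIM('e). dir_deriv A q (X i q) (\<lambda>x. g x (X \<alpha> x) (X \<beta> x))
          * (\<eta> \<bullet> coord_basis \<alpha>) * (\<eta> \<bullet> coord_basis \<beta>))
        + (\<Sum>\<alpha><DIM('e). \<Sum>\<beta><DIM('e). g q (X \<alpha> q) (X \<beta> q)
          * (\<Sum>\<gamma><DIM('e). (\<eta> \<bullet> coord_basis \<gamma>) * structure_fun A X \<alpha> \<gamma> i q) * (\<eta> \<bullet> coord_basis \<beta>)))"

text \<open>
  As \<open>X\<^sub>i\<close> is orthogonal to \<open>D\<close>, the function \<open>X\<^sub>i\<^sup>V(L) = g(X\<^sub>i, v)\<close> is a combination of the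
  quasi-velocities \<open>v\<^sup>k\<close> that define the constraint. These vanish at the point, and so do their
  derivatives along \<open>G\<close>; only \<open>-X\<^sub>i\<^sup>C(L)\<close> is left. In contrast to the definition of the multipliers, the
  result involves no field on the tangent bundle and is visibly continuous in the base point and \<open>\<eta>\<close>.
\<close>

lemma multiplier_formula:
  assumes q: "q \<in> carrier A" and i: "i \<in> {m..<DIM('e)}"
    and \<eta>: "\<And>k. k \<in> {m..<DIM('e)} \<Longrightarrow> \<eta> \<bullet> coord_basis k = 0"
    and tangent: "\<And>k. k \<in> {m..<DIM('e)} \<Longrightarrow>
      dir_deriv TA (q, frame_vec q \<eta>) (G (q, frame_vec q \<eta>)) (quasi_velocity X k) = 0"
  shows "multiplier A (kinetic_lagrangian g) X G i (q, frame_vec q \<eta>) = lambda_expr i q \<eta>"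
proof -
  let ?p = "(q, frame_vec q \<eta>)"
  let ?c = "\<lambda>\<zeta> \<alpha>. \<zeta> \<bullet> coord_basis \<alpha> :: real"
  let ?F = "\<lambda>r. dir_deriv TA r (vertical_lift A (X i) r) (kinetic_lagrangian g)"
  have i': "i < DIM('e)" using i by simp
  obtain \<kappa> \<psi> where \<kappa>: "\<kappa> \<in> A" "q \<in> fst \<kappa>" and \<psi>:
    "\<And>F \<Phi> \<Phi>' w. (\<And>q' \<zeta>. q' \<in> fst \<kappa> \<Longrightarrow> F (q', frame_vec q' \<zeta>) = \<Phi> (snd \<kappa> q', \<zeta>)) \<Longrightarrow>
       (\<Phi> has_derivative \<Phi>') (at (snd \<kappa> q, \<eta>)) \<Longrightarrow> dir_deriv TA ?p w F = \<Phi>' (\<psi> w)"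
    using dir_deriv_frame[OF q, of \<eta>] by blast
  have \<psi>0: "?c (snd (\<psi> (G ?p))) k = 0" if k: "k \<in> {m..<DIM('e)}" for k
    using \<psi>[of "quasi_velocity X k" "\<lambda>z. ?c (snd z) k", OF _ frame_coord_has_derivative] tangent[OF k] k
      carrierI[OF \<kappa>(1)] by simp
  define \<Phi> where "\<Phi> z = (\<Sum>k\<in>{m..<DIM('e)}. g (chart_inv \<kappa> (fst z)) (X i (chart_inv \<kappa> (fst z))) (X k (chart_inv \<kappa> (fst z)))
      * ?c (snd z) k)" for z :: "'e \<times> 'e"
  have F\<Phi>: "?F (q', frame_vec q' \<zeta>) = \<Phi> (snd \<kappa> q', \<zeta>)" if q': "q' \<in> fst \<kappa>" for q' \<zeta>
  proof -
    note c = carrierI[OF \<kappa>(1) q']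
    have "?F (q', frame_vec q' \<zeta>) = (\<Sum>k<DIM('e). ?c \<zeta> k * g q' (X i q') (X k q'))"
      using vertical_lift_kinetic[OF c i'] tensor_frame_right[OF metric_tensor c frame_in_tangent[OF i' c] frame_vec_tangent[OF c]]
      by (simp add: c)
    also have "\<dots> = (\<Sum>k\<in>{m..<DIM('e)}. ?c \<zeta> k * g q' (X i q') (X k q'))"
      by (rule sum.mono_neutral_right) (use metric_orthogonal[OF c _ i] in auto)
    finally show ?thesis by (simp add: \<Phi>_def chart_inv_chart[OF dA \<kappa>(1) q'] mult.commute)
  qed
  have d: "((\<lambda>z. g (chart_inv \<kappa> (fst z)) (X i (chart_inv \<kappa> (fst z))) (X k (chart_inv \<kappa> (fst z)))) has_derivative
       (\<lambda>w. metric_deriv \<kappa> q i k (fst w))) (at (snd \<kappa> q, \<eta>))" if "k < DIM('e)" for k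
    by (rule smooth_fun_fst_has_derivative[OF tensor_smooth[OF metric_tensor i' that] \<kappa>])
  have "(\<Phi> has_derivative (\<lambda>w. \<Sum>k\<in>{m..<DIM('e)}. g q (X i q) (X k q) * ?c (snd w) k
      + metric_deriv \<kappa> q i k (fst w) * ?c \<eta> k)) (at (snd \<kappa> q, \<eta>))"
    unfolding \<Phi>_def by (auto intro!: derivative_eq_intros d simp: chart_inv_chart[OF dA \<kappa>])
  from \<psi>[OF F\<Phi> this, of "G ?p"] have "dir_deriv TA ?p (G ?p) ?F = 0"
    by (simp add: \<eta> \<psi>0)
  moreover have "dir_deriv TA ?p (complete_lift A (X i) ?p) (kinetic_lagrangian g) = - lambda_expr i q \<eta>"
  proof -
    let ?\<kappa> = "chart_at A q"
    let ?\<zeta> = "\<Sum>\<gamma><DIM('e). (\<Sum>\<alpha><DIM('e). ?c \<eta> \<alpha> * structure_fun A X \<gamma> \<alpha> i q) *\<^sub>R coord_basis \<gamma> :: 'e"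
    note \<kappa> = chart_at_in[OF q]
    have "dir_deriv A q (X i q) (\<lambda>x. g x (X \<alpha> x) (X \<beta> x)) = metric_deriv ?\<kappa> q \<alpha> \<beta> (X i q ?\<kappa>)"
      if "\<alpha> < DIM('e)" "\<beta> < DIM('e)" for \<alpha> \<beta>
      by (rule dir_deriv_smooth_fun[OF tensor_smooth[OF metric_tensor that] \<kappa> frame_in_tangent[OF i' q]])
    moreover have "g q (frame_vec q ?\<zeta>) (frame_vec q \<eta>) = (\<Sum>\<alpha><DIM('e). \<Sum>\<beta><DIM('e). g q (X \<alpha> q) (X \<beta> q)
          * (\<Sum>\<gamma><DIM('e). ?c \<eta> \<gamma> * structure_fun A X \<alpha> \<gamma> i q) * ?c \<eta> \<beta>)"
      using q by (subst tensor_frame_expansion[OF metric_tensor q]) (auto simp: inner_sum_coord_basis)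
    ultimately show ?thesis
      using dir_deriv_complete_lift[where F = "kinetic_lagrangian g" and \<Phi> = "kinetic_rep ?\<kappa>",
          OF q i' kinetic_lagrangian_rep[OF \<kappa>(1)] kinetic_rep_has_derivative[OF \<kappa>]]
      by (simp add: lambda_expr_def)
  qed
  ultimately show ?thesis by (simp add: multiplier_def lagrange_expr_def)
qed

end

lemma Ck_on_cong:
  assumes "open S" "\<And>x. x \<in> S \<Longrightarrow> f x = g x" "Ck_on k S f"
  shows "Ck_on k S g"
  using assms(2,3)
proof (induction k arbitrary: f g)
  case 0
  then show ?case using continuous_on_cong[of S S f g] by simp
next
  case (Suc k)
  have d: "(g has_derivative frechet_derivative f (at x)) (at x)" if "x \<in> S" for x
  proof -
    have "(f has_derivative frechet_derivative f (at x)) (at x)"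
      using Suc.prems(2) that by (simp add: frechet_derivative_works[symmetric])
    then show ?thesis
      by (rule has_derivative_transform_within_open[OF _ assms(1) that]) (rule Suc.prems(1))
  qed
  have eq: "frechet_derivative g (at x) = frechet_derivative f (at x)" if "x \<in> S" for x
    using frechet_derivative_at[OF d[OF that]] by simp
  have "Ck_on k S (\<lambda>x. frechet_derivative g (at x) v)" for v
    by (rule Suc.IH[of "\<lambda>x. frechet_derivative f (at x) v"]) (use Suc.prems(2) eq in auto)
  moreover have "g differentiable (at x)" if "x \<in> S" for x
    using d[OF that] unfolding differentiable_def by blast
  ultimately show ?case by simp
qed

lemma Ck_on_const: "Ck_on k S (\<lambda>_. c)"
  by (induction k arbitrary: c) auto

lemma Ck_on_linear:
  assumes "open S" "Ck_on k S f" "Ck_on k S g"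
  shows "Ck_on k S (\<lambda>x. a *\<^sub>R f x + b *\<^sub>R g x)"
  using assms(2,3)
proof (induction k arbitrary: f g)
  case 0
  then show ?case by (auto intro!: continuous_intros)
next
  case (Suc k)
  let ?h = "\<lambda>x. a *\<^sub>R f x + b *\<^sub>R g x"
  have d: "(?h has_derivative (\<lambda>v. a *\<^sub>R frechet_derivative f (at x) v + b *\<^sub>R frechet_derivative g (at x) v)) (at x)"
    if "x \<in> S" for x
    using Suc.prems that
    by (intro has_derivative_add has_derivative_scaleR_right) (simp_all add: frechet_derivative_works[symmetric])
  have eq: "frechet_derivative ?h (at x) = (\<lambda>v. a *\<^sub>R frechet_derivative f (at x) v + b *\<^sub>R frechet_derivative g (at x) v)"
    if "x \<in> S" for x
    using frechet_derivative_at[OF d[OF that]] by simp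
  have "Ck_on k S (\<lambda>x. frechet_derivative ?h (at x) v)" for v
    by (rule Ck_on_cong[OF assms(1) _ Suc.IH[of "\<lambda>x. frechet_derivative f (at x) v" "\<lambda>x. frechet_derivative g (at x) v"]])
      (use Suc.prems eq in auto)
  moreover have "?h differentiable (at x)" if "x \<in> S" for x
    using d[OF that] unfolding differentiable_def by blast
  ultimately show ?case by simp
qed

context adapted_frame_manifold
begin

section \<open>Locality and linearity of brackets and connections\<close>

lemma local_rep_cong:
  assumes "\<And>q. q \<in> carrier A \<Longrightarrow> U' q = U q" "\<kappa> \<in> A" "x \<in> snd \<kappa> ` fst \<kappa>"
  shows "local_rep \<kappa> U' x = local_rep \<kappa> U x"
  using assms carrierI[OF assms(2)] by (auto simp: local_rep_chart)

lemma vector_field_cong: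
  assumes "vector_field A U" "\<And>q. q \<in> carrier A \<Longrightarrow> U' q = U q"
  shows "vector_field A U'"
  unfolding vector_field_on_def smooth_on_def
proof (intro conjI ballI allI)
  show "U' q \<in> tangent_space A q" if "q \<in> carrier A" for q
    using assms that by (simp add: vector_field_on_def)
  fix \<kappa> k assume \<kappa>: "\<kappa> \<in> A"
  show "Ck_on k (snd \<kappa> ` (carrier A \<inter> fst \<kappa>)) (local_rep \<kappa> U')"
    unfolding carrier_Int[OF \<kappa>]
  proof (rule Ck_on_cong[OF open_chart_image[OF dA \<kappa>]])
    show "Ck_on k (snd \<kappa> ` fst \<kappa>) (local_rep \<kappa> U)"
      using assms(1) \<kappa> unfolding vector_field_on_def smooth_on_def by (metis carrier_Int)
  qed (use local_rep_cong[OF assms(2) \<kappa>] in auto)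
qed

lemma vector_field_linear:
  assumes "vector_field A U" "vector_field A V"
  shows "vector_field A (\<lambda>q \<kappa>. a *\<^sub>R U q \<kappa> + b *\<^sub>R V q \<kappa>)"
  unfolding vector_field_on_def smooth_on_def
proof (intro conjI ballI allI)
  show "(\<lambda>\<kappa>. a *\<^sub>R U q \<kappa> + b *\<^sub>R V q \<kappa>) \<in> tangent_space A q" if "q \<in> carrier A" for q
    using assms that by (intro tangent_linear) (auto simp: vector_field_on_def)
  fix \<kappa> k assume \<kappa>: "\<kappa> \<in> A"
  have "local_rep \<kappa> (\<lambda>q \<kappa>. a *\<^sub>R U q \<kappa> + b *\<^sub>R V q \<kappa>) = (\<lambda>x. a *\<^sub>R local_rep \<kappa> U x + b *\<^sub>R local_rep \<kappa> V x)"
    by (auto simp: local_rep_def)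
  then show "Ck_on k (snd \<kappa> ` (carrier A \<inter> fst \<kappa>)) (local_rep \<kappa> (\<lambda>q \<kappa>. a *\<^sub>R U q \<kappa> + b *\<^sub>R V q \<kappa>))"
    using assms \<kappa> open_chart_image[OF dA \<kappa>] carrier_Int[OF \<kappa>]
    by (auto intro!: Ck_on_linear simp: vector_field_on_def smooth_on_def)
qed

abbreviation zero_field :: "('q, 'e) vfield" where
  "zero_field \<equiv> (\<lambda>q \<kappa>. 0)"

lemma zero_tangent: "q \<in> carrier A \<Longrightarrow> (\<lambda>\<kappa>. 0) \<in> tangent_space A q"
  using tangent_sum(1)[of q "{}"] by simp

lemma zero_vector_field: "vector_field A zero_field"
  by (auto simp: vector_field_on_def smooth_on_def local_rep_def[abs_def] zero_tangent Ck_on_const)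

lemma vector_field_frame_sum:
  "finite I \<Longrightarrow> I \<subseteq> {..<DIM('e)} \<Longrightarrow> vector_field A (\<lambda>q. lincomb I c (\<lambda>\<beta>. X \<beta> q))"
proof (induction I rule: finite_induct)
  case empty
  then show ?case using zero_vector_field by (simp add: lincomb_def)
next
  case (insert i I)
  then have "vector_field A (\<lambda>q \<kappa>. c i *\<^sub>R X i q \<kappa> + 1 *\<^sub>R lincomb I c (\<lambda>\<beta>. X \<beta> q) \<kappa>)"
    by (intro vector_field_linear vector_field_frame) auto
  then show ?case using insert by (simp add: lincomb_def)
qed

lemma lie_bracket_cong:
  assumes "\<And>q. q \<in> carrier A \<Longrightarrow> U' q = U q" "\<And>q. q \<in> carrier A \<Longrightarrow> V' q = V q"
  shows "lie_bracket A U' V' q = lie_bracket A U V q"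
proof
  fix \<kappa>
  have D: "frechet_derivative (local_rep \<kappa> W') (at (snd \<kappa> q)) = frechet_derivative (local_rep \<kappa> W) (at (snd \<kappa> q))"
    if W: "\<And>q. q \<in> carrier A \<Longrightarrow> W' q = W q" and \<kappa>: "\<kappa> \<in> A" "q \<in> fst \<kappa>" for W W'
  proof -
    have transfer: "(K has_derivative f) (at (snd \<kappa> q))"
      if "(H has_derivative f) (at (snd \<kappa> q))" "\<And>y. y \<in> snd \<kappa> ` fst \<kappa> \<Longrightarrow> H y = K y" for H K f
      by (rule has_derivative_transform_within_open[OF that(1) open_chart_image[OF dA \<kappa>(1)] imageI[OF \<kappa>(2)] that(2)])
    have "(local_rep \<kappa> W' has_derivative f) (at (snd \<kappa> q)) \<longleftrightarrow> (local_rep \<kappa> W has_derivative f) (at (snd \<kappa> q))" for f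
      using transfer[of "local_rep \<kappa> W" f "local_rep \<kappa> W'"] transfer[of "local_rep \<kappa> W'" f "local_rep \<kappa> W"]
        local_rep_cong[OF W \<kappa>(1)] by auto
    then show ?thesis by (simp add: frechet_derivative_def)
  qed
  show "lie_bracket A U' V' q \<kappa> = lie_bracket A U V q \<kappa>"
    using assms D[OF assms(1)] D[OF assms(2)] carrierI[of \<kappa> q] by (auto simp: lie_bracket_def)
qed

lemma lie_bracket_zero:
  assumes "vector_field A Y" "q \<in> carrier A"
  shows "lie_bracket A zero_field Y q = (\<lambda>\<kappa>. 0)" "lie_bracket A Y zero_field q = (\<lambda>\<kappa>. 0)"
proof -
  have *: "local_rep \<kappa> zero_field = (\<lambda>x. 0)" for \<kappa> by (auto simp: local_rep_def)
  have "frechet_derivative (local_rep \<kappa> Y) (at (snd \<kappa> q)) 0 = 0" if "\<kappa> \<in> A" "q \<in> fst \<kappa>" for \<kappa>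
    using linear_0[OF has_derivative_linear[OF vector_field_has_derivative[OF assms(1) that]]] .
  then show "lie_bracket A zero_field Y q = (\<lambda>\<kappa>. 0)" "lie_bracket A Y zero_field q = (\<lambda>\<kappa>. 0)"
    by (auto simp: lie_bracket_def *)
qed

lemma lie_bracket_frame_sum:
  assumes "q \<in> carrier A" "\<beta> < DIM('e)"
  shows "lie_bracket A (\<lambda>q. lincomb {..<DIM('e)} c (\<lambda>\<gamma>. X \<gamma> q)) (X \<beta>) q =
     (\<lambda>\<kappa>. \<Sum>\<gamma><DIM('e). c \<gamma> *\<^sub>R lie_bracket A (X \<gamma>) (X \<beta>) q \<kappa>)"
proof
  fix \<kappa>
  show "lie_bracket A (\<lambda>q. lincomb {..<DIM('e)} c (\<lambda>\<gamma>. X \<gamma> q)) (X \<beta>) q \<kappa> =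
     (\<Sum>\<gamma><DIM('e). c \<gamma> *\<^sub>R lie_bracket A (X \<gamma>) (X \<beta>) q \<kappa>)"
  proof (cases "\<kappa> \<in> A \<and> q \<in> fst \<kappa>")
    case True
    then have \<kappa>: "\<kappa> \<in> A" "q \<in> fst \<kappa>" by auto
    have rep: "local_rep \<kappa> (\<lambda>q. lincomb {..<DIM('e)} c (\<lambda>\<gamma>. X \<gamma> q)) = (\<lambda>x. \<Sum>\<gamma><DIM('e). c \<gamma> *\<^sub>R local_rep \<kappa> (X \<gamma>) x)"
      by (auto simp: local_rep_def lincomb_def)
    have der: "((\<lambda>x. \<Sum>\<gamma><DIM('e). c \<gamma> *\<^sub>R local_rep \<kappa> (X \<gamma>) x) has_derivative
        (\<lambda>w. \<Sum>\<gamma><DIM('e). c \<gamma> *\<^sub>R frame_deriv \<kappa> \<gamma> (snd \<kappa> q) w)) (at (snd \<kappa> q))"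
      by (intro has_derivative_sum has_derivative_scaleR_right vector_field_has_derivative vector_field_frame \<kappa>) simp
    have "frechet_derivative (local_rep \<kappa> (\<lambda>q. lincomb {..<DIM('e)} c (\<lambda>\<gamma>. X \<gamma> q))) (at (snd \<kappa> q)) =
        (\<lambda>w. \<Sum>\<gamma><DIM('e). c \<gamma> *\<^sub>R frame_deriv \<kappa> \<gamma> (snd \<kappa> q) w)"
      unfolding rep by (rule frechet_derivative_at[OF der, symmetric])
    then show ?thesis
      using True
      by (simp add: linear_sum[OF linear_frame_deriv[OF assms(2) \<kappa>]] linear_scale[OF linear_frame_deriv[OF assms(2) \<kappa>]]
          lie_bracket_def lincomb_def scaleR_diff_right sum_subtractf)
  qed (auto simp: lie_bracket_def)
qed

lemma
  assumes "vector_field A U" "vector_field A V" "vector_field A W" "q \<in> carrier A"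
  shows nab_add_left: "nab (\<lambda>x \<kappa>. U x \<kappa> + V x \<kappa>) W q = (\<lambda>\<kappa>. nab U W q \<kappa> + nab V W q \<kappa>)"
    and nab_scale_left: "smooth_fun_on A (carrier A) f \<Longrightarrow>
      nab (\<lambda>x \<kappa>. f x *\<^sub>R U x \<kappa>) W q = (\<lambda>\<kappa>. f q *\<^sub>R nab U W q \<kappa>)"
    and nab_scale_right: "smooth_fun_on A (carrier A) f \<Longrightarrow>
      nab U (\<lambda>x \<kappa>. f x *\<^sub>R W x \<kappa>) q = (\<lambda>\<kappa>. dir_deriv A q (U q) f *\<^sub>R W q \<kappa> + f q *\<^sub>R nab U W q \<kappa>)"
proof -
  note * = linear_nab[unfolded linear_connection_def, THEN conjunct2, rule_format]
  have c: "smooth_fun_on A (carrier A) (\<lambda>_. 0)"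
    by (auto simp: smooth_fun_on_def smooth_on_def comp_def Ck_on_const)
  show "nab (\<lambda>x \<kappa>. U x \<kappa> + V x \<kappa>) W q = (\<lambda>\<kappa>. nab U W q \<kappa> + nab V W q \<kappa>)"
    by (rule *[OF assms(1,2,3) c assms(4), THEN conjunct1])
  show "nab (\<lambda>x \<kappa>. f x *\<^sub>R U x \<kappa>) W q = (\<lambda>\<kappa>. f q *\<^sub>R nab U W q \<kappa>)" if f: "smooth_fun_on A (carrier A) f"
    by (rule *[OF assms(1,2,3) f assms(4), THEN conjunct2, THEN conjunct1])
  show "nab U (\<lambda>x \<kappa>. f x *\<^sub>R W x \<kappa>) q = (\<lambda>\<kappa>. dir_deriv A q (U q) f *\<^sub>R W q \<kappa> + f q *\<^sub>R nab U W q \<kappa>)"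
    if f: "smooth_fun_on A (carrier A) f"
    by (rule *[OF assms(1,2,3) f assms(4), THEN conjunct2, THEN conjunct2, THEN conjunct2])
qed

lemma smooth_fun_locally_const:
  assumes "\<And>q. q \<in> carrier A \<Longrightarrow> f q = c"
  shows "smooth_fun_on A (carrier A) f"
    and "q \<in> carrier A \<Longrightarrow> v \<in> tangent_space A q \<Longrightarrow> dir_deriv A q v f = 0"
proof -
  have eq: "c = f (chart_inv \<kappa> x)" if "\<kappa> \<in> A" "x \<in> snd \<kappa> ` fst \<kappa>" for \<kappa> x
    using that assms carrierI[OF that(1)] by (auto simp: chart_inv_chart[OF dA])
  show "smooth_fun_on A (carrier A) f"
    unfolding smooth_fun_on_def smooth_on_def comp_def
  proof (intro ballI allI)
    fix \<kappa> k assume \<kappa>: "\<kappa> \<in> A"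
    show "Ck_on k (snd \<kappa> ` (carrier A \<inter> fst \<kappa>)) (\<lambda>x. f (chart_inv \<kappa> x))"
      unfolding carrier_Int[OF \<kappa>]
      by (rule Ck_on_cong[OF open_chart_image[OF dA \<kappa>] eq[OF \<kappa>] Ck_on_const])
  qed
  show "dir_deriv A q v f = 0" if q: "q \<in> carrier A" "v \<in> tangent_space A q"
  proof -
    note \<kappa> = chart_at_in[OF q(1)]
    have "((\<lambda>x. c) has_derivative (\<lambda>_. 0)) (at (snd (chart_at A q) q))" by simp
    then have "((f \<circ> chart_inv (chart_at A q)) has_derivative (\<lambda>_. 0)) (at (snd (chart_at A q) q))"
      by (rule has_derivative_transform_within_open[OF _ open_chart_image[OF dA \<kappa>(1)]])
        (use \<kappa> eq[OF \<kappa>(1)] in \<open>simp_all add: comp_def\<close>)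
    from dir_deriv_in_chart[OF dA q(2) \<kappa> this] show ?thesis .
  qed
qed

text \<open>
  A connection acts on fields that are also given outside the manifold, where orthogonal projections
  take arbitrary values. Multiplication by the indicator function of the manifold, which is smooth
  there, shows that these values do not influence the result.
\<close>

lemma nab_cong:
  assumes "vector_field A U" "vector_field A W" "q \<in> carrier A"
    and "\<And>q. q \<in> carrier A \<Longrightarrow> U' q = U q" "\<And>q. q \<in> carrier A \<Longrightarrow> W' q = W q"
  shows "nab U' W' q = nab U W q"
proof -
  \<comment> \<open>smooth on the manifold, where it is constant\<close>
  define f where "f q = (if q \<in> carrier A then 1 else 0 :: real)" for q
  have f1: "\<And>q. q \<in> carrier A \<Longrightarrow> f q = 1" by (simp add: f_def)
  note f = smooth_fun_locally_const[of f 1, OF f1]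
  have left: "nab U' V q = nab U V q" if V: "vector_field A V" for V
  proof -
    have "(\<lambda>x \<kappa>. f x *\<^sub>R U' x \<kappa>) = (\<lambda>x \<kappa>. f x *\<^sub>R U x \<kappa>)" using assms(4) by (auto simp: f_def fun_eq_iff)
    then show ?thesis
      using nab_scale_left[OF assms(1,1) V assms(3) f(1)] nab_scale_left[OF _ assms(1) V assms(3) f(1), of U']
        vector_field_cong[OF assms(1,4)] f1 assms(3) by simp
  qed
  have U: "U q \<in> tangent_space A q" using assms(1,3) by (simp add: vector_field_on_def)
  have "(\<lambda>x \<kappa>. f x *\<^sub>R W' x \<kappa>) = (\<lambda>x \<kappa>. f x *\<^sub>R W x \<kappa>)" using assms(5) by (auto simp: f_def fun_eq_iff)
  then have "nab U W' q = nab U W q"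
    using nab_scale_right[OF assms(1,1,2,3) f(1)] nab_scale_right[OF assms(1,1) _ assms(3) f(1), of W']
        vector_field_cong[OF assms(2,5)] f1 f(2)[OF _ assms(3) U] assms(3) by simp
  with left[OF vector_field_cong[OF assms(2,5)]] show ?thesis by simp
qed

lemma nab_zero:
  assumes "vector_field A U" "q \<in> carrier A"
  shows "nab zero_field U q = (\<lambda>\<kappa>. 0)" "nab U zero_field q = (\<lambda>\<kappa>. 0)"
proof -
  have U: "U q \<in> tangent_space A q" using assms by (simp add: vector_field_on_def)
  note f = smooth_fun_locally_const[of "\<lambda>_. 0" 0, OF refl]
  show "nab zero_field U q = (\<lambda>\<kappa>. 0)" "nab U zero_field q = (\<lambda>\<kappa>. 0)"
    using nab_scale_left[OF assms(1,1,1,2) f(1)] nab_scale_right[OF assms(1,1,1,2) f(1)] f(2)[OF assms(2) U] by auto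
qed

lemma nab_frame_sum:
  assumes W: "vector_field A W" and q: "q \<in> carrier A"
  shows "nab (\<lambda>q. lincomb {..<DIM('e)} c (\<lambda>\<beta>. X \<beta> q)) W q = (\<lambda>\<kappa>. \<Sum>\<beta><DIM('e). c \<beta> *\<^sub>R nab (X \<beta>) W q \<kappa>)"
proof -
  have "nab (\<lambda>q. lincomb I c (\<lambda>\<beta>. X \<beta> q)) W q = (\<lambda>\<kappa>. \<Sum>\<beta>\<in>I. c \<beta> *\<^sub>R nab (X \<beta>) W q \<kappa>)"
    if "finite I" "I \<subseteq> {..<DIM('e)}" for I
    using that
  proof (induction I rule: finite_induct)
    case empty
    then show ?case using nab_zero(1)[OF W q] by (simp add: lincomb_def)
  next
    case (insert i I)
    have i: "vector_field A (X i)" using insert vector_field_frame by simp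
    have ci: "vector_field A (\<lambda>x \<kappa>. c i *\<^sub>R X i x \<kappa>)" using vector_field_linear[OF i i, of "c i" 0] by simp
    have I: "vector_field A (\<lambda>q. lincomb I c (\<lambda>\<beta>. X \<beta> q))" using insert vector_field_frame_sum by simp
    have "(\<lambda>q. lincomb (insert i I) c (\<lambda>\<beta>. X \<beta> q)) = (\<lambda>q \<kappa>. c i *\<^sub>R X i q \<kappa> + lincomb I c (\<lambda>\<beta>. X \<beta> q) \<kappa>)"
      using insert by (simp add: lincomb_def)
    then show ?case
      using nab_add_left[OF ci I W q] nab_scale_left[OF i i W q smooth_fun_locally_const(1)[of "\<lambda>_. c i" "c i", OF refl]] insert
      by simp
  qed
  then show ?thesis by simp
qed

section \<open>Orthogonal projections and the connection of the splitting\<close>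

lemma tangent_eq_dualI:
  assumes "q \<in> carrier A" "u \<in> tangent_space A q" "v \<in> tangent_space A q"
    and "\<And>\<alpha>. \<alpha> < DIM('e) \<Longrightarrow> dual_frame X \<alpha> q u = dual_frame X \<alpha> q v"
  shows "u = v"
proof -
  have "frame_coord q u = frame_coord q v" using assms(4) by (simp add: frame_coord_def)
  then show ?thesis using frame_vec_frame_coord[OF assms(1)] assms(2,3) by metis
qed

lemma tangent_diff:
  assumes "q \<in> carrier A" "u \<in> tangent_space A q" "v \<in> tangent_space A q"
  shows "(\<lambda>\<kappa>. u \<kappa> - v \<kappa>) \<in> tangent_space A q"
    and "\<alpha> < DIM('e) \<Longrightarrow> dual_frame X \<alpha> q (\<lambda>\<kappa>. u \<kappa> - v \<kappa>) = dual_frame X \<alpha> q u - dual_frame X \<alpha> q v"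
  using tangent_linear[OF assms, where a = 1 and b = "-1"] by simp_all

text \<open>
  Two candidates for the projection differ by a vector of \<open>E\<close> that is orthogonal to \<open>E\<close>, and the
  metric is definite.
\<close>

lemma orth_proj_eqI:
  assumes q: "q \<in> carrier A" and v: "v \<in> tangent_space A q" and E: "E q \<subseteq> tangent_space A q"
    and diff: "\<And>u w. u \<in> E q \<Longrightarrow> w \<in> E q \<Longrightarrow> (\<lambda>\<kappa>. u \<kappa> - w \<kappa>) \<in> E q"
    and u: "u \<in> E q" "\<And>w. w \<in> E q \<Longrightarrow> g q (\<lambda>\<kappa>. v \<kappa> - u \<kappa>) w = 0"
  shows "orth_proj g E q v = u"
  unfolding orth_proj_def
proof (rule the_equality)
  show "u \<in> E q \<and> (\<forall>w\<in>E q. g q (\<lambda>\<kappa>. v \<kappa> - u \<kappa>) w = 0)" using u by blast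
  fix u' assume u': "u' \<in> E q \<and> (\<forall>w\<in>E q. g q (\<lambda>\<kappa>. v \<kappa> - u' \<kappa>) w = 0)"
  define w where "w = (\<lambda>\<kappa>. u' \<kappa> - u \<kappa>)"
  have w: "w \<in> E q" using diff u u' by (simp add: w_def)
  have t: "(\<lambda>\<kappa>. v \<kappa> - u \<kappa>) \<in> tangent_space A q" "(\<lambda>\<kappa>. v \<kappa> - u' \<kappa>) \<in> tangent_space A q"
    using tangent_diff(1)[OF q v, of u] tangent_diff(1)[OF q v, of u'] u u' E by auto
  have "g q (\<lambda>\<kappa>. 1 *\<^sub>R (v \<kappa> - u \<kappa>) + (-1) *\<^sub>R (v \<kappa> - u' \<kappa>)) w = 1 * g q (\<lambda>\<kappa>. v \<kappa> - u \<kappa>) w + (-1) * g q (\<lambda>\<kappa>. v \<kappa> - u' \<kappa>) w"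
    by (rule tensor_linear_left[OF metric_tensor q t]) (use w E in auto)
  then have "g q w w = 0" using u(2)[OF w] u' w by (simp add: w_def)
  then have "w = (\<lambda>\<kappa>. 0)"
    using metric q w E unfolding riemannian_metric_def by force
  then show "u' = u" by (auto simp: w_def fun_eq_iff)
qed

lemma orth_proj_distribution:
  assumes q: "q \<in> carrier A" and v: "v \<in> tangent_space A q"
  shows "orth_proj g D q v = (\<lambda>\<kappa>. \<Sum>\<alpha><DIM('e). (if \<alpha> < m then dual_frame X \<alpha> q v else 0) *\<^sub>R X \<alpha> q \<kappa>)" (is "_ = ?u")
proof (rule orth_proj_eqI[OF q v])
  have u: "?u \<in> tangent_space A q" by (rule tangent_frame_sum[OF q])
  have du: "dual_frame X \<alpha> q ?u = (if \<alpha> < m then dual_frame X \<alpha> q v else 0)" if "\<alpha> < DIM('e)" for \<alpha>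
    by (rule dual_frame_eqI[OF q that]) simp
  show "D q \<subseteq> tangent_space A q" using distribution_iff[OF q] by blast
  show "(\<lambda>\<kappa>. u \<kappa> - w \<kappa>) \<in> D q" if "u \<in> D q" "w \<in> D q" for u w
    using tangent_diff[OF q, of u w] that by (simp add: distribution_iff[OF q])
  show "?u \<in> D q" using u du by (simp add: distribution_iff[OF q])
  have "(\<lambda>\<kappa>. v \<kappa> - ?u \<kappa>) \<in> orth_compl A g D q"
    using tangent_diff[OF q v u] du m_le by (simp add: orth_compl_iff[OF q])
  then show "g q (\<lambda>\<kappa>. v \<kappa> - ?u \<kappa>) w = 0" if "w \<in> D q" for w using that by (simp add: orth_compl_def)
qed

lemma orth_proj_orth_compl:
  assumes q: "q \<in> carrier A" and v: "v \<in> tangent_space A q"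
  shows "orth_proj g (orth_compl A g D) q v =
    (\<lambda>\<kappa>. \<Sum>\<alpha><DIM('e). (if \<alpha> < m then 0 else dual_frame X \<alpha> q v) *\<^sub>R X \<alpha> q \<kappa>)" (is "_ = ?u")
proof (rule orth_proj_eqI[OF q v])
  have u: "?u \<in> tangent_space A q" by (rule tangent_frame_sum[OF q])
  have du: "dual_frame X \<alpha> q ?u = (if \<alpha> < m then 0 else dual_frame X \<alpha> q v)" if "\<alpha> < DIM('e)" for \<alpha>
    by (rule dual_frame_eqI[OF q that]) simp
  show E: "orth_compl A g D q \<subseteq> tangent_space A q" using orth_compl_iff[OF q] by blast
  show "(\<lambda>\<kappa>. u \<kappa> - w \<kappa>) \<in> orth_compl A g D q" if "u \<in> orth_compl A g D q" "w \<in> orth_compl A g D q" for u w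
    using tangent_diff[OF q, of u w] that m_le by (simp add: orth_compl_iff[OF q])
  show "?u \<in> orth_compl A g D q" using u du m_le by (simp add: orth_compl_iff[OF q])
  have t: "(\<lambda>\<kappa>. v \<kappa> - ?u \<kappa>) \<in> tangent_space A q"
    using tangent_diff(1)[OF q v u] by simp
  have d: "(\<lambda>\<kappa>. v \<kappa> - ?u \<kappa>) \<in> D q"
    using tangent_diff[OF q v u] du by (simp add: distribution_iff[OF q])
  show "g q (\<lambda>\<kappa>. v \<kappa> - ?u \<kappa>) w = 0" if w: "w \<in> orth_compl A g D q" for w
    using w d tensor_sym[OF metric_tensor q t, of w] E by (auto simp: orth_compl_def)
qed

lemma lincomb_frame_tangent: "q \<in> carrier A \<Longrightarrow> lincomb {..<DIM('e)} c (\<lambda>\<beta>. X \<beta> q) \<in> tangent_space A q"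
  by (simp add: lincomb_def tangent_frame_sum)

text \<open>
  The component along \<open>X\<^sub>\<gamma>\<close> of the covariant derivative of \<open>X\<^sub>\<beta>\<close> along \<open>X\<^sub>a\<close>, for \<open>a < m\<close>, with respect
  to the connection \<open>\<nabla>\<close>-bar.
\<close>

definition bar_coeff :: "nat \<Rightarrow> nat \<Rightarrow> nat \<Rightarrow> 'q \<Rightarrow> real" where
  "bar_coeff \<gamma> a \<beta> q =
     (if \<beta> < m \<and> \<gamma> < m then dual_frame X \<gamma> q (nab (X a) (X \<beta>) q)
      else if m \<le> \<beta> \<and> m \<le> \<gamma> then structure_fun A X \<gamma> a \<beta> q else 0)"

text \<open>
  For a field \<open>V\<close> in \<open>D\<close> the summands of the definition that contain \<open>Q(V) = 0\<close> disappear. Of the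
  other two, \<open>P(\<nabla>\<^bsub>V\<^esub> P(X\<^sub>\<beta>))\<close> is present only if \<open>X\<^sub>\<beta>\<close> lies in \<open>D\<close> and \<open>Q([V, Q(X\<^sub>\<beta>)])\<close> only if it lies
  in \<open>D\<^sup>g\<close>. So \<open>\<nabla>\<close>-bar preserves both subbundles along \<open>D\<close>.
\<close>

lemma nabla_bar_frame:
  assumes q: "q \<in> carrier A" and \<beta>: "\<beta> < DIM('e)" and c: "\<And>i. i \<in> {m..<DIM('e)} \<Longrightarrow> c i = 0"
  defines "V \<equiv> \<lambda>q. lincomb {..<DIM('e)} c (\<lambda>\<gamma>. X \<gamma> q)"
  shows "nabla_bar A g D nab V (X \<beta>) q = (\<lambda>\<kappa>. \<Sum>\<gamma><DIM('e). (\<Sum>a<m. c a * bar_coeff \<gamma> a \<beta> q) *\<^sub>R X \<gamma> q \<kappa>)"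
proof -
  define P where "P Z = (\<lambda>q. orth_proj g D q (Z q))" for Z :: "('q, 'e) vfield"
  define Q where "Q Z = (\<lambda>q. orth_proj g (orth_compl A g D) q (Z q))" for Z :: "('q, 'e) vfield"
  have bar: "nabla_bar A g D nab V (X \<beta>) q = (\<lambda>\<kappa>. P (nab (P V) (P (X \<beta>))) q \<kappa> + P (lie_bracket A (Q V) (P (X \<beta>))) q \<kappa>
        + Q (nab (Q V) (Q (X \<beta>))) q \<kappa> + Q (lie_bracket A (P V) (Q (X \<beta>))) q \<kappa>)"
    by (simp add: nabla_bar_def P_def Q_def Let_def)
  have V: "vector_field A V" unfolding V_def by (rule vector_field_frame_sum) auto
  note \<beta>X = vector_field_frame[OF \<beta>]
  have PV: "P V q = V q" and QV: "Q V q = zero_field q" if q: "q \<in> carrier A" for q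
    unfolding P_def Q_def V_def orth_proj_distribution[OF q lincomb_frame_tangent[OF q]]
      orth_proj_orth_compl[OF q lincomb_frame_tangent[OF q]]
    using c by (auto simp: fun_eq_iff dual_frame_lincomb[OF q, unfolded lincomb_def] lincomb_def not_less intro!: sum.cong sum.neutral)
  have PX: "P (X \<beta>) q = (if \<beta> < m then X \<beta> q else zero_field q)"
    and QX: "Q (X \<beta>) q = (if \<beta> < m then zero_field q else X \<beta> q)" if q: "q \<in> carrier A" for q
  proof -
    have sum_\<beta>: "(\<Sum>\<alpha><DIM('e). f \<alpha> *\<^sub>R X \<alpha> q \<kappa>) = f \<beta> *\<^sub>R X \<beta> q \<kappa>" if "\<And>\<alpha>. \<alpha> < DIM('e) \<Longrightarrow> \<alpha> \<noteq> \<beta> \<Longrightarrow> f \<alpha> = 0" for f \<kappa>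
      using sum.remove[of "{..<DIM('e)}" \<beta> "\<lambda>\<alpha>. f \<alpha> *\<^sub>R X \<alpha> q \<kappa>"] \<beta> that by (simp add: sum.neutral)
    show "P (X \<beta>) q = (if \<beta> < m then X \<beta> q else zero_field q)" "Q (X \<beta>) q = (if \<beta> < m then zero_field q else X \<beta> q)"
      unfolding P_def Q_def orth_proj_distribution[OF q frame_in_tangent[OF \<beta> q]]
        orth_proj_orth_compl[OF q frame_in_tangent[OF \<beta> q]]
      using \<beta> by (simp_all add: fun_eq_iff sum_\<beta> dual_frame_frame[OF q])
  qed
  have zero: "P Z q = (\<lambda>\<kappa>. 0)" "Q Z q = (\<lambda>\<kappa>. 0)" if Z: "Z q = (\<lambda>\<kappa>. 0)" for Z
  proof -
    have d0: "dual_frame X \<alpha> q (\<lambda>\<kappa>. 0) = 0" if "\<alpha> < DIM('e)" for \<alpha>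
      by (rule dual_frame_eqI[OF q that]) simp
    show "P Z q = (\<lambda>\<kappa>. 0)" "Q Z q = (\<lambda>\<kappa>. 0)"
      unfolding P_def Q_def Z orth_proj_distribution[OF q zero_tangent[OF q]] orth_proj_orth_compl[OF q zero_tangent[OF q]]
      using d0 by (auto intro!: sum.neutral)
  qed
  have sum_c: "(\<Sum>\<alpha><DIM('e). c \<alpha> * f \<alpha>) = (\<Sum>a<m. c a * f a)" for f
    by (rule sum.mono_neutral_right) (use m_le c in auto)
  show ?thesis
  proof (cases "\<beta> < m")
    case True
    have X\<beta>: "\<And>q. q \<in> carrier A \<Longrightarrow> P (X \<beta>) q = X \<beta> q" "\<And>q. q \<in> carrier A \<Longrightarrow> Q (X \<beta>) q = zero_field q"
      using PX QX True by auto
    have t: "nab V (X \<beta>) q \<in> tangent_space A q"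
      using connection_vector_field[OF V \<beta>X] q by (simp add: vector_field_on_def)
    have "nab (P V) (P (X \<beta>)) q = nab V (X \<beta>) q" by (rule nab_cong[OF V \<beta>X q PV X\<beta>(1)])
    moreover have "lie_bracket A (Q V) (P (X \<beta>)) q = (\<lambda>\<kappa>. 0)"
      using lie_bracket_cong[OF QV X\<beta>(1)] lie_bracket_zero[OF \<beta>X q] by simp
    moreover have "nab (Q V) (Q (X \<beta>)) q = (\<lambda>\<kappa>. 0)"
      using nab_cong[OF zero_vector_field zero_vector_field q QV X\<beta>(2)] nab_zero[OF zero_vector_field q] by simp
    moreover have "lie_bracket A (P V) (Q (X \<beta>)) q = (\<lambda>\<kappa>. 0)"
      using lie_bracket_cong[OF PV X\<beta>(2)] lie_bracket_zero[OF V q] by simp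
    ultimately have "nabla_bar A g D nab V (X \<beta>) q = orth_proj g D q (nab V (X \<beta>) q)"
      unfolding bar using zero by (simp add: P_def)
    moreover have "dual_frame X \<gamma> q (nab V (X \<beta>) q) = (\<Sum>a<m. c a * dual_frame X \<gamma> q (nab (X a) (X \<beta>) q))"
      if "\<gamma> < DIM('e)" for \<gamma>
      unfolding V_def nab_frame_sum[OF \<beta>X q] sum_c[symmetric]
      using that \<beta> by (intro tangent_sum(2)[OF q]) (auto simp: connection_in_tangent q)
    ultimately show ?thesis
      using True m_le by (auto simp: orth_proj_distribution[OF q t] bar_coeff_def fun_eq_iff intro!: sum.cong)
  next
    case False
    have X\<beta>: "\<And>q. q \<in> carrier A \<Longrightarrow> Q (X \<beta>) q = X \<beta> q" "\<And>q. q \<in> carrier A \<Longrightarrow> P (X \<beta>) q = zero_field q"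
      using PX QX False by auto
    have t: "lie_bracket A V (X \<beta>) q \<in> tangent_space A q"
      unfolding V_def lie_bracket_frame_sum[OF q \<beta>]
      using \<beta> by (intro tangent_sum(1)[OF q]) (auto simp: lie_bracket_tangent q)
    have "nab (P V) (P (X \<beta>)) q = (\<lambda>\<kappa>. 0)"
      using nab_cong[OF V zero_vector_field q PV X\<beta>(2)] nab_zero[OF V q] by simp
    moreover have "lie_bracket A (Q V) (P (X \<beta>)) q = (\<lambda>\<kappa>. 0)"
      using lie_bracket_cong[OF QV X\<beta>(2)] lie_bracket_zero[OF zero_vector_field q] by simp
    moreover have "nab (Q V) (Q (X \<beta>)) q = (\<lambda>\<kappa>. 0)"
      using nab_cong[OF zero_vector_field \<beta>X q QV X\<beta>(1)] nab_zero[OF \<beta>X q] by simp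
    moreover have "lie_bracket A (P V) (Q (X \<beta>)) q = lie_bracket A V (X \<beta>) q"
      by (rule lie_bracket_cong[OF PV X\<beta>(1)])
    ultimately have "nabla_bar A g D nab V (X \<beta>) q = orth_proj g (orth_compl A g D) q (lie_bracket A V (X \<beta>) q)"
      unfolding bar using zero by (simp add: Q_def)
    moreover have "dual_frame X \<gamma> q (lie_bracket A V (X \<beta>) q) = (\<Sum>a<m. c a * structure_fun A X \<gamma> a \<beta> q)"
      if "\<gamma> < DIM('e)" for \<gamma>
      unfolding V_def lie_bracket_frame_sum[OF q \<beta>] sum_c[symmetric] structure_fun_def
      using that \<beta> by (intro tangent_sum(2)[OF q]) (auto simp: lie_bracket_tangent q)
    ultimately show ?thesis
      using False by (auto simp: orth_proj_orth_compl[OF q t] bar_coeff_def fun_eq_iff intro!: sum.cong)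
  qed
qed

lemma bar_coeff_continuous:
  assumes "a < DIM('e)" "\<beta> < DIM('e)" "\<gamma> < DIM('e)"
  shows "chart_continuous (bar_coeff \<gamma> a \<beta>)"
proof -
  have "chart_continuous (\<lambda>q. 0)" by (simp add: chart_continuous_def)
  then show ?thesis
    using dual_frame_continuous[OF connection_tangent[OF assms(1,2)] assms(3)] structure_fun_continuous[OF assms]
    unfolding bar_coeff_def[abs_def]
    by (cases "\<beta> < m"; cases "\<gamma> < m") simp_all
qed

end

section \<open>Uniqueness for linear systems\<close>

text \<open>
  Gronwall's argument on both sides of \<open>0\<close>: the exponential factor makes \<open>u\<close> monotone.
\<close>

lemma gronwall_zero:
  fixes u :: "real \<Rightarrow> real"
  assumes der: "\<And>s. s \<in> closed_segment 0 t \<Longrightarrow> (u has_real_derivative u' s) (at s)"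
    and bound: "\<And>s. s \<in> closed_segment 0 t \<Longrightarrow> \<bar>u' s\<bar> \<le> L * u s"
    and "u 0 = 0" "0 \<le> u t"
  shows "u t = 0"
proof (cases "0 \<le> t")
  case True
  have "u t * exp (- L * t) \<le> u 0 * exp (- L * 0)"
  proof (rule DERIV_nonpos_imp_nonincreasing[OF True])
    fix s assume s: "0 \<le> s" "s \<le> t"
    then have s': "s \<in> closed_segment 0 t" by (simp add: closed_segment_eq_real_ivl)
    have "((\<lambda>s. u s * exp (- L * s)) has_real_derivative (u' s - L * u s) * exp (- L * s)) (at s)"
      by (auto intro!: derivative_eq_intros der[OF s'] simp: algebra_simps)
    moreover have "(u' s - L * u s) * exp (- L * s) \<le> 0"
      using bound[OF s'] by (intro mult_nonpos_nonneg) auto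
    ultimately show "\<exists>y. ((\<lambda>s. u s * exp (- L * s)) has_real_derivative y) (at s) \<and> y \<le> 0" by blast
  qed
  then show ?thesis using assms(3,4) by (simp add: mult_le_0_iff)
next
  case False
  then have False': "t \<le> 0" by simp
  have "u t * exp (L * t) \<le> u 0 * exp (L * 0)"
  proof (rule DERIV_nonneg_imp_nondecreasing[OF False'])
    fix s assume s: "t \<le> s" "s \<le> 0"
    then have s': "s \<in> closed_segment 0 t" by (simp add: closed_segment_eq_real_ivl)
    have "((\<lambda>s. u s * exp (L * s)) has_real_derivative (u' s + L * u s) * exp (L * s)) (at s)"
      by (auto intro!: derivative_eq_intros der[OF s'] simp: algebra_simps)
    moreover have "0 \<le> (u' s + L * u s) * exp (L * s)"
      using bound[OF s'] by (intro mult_nonneg_nonneg) auto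
    ultimately show "\<exists>y. ((\<lambda>s. u s * exp (L * s)) has_real_derivative y) (at s) \<and> 0 \<le> y" by blast
  qed
  then show ?thesis using assms(3,4) by (simp add: mult_le_0_iff)
qed

text \<open>
  On the segment from \<open>0\<close> to \<open>t\<close> the coefficients are bounded, so that Gronwall's argument applies to
  the sum of the squares of the unknowns.
\<close>

lemma linear_system_zero:
  fixes y :: "nat \<Rightarrow> real \<Rightarrow> real"
  assumes J: "is_interval J" "0 \<in> J" "t \<in> J"
    and der: "\<And>s a. s \<in> J \<Longrightarrow> a < m \<Longrightarrow> (y a has_real_derivative (\<Sum>b<m. y b s * B a b s)) (at s)"
    and B: "\<And>a b. a < m \<Longrightarrow> b < m \<Longrightarrow> continuous_on J (B a b)"
    and zero: "\<And>a. a < m \<Longrightarrow> y a 0 = 0"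
    and "a < m"
  shows "y a t = 0"
proof -
  let ?K = "closed_segment 0 t"
  have K: "?K \<subseteq> J" using J is_interval_convex closed_segment_subset by blast
  have "\<exists>C. \<forall>a<m. \<forall>b<m. \<forall>s\<in>?K. \<bar>B a b s\<bar> \<le> C"
  proof -
    have "\<exists>C. \<forall>s\<in>?K. \<bar>B a b s\<bar> \<le> C" if "a < m" "b < m" for a b
    proof -
      have "bounded (B a b ` ?K)"
        by (intro compact_imp_bounded compact_continuous_image continuous_on_subset[OF B[OF that] K] compact_segment)
      then show ?thesis by (auto simp: bounded_iff)
    qed
    then obtain C where C: "\<And>a b s. a < m \<Longrightarrow> b < m \<Longrightarrow> s \<in> ?K \<Longrightarrow> \<bar>B a b s\<bar> \<le> C a b" by metis
    have "\<bar>B a b s\<bar> \<le> (\<Sum>a<m. \<Sum>b<m. \<bar>C a b\<bar>)" if "a < m" "b < m" "s \<in> ?K" for a b s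
    proof -
      have "\<bar>B a b s\<bar> \<le> \<bar>C a b\<bar>" using C[OF that] by simp
      also have "\<dots> \<le> (\<Sum>b<m. \<bar>C a b\<bar>)" using that by (intro member_le_sum) auto
      also have "\<dots> \<le> (\<Sum>a<m. \<Sum>b<m. \<bar>C a b\<bar>)"
        using that by (intro member_le_sum[of _ _ "\<lambda>a. \<Sum>b<m. \<bar>C a b\<bar>"]) (auto intro: sum_nonneg)
      finally show ?thesis .
    qed
    then show ?thesis by blast
  qed
  then obtain C where C: "\<And>a b s. a < m \<Longrightarrow> b < m \<Longrightarrow> s \<in> ?K \<Longrightarrow> \<bar>B a b s\<bar> \<le> C" by blast
  have C0: "0 \<le> C" using C[OF \<open>a < m\<close> \<open>a < m\<close>, of 0] by force
  define u where "u s = (\<Sum>a<m. (y a s)\<^sup>2)" for s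
  define u' where "u' s = (\<Sum>a<m. 2 * y a s * (\<Sum>b<m. y b s * B a b s))" for s
  have "u t = 0"
  proof (rule gronwall_zero[where u = u and u' = u' and L = "2 * C * real m"])
    show "(u has_real_derivative u' s) (at s)" if "s \<in> ?K" for s
      unfolding u_def u'_def using that K der
      by (auto intro!: derivative_eq_intros sum.cong)
    show "\<bar>u' s\<bar> \<le> 2 * C * real m * u s" if s: "s \<in> ?K" for s
    proof -
      have "\<bar>u' s\<bar> \<le> (\<Sum>a<m. \<Sum>b<m. \<bar>2 * y a s * (y b s * B a b s)\<bar>)"
        unfolding u'_def sum_distrib_left by (intro order_trans[OF sum_abs] sum_mono sum_abs)
      also have "\<dots> \<le> (\<Sum>a<m. \<Sum>b<m. C * ((y a s)\<^sup>2 + (y b s)\<^sup>2))"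
      proof (intro sum_mono)
        fix a b assume "a \<in> {..<m}" "b \<in> {..<m}"
        then have "\<bar>2 * y a s * (y b s * B a b s)\<bar> \<le> (2 * \<bar>y a s\<bar> * \<bar>y b s\<bar>) * C"
          using C[OF _ _ s, of a b] by (simp add: abs_mult mult.assoc mult_left_mono)
        also have "\<dots> \<le> ((y a s)\<^sup>2 + (y b s)\<^sup>2) * C"
          using sum_squares_bound[of "\<bar>y a s\<bar>" "\<bar>y b s\<bar>"] C0 by (intro mult_right_mono) auto
        finally show "\<bar>2 * y a s * (y b s * B a b s)\<bar> \<le> C * ((y a s)\<^sup>2 + (y b s)\<^sup>2)" by (simp add: mult.commute)
      qed
      also have "\<dots> = 2 * C * real m * u s"
        by (simp add: u_def sum.distrib sum_distrib_left[symmetric] distrib_left)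
      finally show ?thesis .
    qed
    show "u 0 = 0" using zero by (simp add: u_def)
    show "0 \<le> u t" by (auto simp: u_def intro: sum_nonneg)
  qed
  then show ?thesis using \<open>a < m\<close> by (auto simp: u_def sum_nonneg_eq_0_iff)
qed

section \<open>The nonholonomic vector field\<close>

locale nonholonomic_system = adapted_frame_manifold A g D m X nab
  for A :: "('q, 'e::euclidean_space) atlas" and g D m X nab +
  fixes gh :: "('q, 'e) tensor2"
    and G :: "('q \<times> ('q, 'e) tvec, 'e \<times> 'e) vfield"
  assumes dynamics: "nonholonomic_field A (kinetic_lagrangian g) m D X G"
    and modification: "preserving_modification A D g gh"
begin

abbreviation "C \<equiv> constraint_set A D"
abbreviation "nbar \<equiv> nabla_bar A g D nab"
abbreviation "lambda \<equiv> multiplier A (kinetic_lagrangian g) X G"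

lemma modified_tensor: "symmetric_tensor A gh"
  using modification by (simp add: preserving_modification_def)

lemma constraint_iff:
  "(q, v) \<in> C \<longleftrightarrow> q \<in> carrier A \<and> v \<in> tangent_space A q \<and> (\<forall>i\<in>{m..<DIM('e)}. dual_frame X i q v = 0)"
  using distribution_iff by (auto simp: constraint_set_def)

lemma frame_expansion_constraint:
  assumes "(q, v) \<in> C"
  shows "v \<kappa> = (\<Sum>a<m. dual_frame X a q v *\<^sub>R X a q \<kappa>)"
proof -
  have q: "q \<in> carrier A" "v \<in> tangent_space A q" using assms by (auto simp: constraint_iff)
  have "v \<kappa> = (\<Sum>\<alpha><DIM('e). dual_frame X \<alpha> q v *\<^sub>R X \<alpha> q \<kappa>)"
    using fun_cong[OF frame_expansion[OF q], of \<kappa>] .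
  also have "\<dots> = (\<Sum>a<m. dual_frame X a q v *\<^sub>R X a q \<kappa>)"
    by (rule sum.mono_neutral_right) (use assms m_le in \<open>auto simp: constraint_iff\<close>)
  finally show ?thesis .
qed

lemma dynamics_tangent: "p \<in> C \<Longrightarrow> i \<in> {m..<DIM('e)} \<Longrightarrow> dir_deriv TA p (G p) (quasi_velocity X i) = 0"
  using dynamics unfolding nonholonomic_field_def by blast

lemma dynamics_obtain:
  obtains f where "\<And>a. a < m \<Longrightarrow> smooth_fun_on_subset TA C (f a)"
    "\<And>p. p \<in> C \<Longrightarrow> G p = (\<lambda>K. \<Sum>a<m. quasi_velocity X a p *\<^sub>R complete_lift A (X a) p K + f a p *\<^sub>R vertical_lift A (X a) p K)"
  using dynamics unfolding nonholonomic_field_def by blast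

lemma lift_chart_in:
  assumes "q \<in> carrier A" "v \<in> tangent_space A q"
  shows "lift_chart A (chart_at A q) \<in> TA" "(q, v) \<in> fst (lift_chart A (chart_at A q))"
  using chart_at_in[OF assms(1)] assms by (auto simp: tangent_atlas_def lift_chart_def)

text \<open>
  Both kinds of lifts at \<open>(q, v)\<close> are given by components in the chart selected at \<open>q\<close>; so is \<open>G\<close>,
  and its base component is \<open>v\<close> itself.
\<close>

lemma dynamics_chart:
  assumes p: "(q, v) \<in> C" and G: "G (q, v) = (\<lambda>K. \<Sum>a<m. quasi_velocity X a (q, v) *\<^sub>R complete_lift A (X a) (q, v) K
      + f a *\<^sub>R vertical_lift A (X a) (q, v) K)"
  shows "G (q, v) = tvec_of TA (q, v) (lift_chart A (chart_at A q)) (v (chart_at A q),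
     \<Sum>a<m. dual_frame X a q v *\<^sub>R frame_deriv (chart_at A q) a (snd (chart_at A q) q) (v (chart_at A q))
        + f a *\<^sub>R X a q (chart_at A q))"
proof
  fix K
  let ?\<kappa> = "chart_at A q"
  have q: "q \<in> carrier A" "v \<in> tangent_space A q" using p by (auto simp: constraint_iff)
  let ?T = "\<lambda>z. tvec_of TA (q, v) (lift_chart A ?\<kappa>) z K"
  have L: "linear ?T" by (rule linear_tvec_of[OF dTA lift_chart_in[OF q]])
  have "G (q, v) K = (\<Sum>a<m. dual_frame X a q v *\<^sub>R ?T (X a q ?\<kappa>, frame_deriv ?\<kappa> a (snd ?\<kappa> q) (v ?\<kappa>))
      + f a *\<^sub>R ?T (0, X a q ?\<kappa>))"
    by (simp add: G complete_lift_def vertical_lift_def quasi_velocity_def Let_def)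
  also have "\<dots> = ?T (\<Sum>a<m. dual_frame X a q v *\<^sub>R (X a q ?\<kappa>, frame_deriv ?\<kappa> a (snd ?\<kappa> q) (v ?\<kappa>))
      + f a *\<^sub>R (0, X a q ?\<kappa>))"
    by (simp only: linear_sum[OF L] linear_add[OF L] linear_scale[OF L])
  also have "(\<Sum>a<m. dual_frame X a q v *\<^sub>R (X a q ?\<kappa>, frame_deriv ?\<kappa> a (snd ?\<kappa> q) (v ?\<kappa>)) + f a *\<^sub>R (0, X a q ?\<kappa>)) =
     (v ?\<kappa>, \<Sum>a<m. dual_frame X a q v *\<^sub>R frame_deriv ?\<kappa> a (snd ?\<kappa> q) (v ?\<kappa>) + f a *\<^sub>R X a q ?\<kappa>)"
    by (simp add: prod_eq_iff fst_sum snd_sum frame_expansion_constraint[OF p, of ?\<kappa>])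
  finally show "G (q, v) K = ?T (v ?\<kappa>, \<Sum>a<m. dual_frame X a q v *\<^sub>R frame_deriv ?\<kappa> a (snd ?\<kappa> q) (v ?\<kappa>) + f a *\<^sub>R X a q ?\<kappa>)" .
qed

section \<open>Nonholonomic trajectories\<close>

text \<open>
  Since the base component of \<open>G(v)\<close> is \<open>v\<close>, an integral curve of \<open>G\<close> consists of the velocities
  of its projection to the manifold.
\<close>

lemma trajectory:
  assumes "nonholonomic_trajectory A D G J c" "t \<in> J"
  shows "(c t, velocity A c t) \<in> C"
    and "has_velocity A c t (velocity A c t)"
    and "has_velocity TA (\<lambda>s. (c s, velocity A c s)) t (G (c t, velocity A c t))"
proof -
  obtain \<gamma> where J: "open J" and \<gamma>: "\<And>s. s \<in> J \<Longrightarrow> \<gamma> s \<in> C" "\<And>s. s \<in> J \<Longrightarrow> has_velocity TA \<gamma> s (G (\<gamma> s))"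
    "\<And>s. s \<in> J \<Longrightarrow> c s = fst (\<gamma> s)"
    using assms(1) unfolding nonholonomic_trajectory_def by blast
  have vel: "has_velocity A c s (snd (\<gamma> s)) \<and> velocity A c s = snd (\<gamma> s)" if s: "s \<in> J" for s
  proof -
    obtain q v where p: "\<gamma> s = (q, v)" by fastforce
    let ?\<kappa> = "chart_at A q"
    let ?K = "lift_chart A ?\<kappa>"
    have pC: "(q, v) \<in> C" using \<gamma>(1)[OF s] p by simp
    then have q: "q \<in> carrier A" "v \<in> tangent_space A q" by (auto simp: constraint_iff)
    note \<kappa> = chart_at_in[OF q(1)]
    obtain f where f: "\<And>p. p \<in> C \<Longrightarrow> G p = (\<lambda>K. \<Sum>a<m. quasi_velocity X a p *\<^sub>R complete_lift A (X a) p K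
        + f a p *\<^sub>R vertical_lift A (X a) p K)"
      using dynamics_obtain by blast
    have "fst (G (q, v) ?K) = v ?\<kappa>"
      by (simp add: dynamics_chart[OF pC f[OF pC]] tvec_of_same[OF dTA lift_chart_in[OF q]])
    moreover have ev: "\<forall>\<^sub>F r in nhds s. \<gamma> r \<in> fst ?K" and d: "((snd ?K \<circ> \<gamma>) has_vector_derivative G (q, v) ?K) (at s)"
      using \<gamma>(2)[OF s] lift_chart_in[OF q] unfolding has_velocity_def p by blast+
    ultimately have d1: "((\<lambda>r. fst ((snd ?K \<circ> \<gamma>) r)) has_vector_derivative v ?\<kappa>) (at s)"
      using bounded_linear.has_vector_derivative[OF bounded_linear_fst d] by simp
    have evJ: "\<forall>\<^sub>F r in nhds s. r \<in> J" by (rule eventually_nhds_in_open[OF J s])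
    have evc: "\<forall>\<^sub>F r in nhds s. c r \<in> fst ?\<kappa>"
      using ev evJ by eventually_elim (auto simp: \<gamma>(3) lift_chart_def)
    have "\<forall>\<^sub>F r in nhds s. (snd ?\<kappa> \<circ> c) r = fst ((snd ?K \<circ> \<gamma>) r)"
      using evJ by eventually_elim (auto simp: \<gamma>(3) lift_chart_def)
    then have "((snd ?\<kappa> \<circ> c) has_vector_derivative v ?\<kappa>) (at s)"
      using d1 by (subst has_vector_derivative_cong_ev[where g = "\<lambda>r. fst ((snd ?K \<circ> \<gamma>) r)"])
        (auto dest: eventually_nhds_x_imp_x elim: eventually_mono)
    then have "has_velocity A c s (tvec_of A (c s) ?\<kappa> (v ?\<kappa>))"
      by (rule has_velocity_from_chart[OF dA \<kappa>(1) evc])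
    moreover have "c s = q" using \<gamma>(3)[OF s] p by simp
    ultimately have "has_velocity A c s v" using tangent_eq_tvec_of[OF dA q(2) \<kappa>] by simp
    then show ?thesis using velocity_eq[OF dA, of c s v] q \<open>c s = q\<close> p by simp
  qed
  have eq: "\<gamma> s = (c s, velocity A c s)" if "s \<in> J" for s
    using vel[OF that] \<gamma>(3)[OF that] by (simp add: prod_eq_iff)
  show "(c t, velocity A c t) \<in> C" using \<gamma>(1)[OF assms(2)] eq[OF assms(2)] by simp
  show "has_velocity A c t (velocity A c t)" using vel[OF assms(2)] by simp
  have ev: "\<forall>\<^sub>F s in nhds t. \<gamma> s = (c s, velocity A c s)"
    using eventually_nhds_in_open[OF J assms(2)] by eventually_elim (rule eq)
  have t: "has_velocity TA \<gamma> t (G (\<gamma> t))" by (rule \<gamma>(2)[OF assms(2)])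
  show "has_velocity TA (\<lambda>s. (c s, velocity A c s)) t (G (c t, velocity A c t))"
    unfolding has_velocity_def
  proof (intro ballI impI conjI)
    fix K assume K: "K \<in> TA" "(c t, velocity A c t) \<in> fst K"
    then have *: "\<forall>\<^sub>F s in nhds t. \<gamma> s \<in> fst K" "((snd K \<circ> \<gamma>) has_vector_derivative G (\<gamma> t) K) (at t)"
      using t eq[OF assms(2)] unfolding has_velocity_def by auto
    show "\<forall>\<^sub>F s in nhds t. (c s, velocity A c s) \<in> fst K"
      using *(1) ev by eventually_elim simp
    have "\<forall>\<^sub>F s in nhds t. (snd K \<circ> (\<lambda>s. (c s, velocity A c s))) s = (snd K \<circ> \<gamma>) s"
      using ev by eventually_elim simp
    then show "((snd K \<circ> (\<lambda>s. (c s, velocity A c s))) has_vector_derivative G (c t, velocity A c t) K) (at t)"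
      using *(2) eq[OF assms(2)]
      by (subst has_vector_derivative_cong_ev[where g = "snd K \<circ> \<gamma>"])
        (auto dest: eventually_nhds_x_imp_x elim: eventually_mono)
  qed
qed

lemma has_derivative_along_trajectory:
  assumes c: "nonholonomic_trajectory A D G J c" "t \<in> J"
    and F: "\<And>\<kappa> q' \<zeta>. \<kappa> \<in> A \<Longrightarrow> q' \<in> fst \<kappa> \<Longrightarrow> F (q', frame_vec q' \<zeta>) = \<Phi> \<kappa> (snd \<kappa> q', \<zeta>)"
    and \<Phi>: "\<And>\<kappa> q \<eta>. \<kappa> \<in> A \<Longrightarrow> q \<in> fst \<kappa> \<Longrightarrow> \<Phi> \<kappa> differentiable (at (snd \<kappa> q, \<eta>))"
  shows "((\<lambda>s. F (c s, velocity A c s)) has_real_derivative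
      dir_deriv TA (c t, velocity A c t) (G (c t, velocity A c t)) F) (at t)"
proof -
  let ?q = "c t" and ?v = "velocity A c t"
  have q: "?q \<in> carrier A" "?v \<in> tangent_space A ?q" using trajectory(1)[OF c] by (auto simp: constraint_iff)
  note \<kappa> = chart_at_in[OF q(1)]
  obtain \<Phi>' where "(\<Phi> (chart_at A ?q) has_derivative \<Phi>') (at (snd (chart_at A ?q) ?q, frame_coord ?q ?v))"
    using \<Phi>[OF \<kappa>] unfolding differentiable_def by blast
  from tangent_bundle_has_derivative[OF \<kappa> F[OF \<kappa>(1)] this]
  have "(F \<circ> chart_inv (lift_chart A (chart_at A ?q))) differentiable
      (at (snd (lift_chart A (chart_at A ?q)) (?q, ?v)))"
    using frame_vec_frame_coord[OF q] by (auto simp: differentiable_def)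
  then show ?thesis
    using has_derivative_dir_deriv_along_curve[OF dTA trajectory(3)[OF c] lift_chart_in[OF q]] by blast
qed

lemma quasi_velocity_along_trajectory:
  assumes "nonholonomic_trajectory A D G J c" "t \<in> J" "\<alpha> < DIM('e)"
  shows "isCont (\<lambda>s. dual_frame X \<alpha> (c s) (velocity A c s)) t"
proof -
  have "((\<lambda>s. quasi_velocity X \<alpha> (c s, velocity A c s)) has_real_derivative
      dir_deriv TA (c t, velocity A c t) (G (c t, velocity A c t)) (quasi_velocity X \<alpha>)) (at t)"
    by (rule has_derivative_along_trajectory[OF assms(1,2), where \<Phi> = "\<lambda>_ z. snd z \<bullet> coord_basis \<alpha>"])
      (use assms(3) frame_coord_has_derivative carrierI in \<open>auto simp: differentiable_def\<close>)
  then show ?thesis using DERIV_isCont by (simp add: quasi_velocity_def)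
qed

lemma theta_along_trajectory:
  assumes "nonholonomic_trajectory A D G J c" "t \<in> J" "i < DIM('e)"
  shows "((\<lambda>s. theta m X gh i (c s, velocity A c s)) has_real_derivative
      dir_deriv TA (c t, velocity A c t) (G (c t, velocity A c t)) (theta m X gh i)) (at t)"
proof (rule has_derivative_along_trajectory[OF assms(1,2),
    where \<Phi> = "\<lambda>\<kappa> z. \<Sum>a<m. gh (chart_inv \<kappa> (fst z)) (X a (chart_inv \<kappa> (fst z))) (X i (chart_inv \<kappa> (fst z)))
      * (snd z \<bullet> coord_basis a)"])
  show "theta m X gh i (q', frame_vec q' \<zeta>) = (\<Sum>a<m. gh (chart_inv \<kappa> (fst (snd \<kappa> q', \<zeta>))) (X a (chart_inv \<kappa> (fst (snd \<kappa> q', \<zeta>))))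
      (X i (chart_inv \<kappa> (fst (snd \<kappa> q', \<zeta>)))) * (snd (snd \<kappa> q', \<zeta>) \<bullet> coord_basis a))"
    if "\<kappa> \<in> A" "q' \<in> fst \<kappa>" for \<kappa> q' \<zeta>
    using that m_le carrierI by (simp add: theta_def chart_inv_chart[OF dA])
  show "(\<lambda>z. \<Sum>a<m. gh (chart_inv \<kappa> (fst z)) (X a (chart_inv \<kappa> (fst z))) (X i (chart_inv \<kappa> (fst z)))
      * (snd z \<bullet> coord_basis a)) differentiable (at (snd \<kappa> q, \<eta> :: 'e))" if "\<kappa> \<in> A" "q \<in> fst \<kappa>" for \<kappa> q \<eta>
  proof (intro differentiable_sum ballI differentiable_mult finite_lessThan)
    fix a assume "a \<in> {..<m}"
    then have a: "a < DIM('e)" using m_le by simp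
    show "(\<lambda>z. gh (chart_inv \<kappa> (fst z)) (X a (chart_inv \<kappa> (fst z))) (X i (chart_inv \<kappa> (fst z)))) differentiable (at (snd \<kappa> q, \<eta>))"
      using smooth_fun_fst_has_derivative[OF tensor_smooth[OF modified_tensor a assms(3)] that] unfolding differentiable_def by blast
    show "(\<lambda>z. snd z \<bullet> coord_basis a) differentiable (at (snd \<kappa> q, \<eta>))"
      using frame_coord_has_derivative unfolding differentiable_def by blast
  qed
qed

lemma chart_continuous_along_curve:
  assumes f: "chart_continuous f" and c: "has_velocity A c t v" "c t \<in> carrier A"
  shows "isCont (\<lambda>s. f (c s)) t"
proof -
  let ?\<kappa> = "chart_at A (c t)"
  note \<kappa> = chart_at_in[OF c(2)]
  have ev: "\<forall>\<^sub>F s in nhds t. c s \<in> fst ?\<kappa>" and d: "((snd ?\<kappa> \<circ> c) has_vector_derivative v ?\<kappa>) (at t)"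
    using c(1) \<kappa> unfolding has_velocity_def by blast+
  have "isCont (snd ?\<kappa> \<circ> c) t" using d by (rule has_vector_derivative_continuous)
  moreover have "isCont (\<lambda>x. f (chart_inv ?\<kappa> x)) ((snd ?\<kappa> \<circ> c) t)"
    using f \<kappa> open_chart_image[OF dA \<kappa>(1)] unfolding chart_continuous_def
    by (auto simp: continuous_on_eq_continuous_at)
  ultimately have "isCont (\<lambda>s. f (chart_inv ?\<kappa> ((snd ?\<kappa> \<circ> c) s))) t" by (rule isCont_o2)
  moreover have "\<forall>\<^sub>F s in nhds t. f (chart_inv ?\<kappa> ((snd ?\<kappa> \<circ> c) s)) = f (c s)"
    using ev by eventually_elim (simp add: chart_inv_chart[OF dA \<kappa>(1)])
  ultimately show ?thesis by (simp add: isCont_cong)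
qed

section \<open>The momentum balance along a trajectory\<close>

text \<open>
  The matrix of \<open>\<nabla>\<close>-bar along the velocity of \<open>c\<close>, in the frame.
\<close>

definition bar_matrix :: "(real \<Rightarrow> 'q) \<Rightarrow> nat \<Rightarrow> nat \<Rightarrow> real \<Rightarrow> real" where
  "bar_matrix c \<gamma> \<alpha> t = (\<Sum>a<m. dual_frame X a (c t) (velocity A c t) * bar_coeff \<gamma> a \<alpha> (c t))"

lemma cov_deriv_components:
  assumes "(c t, velocity A c t) \<in> C"
  shows "cov_deriv_along A nbar X c Y t = (\<lambda>\<kappa>. \<Sum>\<gamma><DIM('e).
     (deriv (\<lambda>s. dual_frame X \<gamma> (c s) (Y s)) t + (\<Sum>\<alpha><DIM('e). dual_frame X \<alpha> (c t) (Y t) * bar_matrix c \<gamma> \<alpha> t)) *\<^sub>R X \<gamma> (c t) \<kappa>)"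
proof
  fix \<kappa>
  have q: "c t \<in> carrier A" using assms by (auto simp: constraint_iff)
  let ?V = "\<lambda>q. lincomb {..<DIM('e)} (\<lambda>\<beta>. dual_frame X \<beta> (c t) (velocity A c t)) (\<lambda>\<beta>. X \<beta> q)"
  let ?y = "\<lambda>\<alpha>. dual_frame X \<alpha> (c t) (Y t)"
  have bar: "nbar ?V (X \<alpha>) (c t) = (\<lambda>\<kappa>. \<Sum>\<gamma><DIM('e). bar_matrix c \<gamma> \<alpha> t *\<^sub>R X \<gamma> (c t) \<kappa>)" if "\<alpha> < DIM('e)" for \<alpha>
    using nabla_bar_frame[OF q that, of "\<lambda>\<beta>. dual_frame X \<beta> (c t) (velocity A c t)"] assms
    by (simp add: constraint_iff bar_matrix_def)
  have "(\<Sum>\<alpha><DIM('e). ?y \<alpha> *\<^sub>R nbar ?V (X \<alpha>) (c t) \<kappa>) = (\<Sum>\<alpha><DIM('e). \<Sum>\<gamma><DIM('e). (?y \<alpha> * bar_matrix c \<gamma> \<alpha> t) *\<^sub>R X \<gamma> (c t) \<kappa>)"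
    by (simp add: bar scaleR_sum_right)
  also have "\<dots> = (\<Sum>\<gamma><DIM('e). (\<Sum>\<alpha><DIM('e). ?y \<alpha> * bar_matrix c \<gamma> \<alpha> t) *\<^sub>R X \<gamma> (c t) \<kappa>)"
    by (subst sum.swap) (simp add: scaleR_sum_left)
  finally show "cov_deriv_along A nbar X c Y t \<kappa> = (\<Sum>\<gamma><DIM('e).
     (deriv (\<lambda>s. dual_frame X \<gamma> (c s) (Y s)) t + (\<Sum>\<alpha><DIM('e). ?y \<alpha> * bar_matrix c \<gamma> \<alpha> t)) *\<^sub>R X \<gamma> (c t) \<kappa>)"
    by (simp add: cov_deriv_along_def Let_def sum.distrib scaleR_add_left)
qed

lemma bar_matrix_blocks:
  "\<lbrakk>\<gamma> < m; m \<le> \<alpha>\<rbrakk> \<Longrightarrow> bar_matrix c \<gamma> \<alpha> t = 0"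
  "\<lbrakk>m \<le> \<gamma>; \<alpha> < m\<rbrakk> \<Longrightarrow> bar_matrix c \<gamma> \<alpha> t = 0"
  "\<lbrakk>m \<le> \<gamma>; m \<le> \<alpha>\<rbrakk> \<Longrightarrow> bar_matrix c \<gamma> \<alpha> t =
     (\<Sum>a<m. dual_frame X a (c t) (velocity A c t) * structure_fun A X \<gamma> a \<alpha> (c t))"
  by (auto simp: bar_matrix_def bar_coeff_def)

lemma bar_matrix_continuous:
  assumes c: "nonholonomic_trajectory A D G J c" and "\<gamma> < DIM('e)" "\<alpha> < DIM('e)"
  shows "continuous_on J (bar_matrix c \<gamma> \<alpha>)"
proof (rule continuous_at_imp_continuous_on, rule ballI)
  fix t assume t: "t \<in> J"
  have q: "c t \<in> carrier A" using trajectory(1)[OF c t] by (simp add: constraint_iff)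
  have "isCont (\<lambda>t. dual_frame X a (c t) (velocity A c t) * bar_coeff \<gamma> a \<alpha> (c t)) t" if "a < m" for a
    using that m_le assms(2,3)
    by (intro continuous_mult quasi_velocity_along_trajectory[OF c t]
        chart_continuous_along_curve[OF bar_coeff_continuous trajectory(2)[OF c t] q]) auto
  then show "isCont (bar_matrix c \<gamma> \<alpha>) t"
    unfolding bar_matrix_def[abs_def] by (intro continuous_sum) auto
qed

lemma parallel_components:
  assumes c: "nonholonomic_trajectory A D G J c" and W: "parallel_along A nbar X c J W"
    and t: "t \<in> J" and \<gamma>: "\<gamma> < DIM('e)"
  shows "((\<lambda>s. dual_frame X \<gamma> (c s) (W s)) has_real_derivative
     (\<Sum>\<alpha><DIM('e). dual_frame X \<alpha> (c t) (W t) * - bar_matrix c \<gamma> \<alpha> t)) (at t)"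
proof -
  let ?w = "\<lambda>\<alpha> s. dual_frame X \<alpha> (c s) (W s)"
  note C = trajectory(1)[OF c t]
  have q: "c t \<in> carrier A" using C by (simp add: constraint_iff)
  have "(\<lambda>\<kappa>. 0) = (\<lambda>\<kappa>. \<Sum>\<gamma><DIM('e). (deriv (?w \<gamma>) t + (\<Sum>\<alpha><DIM('e). ?w \<alpha> t * bar_matrix c \<gamma> \<alpha> t)) *\<^sub>R X \<gamma> (c t) \<kappa>)"
    using W t cov_deriv_components[where Y = W, OF C] by (simp add: parallel_along_def)
  from dual_frame_eqI[OF q \<gamma> this] have "deriv (?w \<gamma>) t + (\<Sum>\<alpha><DIM('e). ?w \<alpha> t * bar_matrix c \<gamma> \<alpha> t) = dual_frame X \<gamma> (c t) (\<lambda>\<kappa>. 0)"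
    by simp
  also have "\<dots> = 0" by (rule dual_frame_eqI[OF q \<gamma>]) simp
  finally have "deriv (?w \<gamma>) t = (\<Sum>\<alpha><DIM('e). ?w \<alpha> t * - bar_matrix c \<gamma> \<alpha> t)" by (simp add: sum_negf)
  moreover have "?w \<gamma> differentiable (at t)"
    using W t \<gamma> by (simp add: parallel_along_def vector_field_along_def)
  ultimately show ?thesis using DERIV_deriv_iff_real_differentiable by metis
qed

text \<open>
  The components of \<open>W\<close> in \<open>D\<close> solve a homogeneous linear system by themselves, because \<open>\<nabla>\<close>-bar
  preserves \<open>D\<close> and \<open>D\<^sup>g\<close>, and they vanish at time \<open>0\<close>.
\<close>

lemma parallel_stays_orthogonal:
  assumes c: "nonholonomic_trajectory A D G J c" and W: "parallel_along A nbar X c J W"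
    and W0: "W 0 \<in> orth_compl A g D (c 0)" and t: "t \<in> J" and a: "a < m"
  shows "dual_frame X a (c t) (W t) = 0"
proof (rule linear_system_zero[where y = "\<lambda>a s. dual_frame X a (c s) (W s)" and B = "\<lambda>a b s. - bar_matrix c a b s" and J = J and m = m])
  show J: "is_interval J" "0 \<in> J" "t \<in> J" using c t by (auto simp: nonholonomic_trajectory_def)
  show "((\<lambda>s. dual_frame X b (c s) (W s)) has_real_derivative
      (\<Sum>d<m. dual_frame X d (c s) (W s) * - bar_matrix c b d s)) (at s)" if "s \<in> J" "b < m" for s b
  proof -
    have "(\<Sum>d<DIM('e). dual_frame X d (c s) (W s) * - bar_matrix c b d s) = (\<Sum>d<m. dual_frame X d (c s) (W s) * - bar_matrix c b d s)"
      by (rule sum.mono_neutral_right) (use m_le that bar_matrix_blocks(1) in auto)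
    then show ?thesis using parallel_components[OF c W that(1), of b] that m_le by simp
  qed
  show "continuous_on J (\<lambda>s. - bar_matrix c b d s)" if "b < m" "d < m" for b d
    using that m_le by (intro continuous_on_minus bar_matrix_continuous[OF c]) auto
  have "c 0 \<in> carrier A" using trajectory(1)[OF c J(2)] by (simp add: constraint_iff)
  then show "dual_frame X b (c 0) (W 0) = 0" if "b < m" for b
    using W0 that by (simp add: orth_compl_iff)
qed (rule a)

text \<open>
  The left-hand side of condition (B).
\<close>

definition residual_B :: "nat \<Rightarrow> 'q \<times> ('q, 'e) tvec \<Rightarrow> real" where
  "residual_B i p = dir_deriv TA p (G p) (theta m X gh i)
        + (\<Sum>k\<in>{m..<DIM('e)}. \<Sum>a<m. theta m X gh k p * structure_fun A X k i a (fst p) * quasi_velocity X a p)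
        + lambda i p"

lemma structure_fun_antisym:
  assumes "q \<in> carrier A" "\<alpha> < DIM('e)" "\<beta> < DIM('e)" "\<gamma> < DIM('e)"
  shows "structure_fun A X \<gamma> \<alpha> \<beta> q = - structure_fun A X \<gamma> \<beta> \<alpha> q"
  using assms by (simp add: structure_fun_torsion_free)

text \<open>
  The \<open>\<theta>\<^sub>i\<close> are the components in \<open>D\<^sup>g\<close> of the momentum \<open>gh(v, \<cdot>)\<close> of a vector \<open>v\<close> in \<open>D\<close>.
\<close>

lemma momentum_pairing:
  assumes "(q, v) \<in> C" and w: "w \<in> tangent_space A q" "\<And>a. a < m \<Longrightarrow> dual_frame X a q w = 0"
  shows "gh q v w = (\<Sum>i\<in>{m..<DIM('e)}. theta m X gh i (q, v) * dual_frame X i q w)"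
proof -
  have q: "q \<in> carrier A" "v \<in> tangent_space A q" using assms(1) by (auto simp: constraint_iff)
  have "gh q v w = (\<Sum>i<DIM('e). dual_frame X i q w * gh q v (X i q))"
    by (rule tensor_frame_right[OF modified_tensor q w(1)])
  also have "\<dots> = (\<Sum>i\<in>{m..<DIM('e)}. dual_frame X i q w * gh q v (X i q))"
    by (rule sum.mono_neutral_right) (use w in auto)
  also have "\<dots> = (\<Sum>i\<in>{m..<DIM('e)}. theta m X gh i (q, v) * dual_frame X i q w)"
  proof (intro sum.cong refl)
    fix i assume i: "i \<in> {m..<DIM('e)}"
    have "gh q v (X i q) = (\<Sum>\<alpha><DIM('e). dual_frame X \<alpha> q v * gh q (X \<alpha> q) (X i q))"
      using i by (intro tensor_frame_left[OF modified_tensor q] frame_in_tangent q) auto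
    also have "\<dots> = (\<Sum>a<m. dual_frame X a q v * gh q (X a q) (X i q))"
      by (rule sum.mono_neutral_right) (use m_le assms(1) in \<open>auto simp: constraint_iff\<close>)
    finally show "dual_frame X i q w * gh q v (X i q) = theta m X gh i (q, v) * dual_frame X i q w"
      by (simp add: theta_def quasi_velocity_def mult.commute)
  qed
  finally show ?thesis .
qed

text \<open>
  The three terms of (B) come from the derivative of \<open>\<theta>\<^sub>i\<close> along the integral curve, from the equation
  of parallel transport for \<open>W\<^sup>i\<close>, and from the equation for \<open>h\<close>.
\<close>

proposition momentum_derivative:
  assumes c: "nonholonomic_trajectory A D G J c" and W: "parallel_along A nbar X c J W"
    and W0: "W 0 \<in> orth_compl A g D (c 0)"
    and h: "form_cov_deriv_along A nbar X c J h (multiplier_form A (kinetic_lagrangian g) m X G c)"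
    and t: "t \<in> J"
  shows "((\<lambda>s. gh (c s) (velocity A c s) (W s) + h s (W s)) has_real_derivative
     (\<Sum>i\<in>{m..<DIM('e)}. residual_B i (c t, velocity A c t) * dual_frame X i (c t) (W t))) (at t)"
proof -
  let ?I = "{m..<DIM('e)}"
  let ?p = "\<lambda>s. (c s, velocity A c s)"
  let ?w = "\<lambda>i s. dual_frame X i (c s) (W s)"
  let ?\<theta> = "\<lambda>i s. theta m X gh i (?p s)"
  let ?d\<theta> = "\<lambda>i. dir_deriv TA (?p t) (G (?p t)) (theta m X gh i)"
  let ?v = "\<lambda>a. dual_frame X a (c t) (velocity A c t)"
  have J: "open J" using c by (simp add: nonholonomic_trajectory_def)
  have q: "c t \<in> carrier A" using trajectory(1)[OF c t] by (simp add: constraint_iff)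
  have Wt: "W s \<in> tangent_space A (c s)" if "s \<in> J" for s
    using W that by (simp add: parallel_along_def vector_field_along_def)
  have pair: "gh (c s) (velocity A c s) (W s) = (\<Sum>i\<in>?I. ?\<theta> i s * ?w i s)" if "s \<in> J" for s
    using momentum_pairing[OF trajectory(1)[OF c that] Wt[OF that] parallel_stays_orthogonal[OF c W W0 that]] .
  have dw: "(?w i has_real_derivative (\<Sum>k\<in>?I. ?w k t * (\<Sum>a<m. ?v a * structure_fun A X i k a (c t)))) (at t)"
    if i: "i \<in> ?I" for i
  proof -
    have "(\<Sum>k<DIM('e). ?w k t * - bar_matrix c i k t) = (\<Sum>k\<in>?I. ?w k t * - bar_matrix c i k t)"
      by (rule sum.mono_neutral_right) (use bar_matrix_blocks(2) i in auto)
    also have "\<dots> = (\<Sum>k\<in>?I. ?w k t * (\<Sum>a<m. ?v a * structure_fun A X i k a (c t)))"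
    proof (intro sum.cong refl arg_cong[where f = "\<lambda>z. _ * z"])
      fix k assume k: "k \<in> ?I"
      have "- bar_matrix c i k t = (\<Sum>a<m. ?v a * - structure_fun A X i a k (c t))"
        using i k by (simp add: bar_matrix_blocks(3) sum_negf)
      also have "\<dots> = (\<Sum>a<m. ?v a * structure_fun A X i k a (c t))"
        using i k m_le by (intro sum.cong refl arg_cong[where f = "\<lambda>z. _ * z"])
          (simp add: structure_fun_antisym[OF q, of k])
      finally show "- bar_matrix c i k t = (\<Sum>a<m. ?v a * structure_fun A X i k a (c t))" .
    qed
    finally show ?thesis using parallel_components[OF c W t, of i] i by simp
  qed
  have d1: "((\<lambda>s. \<Sum>i\<in>?I. ?\<theta> i s * ?w i s) has_real_derivative
     (\<Sum>i\<in>?I. ?d\<theta> i * ?w i t + (\<Sum>k\<in>?I. ?w k t * (\<Sum>a<m. ?v a * structure_fun A X i k a (c t))) * ?\<theta> i t)) (at t)"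
    by (intro DERIV_sum DERIV_mult theta_along_trajectory[OF c t] dw) auto
  \<comment> \<open>exchanging the roles of the two indices collects the coefficient of each \<open>W\<^sup>k\<close>\<close>
  have "(\<Sum>i\<in>?I. (\<Sum>k\<in>?I. ?w k t * (\<Sum>a<m. ?v a * structure_fun A X i k a (c t))) * ?\<theta> i t) =
     (\<Sum>i\<in>?I. \<Sum>k\<in>?I. (\<Sum>a<m. ?\<theta> i t * structure_fun A X i k a (c t) * ?v a) * ?w k t)"
    by (simp add: sum_distrib_left sum_distrib_right mult_ac)
  also have "\<dots> = (\<Sum>k\<in>?I. (\<Sum>i\<in>?I. \<Sum>a<m. ?\<theta> i t * structure_fun A X i k a (c t) * ?v a) * ?w k t)"
    by (subst sum.swap) (simp add: sum_distrib_right)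
  finally have d1': "((\<lambda>s. \<Sum>i\<in>?I. ?\<theta> i s * ?w i s) has_real_derivative
     (\<Sum>k\<in>?I. (?d\<theta> k + (\<Sum>i\<in>?I. \<Sum>a<m. ?\<theta> i t * structure_fun A X i k a (c t) * ?v a)) * ?w k t)) (at t)"
    using d1 by (simp add: sum.distrib distrib_right)
  have Wf: "vector_field_along A X c J W" using W by (simp add: parallel_along_def)
  have "one_form_along A c J h" using h by (simp add: form_cov_deriv_along_def)
  then have "h t (\<lambda>\<kappa>. 0 *\<^sub>R W t \<kappa> + 0 *\<^sub>R W t \<kappa>) = 0 * h t (W t) + 0 * h t (W t)"
    using t Wt[OF t] unfolding one_form_along_def by blast
  \<comment> \<open>the covariant derivative of \<open>W\<close> vanishes, so \<open>h\<close> is evaluated at the zero vector\<close>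
  then have h0: "h t (\<lambda>\<kappa>. 0) = 0" by simp
  have "(\<lambda>s. h s (W s)) differentiable (at t)"
    "multiplier_form A (kinetic_lagrangian g) m X G c t (W t) = deriv (\<lambda>s. h s (W s)) t - h t (cov_deriv_along A nbar X c W t)"
    using h Wf t unfolding form_cov_deriv_along_def by blast+
  moreover have "cov_deriv_along A nbar X c W t = (\<lambda>\<kappa>. 0)" using W t by (simp add: parallel_along_def)
  ultimately have d2: "((\<lambda>s. h s (W s)) has_real_derivative (\<Sum>i\<in>?I. lambda i (?p t) * ?w i t)) (at t)"
    using DERIV_deriv_iff_real_differentiable[of "\<lambda>s. h s (W s)" t] h0 by (simp add: multiplier_form_def)
  have "((\<lambda>s. (\<Sum>i\<in>?I. ?\<theta> i s * ?w i s) + h s (W s)) has_real_derivative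
     (\<Sum>i\<in>?I. residual_B i (?p t) * ?w i t)) (at t)"
    using DERIV_add[OF d1' d2] by (simp add: residual_B_def quasi_velocity_def sum.distrib distrib_right)
  moreover have "\<forall>\<^sub>F s in nhds t. gh (c s) (velocity A c s) (W s) + h s (W s) = (\<Sum>i\<in>?I. ?\<theta> i s * ?w i s) + h s (W s)"
    using eventually_nhds_in_open[OF J t] by eventually_elim (simp add: pair)
  ultimately show ?thesis by (subst DERIV_cong_ev[OF refl _ refl])
qed

end

context nonholonomic_system
begin

section \<open>Local existence of trajectories with parallel data\<close>

text \<open>
  Discards the components in \<open>D\<^sup>g\<close>, so that a differential equation for an unrestricted frame
  coordinate \<open>\<eta>\<close> produces velocities in \<open>D\<close>.
\<close>

definition horizontal :: "'e \<Rightarrow> 'e" where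
  "horizontal \<eta> = (\<Sum>a<m. (\<eta> \<bullet> coord_basis a) *\<^sub>R coord_basis a)"

lemma inner_horizontal:
  assumes "\<alpha> < DIM('e)"
  shows "horizontal \<eta> \<bullet> coord_basis \<alpha> = (if \<alpha> < m then \<eta> \<bullet> coord_basis \<alpha> else 0)"
proof -
  have "horizontal \<eta> = (\<Sum>\<beta><DIM('e). (if \<beta> < m then \<eta> \<bullet> coord_basis \<beta> else 0) *\<^sub>R coord_basis \<beta>)"
    unfolding horizontal_def by (intro sum.mono_neutral_cong_left) (use m_le in auto)
  then show ?thesis using inner_sum_coord_basis[OF assms] by simp
qed

lemma frame_vec_horizontal: "frame_vec q (horizontal \<eta>) \<kappa> = (\<Sum>a<m. (\<eta> \<bullet> coord_basis a) *\<^sub>R X a q \<kappa>)"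
  unfolding frame_vec_def
  by (rule sum.mono_neutral_cong_right) (use m_le in \<open>auto simp: inner_horizontal\<close>)

lemma horizontal_in_constraint: "q \<in> carrier A \<Longrightarrow> (q, frame_vec q (horizontal \<eta>)) \<in> C"
  by (auto simp: constraint_iff inner_horizontal)

text \<open>
  A smooth function on the constraint set is only given by local extensions to the tangent bundle.
  Restricting such an extension along \<open>(x, \<eta>) \<mapsto> \<eta>\<^sup>a X\<^sub>a(x)\<close> yields a continuous function on an open set
  of the Euclidean space \<open>'e \<times> 'e\<close>, as required for the right-hand side of a differential equation.
\<close>

lemma smooth_on_constraint_continuous:
  assumes f: "smooth_fun_on_subset TA C f" and \<kappa>: "\<kappa> \<in> A" "q \<in> fst \<kappa>"
  obtains S \<phi> where "open S" "(snd \<kappa> q, \<eta>) \<in> S" "S \<subseteq> snd \<kappa> ` fst \<kappa> \<times> UNIV" "continuous_on S \<phi>"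
    "\<And>q' \<zeta>. (snd \<kappa> q', \<zeta>) \<in> S \<Longrightarrow> q' \<in> fst \<kappa> \<Longrightarrow> \<phi> (snd \<kappa> q', \<zeta>) = f (q', frame_vec q' (horizontal \<zeta>))"
proof -
  let ?K = "lift_chart A \<kappa>"
  let ?p = "(q, frame_vec q (horizontal \<eta>))"
  let ?T = "snd \<kappa> ` fst \<kappa> \<times> (UNIV :: 'e set)"
  have p: "?p \<in> C" by (rule horizontal_in_constraint[OF carrierI[OF \<kappa>]])
  from bspec[OF f[unfolded smooth_fun_on_subset_def] this]
  obtain U F where U: "openin (manifold_topology TA) U" "?p \<in> U" "smooth_fun_on TA U F"
    "\<forall>x\<in>U \<inter> C. F x = f x" by (elim exE conjE)
  have K: "?K \<in> TA" using \<kappa> by (simp add: tangent_atlas_def)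
  let ?N = "snd ?K ` (U \<inter> fst ?K)"
  have "\<forall>\<kappa>\<in>TA. inj_on (snd \<kappa>) (fst \<kappa>)" using dTA by (simp add: differentiable_atlas_def)
  then have N: "open ?N" using U(1) K by (simp add: openin_manifold_topology)
  have "Ck_on 0 ?N (F \<circ> chart_inv ?K)"
    using U(3) K unfolding smooth_fun_on_def smooth_on_def by blast
  then have cF: "continuous_on ?N (F \<circ> chart_inv ?K)" by simp
  define E where "E z = (fst z, \<Sum>a<m. (snd z \<bullet> coord_basis a) *\<^sub>R local_rep \<kappa> (X a) (fst z))" for z :: "'e \<times> 'e"
  have E: "E (snd \<kappa> q', \<zeta>) = (snd \<kappa> q', frame_vec q' (horizontal \<zeta>) \<kappa>)" if "q' \<in> fst \<kappa>" for q' \<zeta>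
    using that \<kappa>(1) by (simp add: E_def frame_vec_horizontal local_rep_chart)
  have cE: "continuous_on ?T E"
  proof -
    have "continuous_on ?T (\<lambda>z. local_rep \<kappa> (X a) (fst z))" if "a < m" for a
      using that m_le by (intro continuous_on_compose2[OF vector_field_continuous[OF vector_field_frame \<kappa>(1)] continuous_on_fst[OF continuous_on_id]]) auto
    then show ?thesis unfolding E_def by (intro continuous_intros) auto
  qed
  have T: "open ?T" by (intro open_Times open_chart_image[OF dA \<kappa>(1)] open_UNIV)
  let ?S = "?T \<inter> E -` ?N"
  have inv: "chart_inv ?K (E (snd \<kappa> q', \<zeta>)) = (q', frame_vec q' (horizontal \<zeta>))" if q': "q' \<in> fst \<kappa>" for q' \<zeta>
    using tangent_eq_tvec_of[OF dA frame_vec_tangent[OF carrierI[OF \<kappa>(1) q']] \<kappa>(1) q']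
    by (simp add: E[OF q'] chart_inv_lift_chart[OF manifold \<kappa>(1) q'])
  show ?thesis
  proof (rule that[of ?S "\<lambda>z. (F \<circ> chart_inv ?K) (E z)"])
    show "open ?S" by (rule continuous_open_preimage[OF cE T N])
    have "E (snd \<kappa> q, \<eta>) = snd ?K ?p" by (simp add: E[OF \<kappa>(2)] lift_chart_def)
    moreover have "?p \<in> fst ?K" using \<kappa> carrierI[OF \<kappa>] by (simp add: lift_chart_def)
    ultimately show "(snd \<kappa> q, \<eta>) \<in> ?S" using \<kappa>(2) U(2) by auto
    show "continuous_on ?S (\<lambda>z. (F \<circ> chart_inv ?K) (E z))"
      by (rule continuous_on_compose2[OF cF continuous_on_subset[OF cE]]) auto
    show "(F \<circ> chart_inv ?K) (E (snd \<kappa> q', \<zeta>)) = f (q', frame_vec q' (horizontal \<zeta>))"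
      if z: "(snd \<kappa> q', \<zeta>) \<in> ?S" and q': "q' \<in> fst \<kappa>" for q' \<zeta>
    proof -
      have "E (snd \<kappa> q', \<zeta>) \<in> ?N" using z by simp
      then obtain r where r: "r \<in> U" "r \<in> fst ?K" "E (snd \<kappa> q', \<zeta>) = snd ?K r" by auto
      have "chart_inv ?K (snd ?K r) = (q', frame_vec q' (horizontal \<zeta>))"
        unfolding r(3)[symmetric] by (rule inv[OF q'])
      then have "r = (q', frame_vec q' (horizontal \<zeta>))"
        unfolding chart_inv_chart[OF dTA K r(2)] .
      with r(1) have "(q', frame_vec q' (horizontal \<zeta>)) \<in> U \<inter> C"
        using horizontal_in_constraint[OF carrierI[OF \<kappa>(1) q']] by simp
      then show ?thesis using U(4) by (simp add: inv[OF q'])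
    qed
  qed blast
qed

lemma lambda_expr_continuous:
  assumes S: "open S" "S \<subseteq> snd \<kappa> ` fst \<kappa> \<times> UNIV" and \<kappa>: "\<kappa> \<in> A" and i: "i < DIM('e)"
    and \<eta>: "continuous_on S \<eta>"
  shows "continuous_on S (\<lambda>z. lambda_expr i (chart_inv \<kappa> (fst z)) (\<eta> z))"
proof -
  have base: "continuous_on S (\<lambda>z. f (chart_inv \<kappa> (fst z)))" if "chart_continuous f" for f
    using that \<kappa> S unfolding chart_continuous_def
    by (intro continuous_on_compose2[where g = "\<lambda>x. f (chart_inv \<kappa> x)" and f = fst] continuous_on_fst continuous_on_id) auto
  show ?thesis
    unfolding lambda_expr_def
    by (intro continuous_on_minus continuous_on_add continuous_on_mult continuous_on_sum continuous_on_const
        continuous_on_inner \<eta> base[OF smooth_fun_continuous[OF tensor_smooth[OF metric_tensor]]]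
        base[OF structure_fun_continuous] base[OF dir_deriv_continuous[OF tensor_smooth[OF metric_tensor] vector_field_frame[OF i]]])
      (use i in auto)
qed

lemma has_real_derivative_inner:
  "(f has_vector_derivative f') (at t) \<Longrightarrow> ((\<lambda>s. f s \<bullet> b) has_real_derivative f' \<bullet> b) (at t)"
  unfolding has_real_derivative_iff_has_vector_derivative
  by (rule bounded_linear.has_vector_derivative[OF bounded_linear_inner_left])

text \<open>
  In a chart the unknowns are the coordinates \<open>x\<close> of \<open>c\<close> and the frame components \<open>\<eta>\<close>, \<open>\<omega>\<close>, \<open>\<mu>\<close> of
  its velocity, of \<open>W\<close> and of \<open>h\<close>. With \<open>G = v\<^sup>a X\<^sub>a\<^sup>C + f\<^sup>a X\<^sub>a\<^sup>V\<close> and the matrix \<open>N\<close> of \<open>\<nabla>\<close>-bar along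
  the velocity, the system is \<open>x' = \<eta>\<^sup>a X\<^sub>a(x)\<close>, \<open>(\<eta>\<^sup>a)' = f\<^sup>a\<close>, \<open>\<omega>' = -N \<omega>\<close>, \<open>\<mu>' = \<lambda> + N\<^sup>T \<mu>\<close>.
  It is equivalent to the geometric equations because along a solution the vector \<open>\<eta>\<^sup>a X\<^sub>a\<close> is the
  velocity of \<open>c\<close>, so that the derivative of its components is the one that \<open>G\<close> prescribes.
\<close>

proposition local_solution:
  assumes p: "(q, v) \<in> C" and w: "w \<in> tangent_space A q"
  obtains J c h W where "nonholonomic_trajectory A D G J c" "c 0 = q" "velocity A c 0 = v"
    "form_cov_deriv_along A nbar X c J h (multiplier_form A (kinetic_lagrangian g) m X G c)" "\<And>u. h 0 u = 0"
    "parallel_along A nbar X c J W" "W 0 = w"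
proof -
  have q: "q \<in> carrier A" "v \<in> tangent_space A q" using p by (auto simp: constraint_iff)
  define \<kappa> where "\<kappa> = chart_at A q"
  have \<kappa>: "\<kappa> \<in> A" "q \<in> fst \<kappa>" using chart_at_in[OF q(1)] by (simp_all add: \<kappa>_def)
  define \<eta>0 where "\<eta>0 = frame_coord q v"
  obtain f where f: "\<And>a. a < m \<Longrightarrow> smooth_fun_on_subset TA C (f a)"
    "\<And>p. p \<in> C \<Longrightarrow> G p = (\<lambda>K. \<Sum>a<m. quasi_velocity X a p *\<^sub>R complete_lift A (X a) p K + f a p *\<^sub>R vertical_lift A (X a) p K)"
    using dynamics_obtain by blast
  \<comment> \<open>\<open>z\<close> is an open set of points \<open>(x, \<eta>)\<close> together with the expression of \<open>f\<^sup>a\<close> on it\<close>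
  define good where "good a z \<longleftrightarrow> open (fst z) \<and> (snd \<kappa> q, \<eta>0) \<in> fst z \<and> fst z \<subseteq> snd \<kappa> ` fst \<kappa> \<times> UNIV \<and>
      continuous_on (fst z) (snd z) \<and> (\<forall>q' \<zeta>. (snd \<kappa> q', \<zeta>) \<in> fst z \<longrightarrow> q' \<in> fst \<kappa> \<longrightarrow>
        snd z (snd \<kappa> q', \<zeta>) = f a (q', frame_vec q' (horizontal \<zeta>)))" for a and z :: "('e \<times> 'e) set \<times> ('e \<times> 'e \<Rightarrow> real)"
  have "\<forall>a\<in>{..<m}. \<exists>z. good a z"
  proof
    fix a assume "a \<in> {..<m}"
    then have "smooth_fun_on_subset TA C (f a)" using f(1) by simp
    then obtain S \<phi> where "open S" "(snd \<kappa> q, \<eta>0) \<in> S" "S \<subseteq> snd \<kappa> ` fst \<kappa> \<times> UNIV" "continuous_on S \<phi>"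
      "\<And>q' \<zeta>. (snd \<kappa> q', \<zeta>) \<in> S \<Longrightarrow> q' \<in> fst \<kappa> \<Longrightarrow> \<phi> (snd \<kappa> q', \<zeta>) = f a (q', frame_vec q' (horizontal \<zeta>))"
      using smooth_on_constraint_continuous[OF _ \<kappa>, of "f a" \<eta>0] by blast
    then have "good a (S, \<phi>)" by (simp add: good_def)
    then show "\<exists>z. good a z" by blast
  qed
  from bchoice[OF this] obtain z where z: "\<And>a. a < m \<Longrightarrow> good a (z a)" by auto
  define \<phi> where "\<phi> a = snd (z a)" for a
  define S where "S = snd \<kappa> ` fst \<kappa> \<times> UNIV \<inter> (\<Inter>a\<in>{..<m}. fst (z a))"
  have S: "open S" unfolding S_def using z
    by (intro open_Int open_Times open_chart_image[OF dA \<kappa>(1)] open_UNIV open_INT) (auto simp: good_def)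
  have S0: "(snd \<kappa> q, \<eta>0) \<in> S" using z \<kappa> by (auto simp: S_def good_def)
  have SU: "S \<subseteq> snd \<kappa> ` fst \<kappa> \<times> UNIV" by (auto simp: S_def)
  have \<phi>: "continuous_on S (\<phi> a)"
    "\<And>q' \<zeta>. (snd \<kappa> q', \<zeta>) \<in> S \<Longrightarrow> q' \<in> fst \<kappa> \<Longrightarrow> \<phi> a (snd \<kappa> q', \<zeta>) = f a (q', frame_vec q' (horizontal \<zeta>))"
    if "a < m" for a
    using z[OF that] that by (auto simp: good_def \<phi>_def S_def intro: continuous_on_subset)
  define \<Omega> where "\<Omega> = (\<lambda>y :: 'e \<times> 'e \<times> 'e \<times> 'e. (fst y, fst (snd y))) -` S"
  have \<Omega>: "open \<Omega>" unfolding \<Omega>_def by (intro open_vimage S continuous_intros)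
  define N where "N \<gamma> \<alpha> y = (\<Sum>a<m. (fst (snd y) \<bullet> coord_basis a) * bar_coeff \<gamma> a \<alpha> (chart_inv \<kappa> (fst y)))"
    for \<gamma> \<alpha> and y :: "'e \<times> 'e \<times> 'e \<times> 'e"
  define l where "l \<alpha> y = (if m \<le> \<alpha> then lambda_expr \<alpha> (chart_inv \<kappa> (fst y)) (horizontal (fst (snd y))) else 0)"
    for \<alpha> and y :: "'e \<times> 'e \<times> 'e \<times> 'e"
  define F :: "'e \<times> 'e \<times> 'e \<times> 'e \<Rightarrow> 'e \<times> 'e \<times> 'e \<times> 'e" where "F y =
    (\<Sum>a<m. (fst (snd y) \<bullet> coord_basis a) *\<^sub>R local_rep \<kappa> (X a) (fst y),
     \<Sum>\<alpha><DIM('e). (if \<alpha> < m then \<phi> \<alpha> (fst y, fst (snd y)) else 0) *\<^sub>R coord_basis \<alpha>,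
     \<Sum>\<gamma><DIM('e). (\<Sum>\<alpha><DIM('e). (fst (snd (snd y)) \<bullet> coord_basis \<alpha>) * - N \<gamma> \<alpha> y) *\<^sub>R coord_basis \<gamma>,
     \<Sum>\<alpha><DIM('e). (l \<alpha> y + (\<Sum>\<gamma><DIM('e). (snd (snd (snd y)) \<bullet> coord_basis \<gamma>) * N \<gamma> \<alpha> y)) *\<^sub>R coord_basis \<alpha>)" for y
  have "continuous_on \<Omega> F"
  proof -
    have xin: "fst y \<in> snd \<kappa> ` fst \<kappa>" if "y \<in> \<Omega>" for y using that SU by (auto simp: \<Omega>_def)
    have base: "continuous_on \<Omega> (\<lambda>y. k (fst y))" if "continuous_on (snd \<kappa> ` fst \<kappa>) k" for k :: "'e \<Rightarrow> 'b::topological_space"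
      by (rule continuous_on_compose2[OF that continuous_on_fst[OF continuous_on_id]]) (use xin in auto)
    have xy: "continuous_on \<Omega> (\<lambda>y. k (fst y, fst (snd y)))" if "continuous_on S k" for k :: "'e \<times> 'e \<Rightarrow> real"
      by (rule continuous_on_compose2[OF that]) (auto simp: \<Omega>_def intro!: continuous_intros)
    have cl: "continuous_on \<Omega> (l \<alpha>)" if "\<alpha> < DIM('e)" for \<alpha>
    proof -
      have "continuous_on S (\<lambda>z. horizontal (snd z))"
        unfolding horizontal_def by (intro continuous_intros)
      from xy[OF lambda_expr_continuous[OF S SU \<kappa>(1) that this]]
      show ?thesis unfolding l_def[abs_def] by (cases "m \<le> \<alpha>") simp_all
    qed
    have cN: "continuous_on \<Omega> (N \<gamma> \<alpha>)" if "\<gamma> < DIM('e)" "\<alpha> < DIM('e)" for \<gamma> \<alpha>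
    proof -
      have "continuous_on \<Omega> (\<lambda>y. bar_coeff \<gamma> a \<alpha> (chart_inv \<kappa> (fst y)))" if "a < m" for a
        using bar_coeff_continuous[of a \<alpha> \<gamma>] that \<open>\<gamma> < DIM('e)\<close> \<open>\<alpha> < DIM('e)\<close> m_le \<kappa>(1)
        by (intro base) (auto simp: chart_continuous_def)
      then show ?thesis unfolding N_def[abs_def] by (intro continuous_intros) auto
    qed
    have cX: "continuous_on \<Omega> (\<lambda>y. local_rep \<kappa> (X a) (fst y))" if "a < m" for a
      using that m_le by (intro base vector_field_continuous vector_field_frame \<kappa>) auto
    have c\<phi>: "continuous_on \<Omega> (\<lambda>y. if \<alpha> < m then \<phi> \<alpha> (fst y, fst (snd y)) else 0)" for \<alpha>
      using xy[OF \<phi>(1)] by (cases "\<alpha> < m") auto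
    show ?thesis
      unfolding F_def[abs_def]
      by (intro continuous_on_Pair continuous_on_sum continuous_on_scaleR continuous_on_inner continuous_on_fst
          continuous_on_snd continuous_on_id continuous_on_const continuous_on_add continuous_on_mult continuous_on_minus
          cX c\<phi> cN cl) auto
  qed
  moreover have "(snd \<kappa> q, \<eta>0, frame_coord q w, 0) \<in> \<Omega>" using S0 by (simp add: \<Omega>_def)
  ultimately obtain y \<epsilon> where \<epsilon>: "0 < \<epsilon>" and y0: "y 0 = (snd \<kappa> q, \<eta>0, frame_coord q w, 0)"
    and y: "\<And>t. t \<in> {-\<epsilon><..<\<epsilon>} \<Longrightarrow> y t \<in> \<Omega> \<and> (y has_vector_derivative F (y t)) (at t)"
    using Peano_existence[OF \<Omega>] by blast
  define J where "J = {-\<epsilon><..<\<epsilon>}"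
  have J: "open J" "is_interval J" "0 \<in> J" using \<epsilon> by (auto simp: J_def is_interval_oo)
  define \<eta> where "\<eta> t = fst (snd (y t))" for t
  define \<omega> where "\<omega> t = fst (snd (snd (y t)))" for t
  define \<mu> where "\<mu> t = snd (snd (snd (y t)))" for t
  define c where "c t = chart_inv \<kappa> (fst (y t))" for t
  define V where "V t = frame_vec (c t) (horizontal (\<eta> t))" for t
  define W where "W t = frame_vec (c t) (\<omega> t)" for t
  define h where "h t u = (\<Sum>\<alpha><DIM('e). (\<mu> t \<bullet> coord_basis \<alpha>) * dual_frame X \<alpha> (c t) u)" for t u
  have ct: "c t \<in> fst \<kappa>" "snd \<kappa> (c t) = fst (y t)" if "t \<in> J" for t
  proof -
    have "fst (y t) \<in> snd \<kappa> ` fst \<kappa>" using y that SU by (auto simp: J_def \<Omega>_def)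
    then show "c t \<in> fst \<kappa>" "snd \<kappa> (c t) = fst (y t)"
      by (simp_all add: c_def inv_into_into f_inv_into_f)
  qed
  note cC = carrierI[OF \<kappa>(1) ct(1)]
  have dy: "(y has_vector_derivative F (y t)) (at t)" if "t \<in> J" for t using y that by (simp add: J_def)
  have dfst: "((\<lambda>s. fst (k s)) has_vector_derivative fst k') (at t)"
    if "(k has_vector_derivative k') (at t)" for k :: "real \<Rightarrow> 'b::real_normed_vector \<times> 'c::real_normed_vector" and k' t
    by (rule bounded_linear.has_vector_derivative[OF bounded_linear_fst that])
  have dsnd: "((\<lambda>s. snd (k s)) has_vector_derivative snd k') (at t)"
    if "(k has_vector_derivative k') (at t)" for k :: "real \<Rightarrow> 'b::real_normed_vector \<times> 'c::real_normed_vector" and k' t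
    by (rule bounded_linear.has_vector_derivative[OF bounded_linear_snd that])
  have d\<eta>: "((\<lambda>s. \<eta> s \<bullet> coord_basis a) has_real_derivative f a (c t, V t)) (at t)" if t: "t \<in> J" and a: "a < m" for t a
  proof -
    have "(fst (y t), \<eta> t) \<in> S" using y t by (simp add: J_def \<Omega>_def \<eta>_def)
    then have "\<phi> a (fst (y t), \<eta> t) = f a (c t, V t)"
      using \<phi>(2)[OF a, of "c t" "\<eta> t"] ct[OF t] by (simp add: V_def)
    then show ?thesis
      using has_real_derivative_inner[OF dfst[OF dsnd[OF dy[OF t]]], of "coord_basis a"] a m_le
      by (simp add: F_def \<eta>_def inner_sum_coord_basis)
  qed
  have VC: "(c t, V t) \<in> C" if "t \<in> J" for t
    unfolding V_def by (rule horizontal_in_constraint[OF cC[OF that]])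
  then have Vt: "V t \<in> tangent_space A (c t)" if "t \<in> J" for t using that by (simp add: constraint_iff)
  have vel: "has_velocity A c t (V t)" if t: "t \<in> J" for t
  proof -
    have ev: "\<forall>\<^sub>F s in nhds t. s \<in> J" by (rule eventually_nhds_in_open[OF J(1) t])
    have "fst (F (y t)) = V t \<kappa>"
      using ct[OF t] by (simp add: F_def V_def frame_vec_horizontal local_rep_def \<eta>_def c_def)
    then have "((\<lambda>s. fst (y s)) has_vector_derivative V t \<kappa>) (at t)" using dfst[OF dy[OF t]] by simp
    moreover have "\<forall>\<^sub>F s in nhds t. (snd \<kappa> \<circ> c) s = fst (y s)"
      using ev by eventually_elim (simp add: ct)
    ultimately have "((snd \<kappa> \<circ> c) has_vector_derivative V t \<kappa>) (at t)"
      by (subst has_vector_derivative_cong_ev[where g = "\<lambda>s. fst (y s)"])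
        (auto dest: eventually_nhds_x_imp_x elim: eventually_mono)
    moreover have "\<forall>\<^sub>F s in nhds t. c s \<in> fst \<kappa>" using ev by eventually_elim (rule ct)
    ultimately have "has_velocity A c t (tvec_of A (c t) \<kappa> (V t \<kappa>))"
      by (intro has_velocity_from_chart[OF dA \<kappa>(1)])
    then show ?thesis using tangent_eq_tvec_of[OF dA Vt[OF t] \<kappa>(1) ct(1)[OF t]] by simp
  qed
  have velocity: "velocity A c t = V t" if "t \<in> J" for t by (rule velocity_eq[OF dA vel[OF that] Vt[OF that]])
  \<comment> \<open>verified in the chart selected at \<open>c(t)\<close>, in which the lifts are given; it varies with \<open>t\<close>\<close>
  have "has_velocity TA (\<lambda>s. (c s, V s)) t (G (c t, V t))" if t: "t \<in> J" for t
  proof -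
    let ?k = "chart_at A (c t)"
    let ?K = "lift_chart A ?k"
    note k = chart_at_in[OF cC[OF t]]
    have ev: "\<forall>\<^sub>F s in nhds t. c s \<in> fst ?k" and d0: "((snd ?k \<circ> c) has_vector_derivative V t ?k) (at t)"
      using vel[OF t] k unfolding has_velocity_def by blast+
    have evJ: "\<forall>\<^sub>F s in nhds t. s \<in> J" by (rule eventually_nhds_in_open[OF J(1) t])
    let ?x = "\<lambda>s. snd ?k (c s)"
    have d1: "((\<lambda>s. local_rep ?k (X a) (?x s)) has_vector_derivative frame_deriv ?k a (?x t) (V t ?k)) (at t)"
      if "a < m" for a
    proof -
      have "(local_rep ?k (X a) has_derivative frame_deriv ?k a (?x t)) (at ((snd ?k \<circ> c) t))"
        using vector_field_has_derivative[OF vector_field_frame[of a] k] that m_le by simp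
      from vector_derivative_diff_chain_within[OF d0 has_derivative_at_withinI[OF this]]
      show ?thesis by (simp add: comp_def)
    qed
    have "((\<lambda>s. (?x s, \<Sum>a<m. (\<eta> s \<bullet> coord_basis a) *\<^sub>R local_rep ?k (X a) (?x s))) has_vector_derivative
       (V t ?k, \<Sum>a<m. (\<eta> t \<bullet> coord_basis a) *\<^sub>R frame_deriv ?k a (?x t) (V t ?k) + f a (c t, V t) *\<^sub>R local_rep ?k (X a) (?x t))) (at t)"
      using d0 by (intro has_vector_derivative_Pair has_vector_derivative_sum has_vector_derivative_scaleR d\<eta>[OF t] d1) (auto simp: comp_def)
    moreover have "\<forall>\<^sub>F s in nhds t. (snd ?K \<circ> (\<lambda>s. (c s, V s))) s = (?x s, \<Sum>a<m. (\<eta> s \<bullet> coord_basis a) *\<^sub>R local_rep ?k (X a) (?x s))"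
      using ev by eventually_elim (simp add: lift_chart_def V_def frame_vec_horizontal local_rep_chart[OF k(1)])
    ultimately have d: "((snd ?K \<circ> (\<lambda>s. (c s, V s))) has_vector_derivative
       (V t ?k, \<Sum>a<m. (\<eta> t \<bullet> coord_basis a) *\<^sub>R frame_deriv ?k a (?x t) (V t ?k) + f a (c t, V t) *\<^sub>R X a (c t) ?k)) (at t)"
      by (subst has_vector_derivative_cong_ev[where g = "\<lambda>s. (?x s, \<Sum>a<m. (\<eta> s \<bullet> coord_basis a) *\<^sub>R local_rep ?k (X a) (?x s))"])
        (auto dest: eventually_nhds_x_imp_x elim: eventually_mono simp: local_rep_chart[OF k])
    have evK: "\<forall>\<^sub>F s in nhds t. (c s, V s) \<in> fst ?K"
      using ev evJ by eventually_elim (simp add: lift_chart_def Vt)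
    have "G (c t, V t) = tvec_of TA (c t, V t) ?K (V t ?k, \<Sum>a<m. dual_frame X a (c t) (V t) *\<^sub>R frame_deriv ?k a (?x t) (V t ?k)
        + f a (c t, V t) *\<^sub>R X a (c t) ?k)"
      by (rule dynamics_chart[OF VC[OF t] f(2)[OF VC[OF t]]])
    also have "(\<Sum>a<m. dual_frame X a (c t) (V t) *\<^sub>R frame_deriv ?k a (?x t) (V t ?k) + f a (c t, V t) *\<^sub>R X a (c t) ?k) =
       (\<Sum>a<m. (\<eta> t \<bullet> coord_basis a) *\<^sub>R frame_deriv ?k a (?x t) (V t ?k) + f a (c t, V t) *\<^sub>R X a (c t) ?k)"
      using m_le by (intro sum.cong) (auto simp: V_def cC[OF t] inner_horizontal)
    finally show ?thesis
      using has_velocity_from_chart[OF dTA lift_chart_in(1)[OF cC[OF t] Vt[OF t]] evK d] by simp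
  qed
  then have traj: "nonholonomic_trajectory A D G J c"
    unfolding nonholonomic_trajectory_def using J VC by (intro conjI exI[of _ "\<lambda>t. (c t, V t)"]) auto
  have N: "bar_matrix c \<gamma> \<alpha> t = N \<gamma> \<alpha> (y t)" if t: "t \<in> J" for \<gamma> \<alpha> t
    unfolding bar_matrix_def N_def velocity[OF t] using m_le
    by (intro sum.cong) (auto simp: V_def cC[OF t] inner_horizontal \<eta>_def c_def[symmetric])
  have c0: "c 0 = q" using \<kappa> by (simp add: c_def y0 chart_inv_chart[OF dA])
  have V0: "V 0 = v"
  proof (rule tangent_eq_dualI[OF q(1) _ q(2)])
    show "V 0 \<in> tangent_space A q" using Vt[OF J(3)] c0 by simp
    show "dual_frame X \<alpha> q (V 0) = dual_frame X \<alpha> q v" if "\<alpha> < DIM('e)" for \<alpha>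
      using that q(1) p by (auto simp: V_def c0 inner_horizontal \<eta>_def y0 \<eta>0_def constraint_iff)
  qed
  have lam: "multiplier A (kinetic_lagrangian g) X G i (c t, V t) = l i (y t)" if t: "t \<in> J" and i: "i \<in> {m..<DIM('e)}" for t i
    using multiplier_formula[OF cC[OF t] i, of "horizontal (\<eta> t)" G] dynamics_tangent[OF VC[OF t]] i
    by (simp add: V_def inner_horizontal l_def \<eta>_def c_def)
  have d\<mu>: "((\<lambda>s. \<mu> s \<bullet> coord_basis \<alpha>) has_real_derivative l \<alpha> (y t) + (\<Sum>\<gamma><DIM('e). (\<mu> t \<bullet> coord_basis \<gamma>) * bar_matrix c \<gamma> \<alpha> t)) (at t)"
    if t: "t \<in> J" and "\<alpha> < DIM('e)" for t \<alpha>
    using has_real_derivative_inner[OF dsnd[OF dsnd[OF dsnd[OF dy[OF t]]]], of "coord_basis \<alpha>"] that(2)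
    by (simp add: F_def \<mu>_def inner_sum_coord_basis N[OF t])
  have d\<omega>: "((\<lambda>s. \<omega> s \<bullet> coord_basis \<gamma>) has_real_derivative (\<Sum>\<alpha><DIM('e). (\<omega> t \<bullet> coord_basis \<alpha>) * - bar_matrix c \<gamma> \<alpha> t)) (at t)"
    if t: "t \<in> J" and "\<gamma> < DIM('e)" for t \<gamma>
    using has_real_derivative_inner[OF dfst[OF dsnd[OF dsnd[OF dy[OF t]]]], of "coord_basis \<gamma>"] that(2)
    by (simp add: F_def \<omega>_def inner_sum_coord_basis N[OF t])
  have form: "form_cov_deriv_along A nbar X c J h (multiplier_form A (kinetic_lagrangian g) m X G c)"
    unfolding form_cov_deriv_along_def
  proof (intro conjI allI impI ballI)
    show "one_form_along A c J h"
      unfolding one_form_along_def h_def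
      by (auto simp: tangent_linear(2)[OF cC] sum_distrib_left sum.distrib[symmetric] algebra_simps intro!: sum.cong)
    fix Y t assume Y: "vector_field_along A X c J Y" and t: "t \<in> J"
    let ?y = "\<lambda>\<alpha> s. dual_frame X \<alpha> (c s) (Y s)"
    have dY: "(?y \<alpha> has_real_derivative deriv (?y \<alpha>) t) (at t)" if "\<alpha> < DIM('e)" for \<alpha>
      using Y t that unfolding vector_field_along_def by (simp add: DERIV_deriv_iff_real_differentiable)
    have Yt: "Y t \<in> tangent_space A (c t)" using Y t by (simp add: vector_field_along_def)
    have dh: "((\<lambda>s. h s (Y s)) has_real_derivative
        (\<Sum>\<alpha><DIM('e). (l \<alpha> (y t) + (\<Sum>\<gamma><DIM('e). (\<mu> t \<bullet> coord_basis \<gamma>) * bar_matrix c \<gamma> \<alpha> t)) * ?y \<alpha> t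
           + deriv (?y \<alpha>) t * (\<mu> t \<bullet> coord_basis \<alpha>))) (at t)"
      unfolding h_def by (intro DERIV_sum DERIV_mult d\<mu>[OF t] dY) auto
    then show "(\<lambda>s. h s (Y s)) differentiable (at t)" unfolding real_differentiable_def by blast
    have "h t (cov_deriv_along A nbar X c Y t) = (\<Sum>\<gamma><DIM('e). (\<mu> t \<bullet> coord_basis \<gamma>) *
        (deriv (?y \<gamma>) t + (\<Sum>\<alpha><DIM('e). ?y \<alpha> t * bar_matrix c \<gamma> \<alpha> t)))"
      unfolding h_def cov_deriv_components[where Y = Y, OF trajectory(1)[OF traj t]]
      by (intro sum.cong refl arg_cong[where f = "\<lambda>z. _ * z"] dual_frame_eqI[OF cC[OF t]]) auto
    also have "\<dots> = (\<Sum>\<gamma><DIM('e). (\<mu> t \<bullet> coord_basis \<gamma>) * deriv (?y \<gamma>) t) +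
        (\<Sum>\<gamma><DIM('e). \<Sum>\<alpha><DIM('e). (\<mu> t \<bullet> coord_basis \<gamma>) * bar_matrix c \<gamma> \<alpha> t * ?y \<alpha> t)"
      by (simp add: distrib_left sum.distrib sum_distrib_left mult_ac)
    also have "(\<Sum>\<gamma><DIM('e). \<Sum>\<alpha><DIM('e). (\<mu> t \<bullet> coord_basis \<gamma>) * bar_matrix c \<gamma> \<alpha> t * ?y \<alpha> t) =
        (\<Sum>\<alpha><DIM('e). (\<Sum>\<gamma><DIM('e). (\<mu> t \<bullet> coord_basis \<gamma>) * bar_matrix c \<gamma> \<alpha> t) * ?y \<alpha> t)"
      by (subst sum.swap) (simp add: sum_distrib_right)
    finally have hc: "h t (cov_deriv_along A nbar X c Y t) = (\<Sum>\<gamma><DIM('e). (\<mu> t \<bullet> coord_basis \<gamma>) * deriv (?y \<gamma>) t) +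
        (\<Sum>\<alpha><DIM('e). (\<Sum>\<gamma><DIM('e). (\<mu> t \<bullet> coord_basis \<gamma>) * bar_matrix c \<gamma> \<alpha> t) * ?y \<alpha> t)" .
    have "multiplier_form A (kinetic_lagrangian g) m X G c t (Y t) = (\<Sum>i\<in>{m..<DIM('e)}. l i (y t) * ?y i t)"
      unfolding multiplier_form_def velocity[OF t] by (intro sum.cong) (auto simp: lam[OF t])
    also have "\<dots> = (\<Sum>\<alpha><DIM('e). l \<alpha> (y t) * ?y \<alpha> t)"
      by (rule sum.mono_neutral_left) (auto simp: l_def)
    also have "\<dots> = deriv (\<lambda>s. h s (Y s)) t - h t (cov_deriv_along A nbar X c Y t)"
      unfolding DERIV_imp_deriv[OF dh] hc by (simp add: sum.distrib algebra_simps)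
    finally show "multiplier_form A (kinetic_lagrangian g) m X G c t (Y t) =
        deriv (\<lambda>s. h s (Y s)) t - h t (cov_deriv_along A nbar X c Y t)" .
  qed
  have dualW: "dual_frame X \<alpha> (c s) (W s) = \<omega> s \<bullet> coord_basis \<alpha>" if "s \<in> J" "\<alpha> < DIM('e)" for s \<alpha>
    using that by (simp add: W_def cC)
  have dW: "((\<lambda>s. dual_frame X \<gamma> (c s) (W s)) has_real_derivative (\<Sum>\<alpha><DIM('e). (\<omega> t \<bullet> coord_basis \<alpha>) * - bar_matrix c \<gamma> \<alpha> t)) (at t)"
    if t: "t \<in> J" and \<gamma>: "\<gamma> < DIM('e)" for t \<gamma>
  proof -
    have "\<forall>\<^sub>F s in nhds t. dual_frame X \<gamma> (c s) (W s) = \<omega> s \<bullet> coord_basis \<gamma>"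
      using eventually_nhds_in_open[OF J(1) t] by eventually_elim (simp add: dualW \<gamma>)
    then show ?thesis using d\<omega>[OF t \<gamma>] by (subst DERIV_cong_ev[OF refl _ refl])
  qed
  have par: "parallel_along A nbar X c J W"
    unfolding parallel_along_def vector_field_along_def
  proof (intro conjI ballI allI impI)
    fix t assume t: "t \<in> J"
    show "W t \<in> tangent_space A (c t)" using cC[OF t] by (simp add: W_def)
    show "(\<lambda>s. dual_frame X \<alpha> (c s) (W s)) differentiable (at t)" if "\<alpha> < DIM('e)" for \<alpha>
      using dW[OF t that] unfolding real_differentiable_def by blast
    show "cov_deriv_along A nbar X c W t = (\<lambda>\<kappa>. 0)"
      unfolding cov_deriv_components[where Y = W, OF trajectory(1)[OF traj t]]
      by (auto simp: fun_eq_iff DERIV_imp_deriv[OF dW[OF t]] dualW[OF t] sum_negf intro!: sum.neutral)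
  qed
  show ?thesis
  proof (rule that[OF traj c0 _ form _ par])
    show "velocity A c 0 = v" using velocity[OF J(3)] V0 by simp
    show "h 0 u = 0" for u by (simp add: h_def \<mu>_def y0)
    show "W 0 = w" using frame_vec_frame_coord[OF q(1) w] by (simp add: W_def c0 \<omega>_def y0)
  qed
qed

section \<open>The conservation law\<close>

theorem condition_B_iff_conserved:
  "condition_B A (kinetic_lagrangian g) m D X G gh \<longleftrightarrow>
    (\<forall>q\<in>carrier A. \<forall>v\<in>D q. \<forall>J c h.
       nonholonomic_trajectory A D G J c \<and> c 0 = q \<and> velocity A c 0 = v \<and>
       form_cov_deriv_along A nbar X c J h (multiplier_form A (kinetic_lagrangian g) m X G c) \<and>
       (\<forall>w\<in>tangent_space A q. h 0 w = 0) \<longrightarrow>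
       (\<forall>w\<in>orth_compl A g D q. \<forall>W.
          parallel_along A nbar X c J W \<and> W 0 = w \<longrightarrow>
          (\<forall>t\<in>J. gh (c t) (velocity A c t) (W t) + h t (W t) = gh q v w)))"
    (is "_ \<longleftrightarrow> ?conserved")
proof
  assume "condition_B A (kinetic_lagrangian g) m D X G gh"
  then have B: "residual_B i p = 0" if "i \<in> {m..<DIM('e)}" "p \<in> C" for i p
    using that unfolding condition_B_def residual_B_def by blast
  show ?conserved
  proof (intro ballI allI impI, elim conjE)
    fix q v J c h w W t
    assume q: "q \<in> carrier A" and c: "nonholonomic_trajectory A D G J c" "c 0 = q" "velocity A c 0 = v"
      and h: "form_cov_deriv_along A nbar X c J h (multiplier_form A (kinetic_lagrangian g) m X G c)"
        "\<forall>w\<in>tangent_space A q. h 0 w = 0"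
      and w: "w \<in> orth_compl A g D q" and W: "parallel_along A nbar X c J W" "W 0 = w" and t: "t \<in> J"
    let ?E = "\<lambda>t. gh (c t) (velocity A c t) (W t) + h t (W t)"
    have J: "open J" "is_interval J" "0 \<in> J" using c by (auto simp: nonholonomic_trajectory_def)
    have "(?E has_derivative (\<lambda>_. 0)) (at s within J)" if s: "s \<in> J" for s
    proof -
      have "(?E has_real_derivative 0) (at s)"
        using momentum_derivative[OF c(1) W(1) _ h(1) s] w W(2) c(2) B trajectory(1)[OF c(1) s] by simp
      then have "(?E has_derivative (\<lambda>_. 0)) (at s)" by (simp add: has_field_derivative_def lambda_zero)
      then show ?thesis by (rule has_derivative_at_withinI)
    qed
    then have "\<exists>k. \<forall>s\<in>J. ?E s = k"
      by (intro has_derivative_zero_constant is_interval_convex J)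
    then have "?E t = ?E 0" using t J(3) by auto
    also have "?E 0 = gh q v w" using c(2,3) W(2) h(2) w by (simp add: orth_compl_def)
    finally show "?E t = gh q v w" .
  qed
next
  assume conserved: ?conserved
  have "residual_B i (q, v) = 0" if i: "i \<in> {m..<DIM('e)}" and p: "(q, v) \<in> C" for i q v
  proof -
    have q: "q \<in> carrier A" "v \<in> D q" using p by (auto simp: constraint_set_def)
    have Xi: "X i q \<in> orth_compl A g D q" "X i q \<in> tangent_space A q"
      using i m_le q(1) by (auto simp: orth_compl_iff frame_in_tangent dual_frame_frame)
    \<comment> \<open>starting \<open>W\<close> at \<open>X\<^sub>i\<close> singles out the term \<open>B\<^sub>i\<close> of the balance law at time \<open>0\<close>\<close>
    obtain J c h W where c: "nonholonomic_trajectory A D G J c" "c 0 = q" "velocity A c 0 = v"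
      and h: "form_cov_deriv_along A nbar X c J h (multiplier_form A (kinetic_lagrangian g) m X G c)" "\<And>u. h 0 u = 0"
      and W: "parallel_along A nbar X c J W" "W 0 = X i q"
      using local_solution[OF p Xi(2)] by blast
    let ?E = "\<lambda>t. gh (c t) (velocity A c t) (W t) + h t (W t)"
    have J: "open J" "0 \<in> J" using c by (auto simp: nonholonomic_trajectory_def)
    have E: "?E t = gh q v (X i q)" if "t \<in> J" for t
      using conserved q c h Xi(1) W that by blast
    have "\<forall>\<^sub>F t in nhds 0. ?E t = gh q v (X i q)"
      using eventually_nhds_in_open[OF J] by eventually_elim (rule E)
    then have "(?E has_real_derivative 0) (at 0)" by (subst DERIV_cong_ev[OF refl _ refl]) auto
    moreover have "(?E has_real_derivative (\<Sum>k\<in>{m..<DIM('e)}. residual_B k (q, v) * dual_frame X k q (X i q))) (at 0)"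
      using momentum_derivative[OF c(1) W(1) _ h(1) J(2)] Xi(1) W(2) c(2,3) by simp
    ultimately have "(\<Sum>k\<in>{m..<DIM('e)}. residual_B k (q, v) * dual_frame X k q (X i q)) = 0"
      by (rule DERIV_unique[THEN sym])
    moreover have "(\<Sum>k\<in>{m..<DIM('e)}. residual_B k (q, v) * dual_frame X k q (X i q)) = (\<Sum>k\<in>{m..<DIM('e)}. if k = i then residual_B k (q, v) else 0)"
      using i by (intro sum.cong) (auto simp: dual_frame_frame[OF q(1)])
    ultimately show ?thesis using i by simp
  qed
  then show "condition_B A (kinetic_lagrangian g) m D X G gh"
    unfolding condition_B_def residual_B_def by auto
qed

end

theorem proposition9:
  fixes A :: "('q, 'e::euclidean_space) atlas"
    and g gh :: "('q, 'e) tensor2"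
    and D :: "('q, 'e) distr"
    and m :: nat
    and X :: "nat \<Rightarrow> ('q, 'e) vfield"
    and nab :: "('q, 'e) connection"
    and L :: "'q \<times> ('q, 'e) tvec \<Rightarrow> real"
    and G :: "('q \<times> ('q, 'e) tvec, 'e \<times> 'e) vfield"
  assumes "smooth_manifold A"
    and "riemannian_metric A g"
    and "distribution A m D"
    and "adapted_frame A g m D X"
    and "levi_civita A g nab"
    and "L = kinetic_lagrangian g"
    and "nonholonomic_field A L m D X G"
    and "preserving_modification A D g gh"
  shows "condition_B A L m D X G gh \<longleftrightarrow>
    (\<forall>q\<in>carrier A. \<forall>v\<in>D q. \<forall>J c h.
       nonholonomic_trajectory A D G J c \<and> c 0 = q \<and> velocity A c 0 = v \<and>
       form_cov_deriv_along A (nabla_bar A g D nab) X c J h (multiplier_form A L m X G c) \<and>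
       (\<forall>w\<in>tangent_space A q. h 0 w = 0) \<longrightarrow>
       (\<forall>w\<in>orth_compl A g D q. \<forall>W.
          parallel_along A (nabla_bar A g D nab) X c J W \<and> W 0 = w \<longrightarrow>
          (\<forall>t\<in>J. gh (c t) (velocity A c t) (W t) + h t (W t) = gh q v w)))"
proof -
  interpret nonholonomic_system A g D m X nab gh G
    using assms by unfold_locales simp_all
  show ?thesis unfolding \<open>L = kinetic_lagrangian g\<close> by (rule condition_B_iff_conserved)
qed

end
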